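(* Let $(R,\mathfrak{m})$ be a complete Noetherian local ring of dimension $d\geq 3$, and let $\mathfrak{a}$ be an ideal of $R$ such that $H^d_{\mathfrak{a}}(R)\neq 0$. Let $\mathfrak{b}$ be an ideal of $R$ with $\dim R/\mathfrak{b}=1$ which contains an $R$-regular element $x$ (that is, a nonzerodivisor of $R$). Suppose that $\mathfrak{b}$ does not contain any $D(H^d_{\mathfrak{a}}(R))/xD(H^d_{\mathfrak{a}}(R))$-regular element. Then $D(H^d_{\mathfrak{a}}(R))$ is not a Cohen-Macaulay $R$-module.
   Context: All rings are commutative Noetherian. $H^i_{\mathfrak{a}}(-)$ denotes the $i$-th local cohomology functor with support in $\mathfrak{a}$. $D(-)=\operatorname{Hom}_R(-,E_R(R/\mathfrak{m}))$ is the Matlis dual functor, where $E_R(R/\mathfrak{m})$ is the injective hull of $R/\mathfrak{m}$. For $R$ complete of dimension $d$ with $H^d_{\mathfrak{a}}(R)\neq 0$, $D(H^d_{\mathfrak{a}}(R))$ is a finitely generated $R$-module of Krull dimension $d$. *)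

theory Defs
  imports "HOL-Algebra.Algebra" "HOL-Library.Extended_Nat"
begin

section \<open>Rings\<close>

text \<open>
  The supremum of the lengths \<open>n\<close> of strict chains \<open>p 0 \<subset> \<dots> \<subset> p n\<close> of prime ideals. The zero
  ring, which has no prime ideals, gets dimension \<open>0\<close> here instead of \<open>-\<infinity>\<close>.
\<close>

definition krull_dim :: "('a, 'r) ring_scheme \<Rightarrow> enat" where
  "krull_dim R = Sup {enat n | n. \<exists>p :: nat \<Rightarrow> 'a set.
     (\<forall>i\<le>n. primeideal (p i) R) \<and> (\<forall>i<n. p i \<subset> p (Suc i))}"

abbreviation ideal_pow :: "('a, 'r) ring_scheme \<Rightarrow> 'a set \<Rightarrow> nat \<Rightarrow> 'a set" where
  "ideal_pow R I n \<equiv> I [^]\<^bsub>ideals_set R\<^esub> n"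

locale noetherian_local_ring = noetherian_ring R + cring R for R (structure) +
  fixes \<mm>
  assumes maximal: "maximalideal \<mm> R"
    and maximal_unique: "maximalideal \<nn> R \<Longrightarrow> \<nn> = \<mm>"

text \<open>
  A sequence \<open>f\<close> as below represents an element of the inverse limit of the rings \<open>R/I^n\<close>; the
  condition says that the canonical map from \<open>R\<close> to this limit is bijective.
\<close>

definition adically_complete :: "('a, 'r) ring_scheme \<Rightarrow> 'a set \<Rightarrow> bool" where
  "adically_complete R I \<longleftrightarrow>
     (\<forall>f :: nat \<Rightarrow> 'a. (\<forall>n. f n \<in> carrier R) \<and> (\<forall>n. f (Suc n) \<ominus>\<^bsub>R\<^esub> f n \<in> ideal_pow R I n) \<longrightarrow>
        (\<exists>!l. l \<in> carrier R \<and> (\<forall>n. l \<ominus>\<^bsub>R\<^esub> f n \<in> ideal_pow R I n)))"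


section \<open>Modules\<close>

text \<open>
  The fields \<open>mult\<close> and \<open>one\<close>, which the record of modules inherits from rings, play no role in
  \<^locale>\<open>module\<close>.
\<close>

definition ring_module :: "('a, 'r) ring_scheme \<Rightarrow> ('a, 'a) module" where
  "ring_module R = \<lparr>carrier = carrier R, monoid.mult = monoid.mult R, one = \<one>\<^bsub>R\<^esub>,
     ring.zero = \<zero>\<^bsub>R\<^esub>, add = add R, smult = monoid.mult R\<rparr>"

definition quotient_module :: "('a, 'm) module \<Rightarrow> 'm set \<Rightarrow> ('a, 'm set) module" where
  "quotient_module M N = \<lparr>carrier = a_rcosets\<^bsub>M\<^esub> N, monoid.mult = undefined, one = undefined,
     ring.zero = N, add = set_add M, smult = (\<lambda>r C. \<Union>x\<in>C. N +>\<^bsub>M\<^esub> (r \<odot>\<^bsub>M\<^esub> x))\<rparr>"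

definition submodule_gen :: "('a, 'r) ring_scheme \<Rightarrow> ('a, 'm) module \<Rightarrow> 'm set \<Rightarrow> 'm set" where
  "submodule_gen R M S = \<Inter>{N. submodule N R M \<and> S \<subseteq> N}"

text \<open>The submodule \<open>(S)M\<close>; for \<open>S = {x}\<close> this is \<open>xM\<close>.\<close>

definition mult_submodule :: "('a, 'r) ring_scheme \<Rightarrow> 'a set \<Rightarrow> ('a, 'm) module \<Rightarrow> 'm set" where
  "mult_submodule R S M = submodule_gen R M {s \<odot>\<^bsub>M\<^esub> x | s x. s \<in> S \<and> x \<in> carrier M}"

definition fin_gen_module :: "('a, 'r) ring_scheme \<Rightarrow> ('a, 'm) module \<Rightarrow> bool" where
  "fin_gen_module R M \<longleftrightarrow> (\<exists>S\<subseteq>carrier M. finite S \<and> submodule_gen R M S = carrier M)"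

definition annihilator :: "('a, 'r) ring_scheme \<Rightarrow> ('a, 'm) module \<Rightarrow> 'a set" where
  "annihilator R M = {r \<in> carrier R. \<forall>x\<in>carrier M. r \<odot>\<^bsub>M\<^esub> x = \<zero>\<^bsub>M\<^esub>}"

definition module_hom ::
  "('a, 'r) ring_scheme \<Rightarrow> ('a, 'm) module \<Rightarrow> ('a, 'n) module \<Rightarrow> ('m \<Rightarrow> 'n) set" where
  "module_hom R M N = {f \<in> carrier M \<rightarrow> carrier N.
     (\<forall>x\<in>carrier M. \<forall>y\<in>carrier M. f (x \<oplus>\<^bsub>M\<^esub> y) = f x \<oplus>\<^bsub>N\<^esub> f y) \<and>
     (\<forall>r\<in>carrier R. \<forall>x\<in>carrier M. f (r \<odot>\<^bsub>M\<^esub> x) = r \<odot>\<^bsub>N\<^esub> f x)}"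

definition Hom_module ::
  "('a, 'r) ring_scheme \<Rightarrow> ('a, 'm) module \<Rightarrow> ('a, 'n) module \<Rightarrow> ('a, 'm \<Rightarrow> 'n) module" where
  "Hom_module R M N = \<lparr>carrier = module_hom R M N \<inter> extensional (carrier M),
     monoid.mult = undefined, one = undefined,
     ring.zero = (\<lambda>x\<in>carrier M. \<zero>\<^bsub>N\<^esub>),
     add = (\<lambda>f g. \<lambda>x\<in>carrier M. f x \<oplus>\<^bsub>N\<^esub> g x),
     smult = (\<lambda>r f. \<lambda>x\<in>carrier M. r \<odot>\<^bsub>N\<^esub> f x)\<rparr>"


section \<open>Injective modules, injective hulls and injective resolutions\<close>

text \<open>
  HOL cannot quantify over the types of the test modules \<open>A\<close> and \<open>B\<close>, so these range over the
  modules on the element type of \<open>R\<close>. They include \<open>R\<close> and its ideals; by Baer's criterion nothing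
  is lost.
\<close>

definition injective_module :: "('a, 'r) ring_scheme \<Rightarrow> ('a, 'e) module \<Rightarrow> bool" where
  "injective_module R E \<longleftrightarrow> module R E \<and>
     (\<forall>(A :: ('a, 'a) module) (B :: ('a, 'a) module) i f.
        module R A \<and> module R B \<and> i \<in> module_hom R A B \<and> inj_on i (carrier A) \<and>
        f \<in> module_hom R A E \<longrightarrow>
        (\<exists>g\<in>module_hom R B E. \<forall>x\<in>carrier A. g (i x) = f x))"

definition injective_hull ::
  "('a, 'r) ring_scheme \<Rightarrow> ('a, 'm) module \<Rightarrow> ('a, 'e) module \<Rightarrow> ('m \<Rightarrow> 'e) \<Rightarrow> bool" where
  "injective_hull R M E \<iota> \<longleftrightarrow> injective_module R E \<and>
     \<iota> \<in> module_hom R M E \<and> inj_on \<iota> (carrier M) \<and>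
     (\<forall>N. submodule N R E \<and> N \<noteq> {\<zero>\<^bsub>E\<^esub>} \<longrightarrow> N \<inter> \<iota> ` carrier M \<noteq> {\<zero>\<^bsub>E\<^esub>})"

text \<open>Exactness of \<open>0 \<rightarrow> M \<rightarrow> I 0 \<rightarrow> I 1 \<rightarrow> \<dots>\<close> with all \<open>I n\<close> injective.\<close>

definition injective_resolution ::
  "('a, 'r) ring_scheme \<Rightarrow> ('a, 'm) module \<Rightarrow> (nat \<Rightarrow> ('a, 'i) module) \<Rightarrow>
     (nat \<Rightarrow> 'i \<Rightarrow> 'i) \<Rightarrow> ('m \<Rightarrow> 'i) \<Rightarrow> bool" where
  "injective_resolution R M I \<delta> \<epsilon> \<longleftrightarrow>
     (\<forall>n. injective_module R (I n)) \<and>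
     \<epsilon> \<in> module_hom R M (I 0) \<and> (\<forall>n. \<delta> n \<in> module_hom R (I n) (I (Suc n))) \<and>
     inj_on \<epsilon> (carrier M) \<and>
     \<epsilon> ` carrier M = {x \<in> carrier (I 0). \<delta> 0 x = \<zero>\<^bsub>I 1\<^esub>} \<and>
     (\<forall>n. \<delta> n ` carrier (I n) =
        {x \<in> carrier (I (Suc n)). \<delta> (Suc n) x = \<zero>\<^bsub>I (Suc (Suc n))\<^esub>})"


section \<open>Local cohomology and Matlis duality\<close>

definition torsion_part :: "('a, 'r) ring_scheme \<Rightarrow> 'a set \<Rightarrow> ('a, 'm) module \<Rightarrow> 'm set" where
  "torsion_part R \<aa> M =
     {x \<in> carrier M. \<exists>n. \<forall>r\<in>ideal_pow R \<aa> n. r \<odot>\<^bsub>M\<^esub> x = \<zero>\<^bsub>M\<^esub>}"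

text \<open>
  The \<open>i\<close>-th right derived functor of the \<open>\<aa>\<close>-torsion functor, evaluated on the module of which
  \<open>(I, \<delta>)\<close> is an injective resolution: the cohomology at \<open>i\<close> of the complex of \<open>\<aa>\<close>-torsion parts
  of the \<open>I n\<close>. Up to isomorphism it does not depend on the resolution.
\<close>

definition local_cohomology ::
  "('a, 'r) ring_scheme \<Rightarrow> 'a set \<Rightarrow> (nat \<Rightarrow> ('a, 'i) module) \<Rightarrow> (nat \<Rightarrow> 'i \<Rightarrow> 'i) \<Rightarrow>
     nat \<Rightarrow> ('a, 'i set) module" where
  "local_cohomology R \<aa> I \<delta> i =
     quotient_module
       ((I i)\<lparr>carrier := {x \<in> torsion_part R \<aa> (I i). \<delta> i x = \<zero>\<^bsub>I (Suc i)\<^esub>}\<rparr>)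
       (case i of 0 \<Rightarrow> {\<zero>\<^bsub>I 0\<^esub>} | Suc j \<Rightarrow> \<delta> j ` torsion_part R \<aa> (I j))"

text \<open>\<open>E\<close> is to be an injective hull of the residue field.\<close>

definition matlis_dual ::
  "('a, 'r) ring_scheme \<Rightarrow> ('a, 'e) module \<Rightarrow> ('a, 'm) module \<Rightarrow> ('a, 'm \<Rightarrow> 'e) module" where
  "matlis_dual R E M = Hom_module R M E"


section \<open>Regular elements and Cohen-Macaulay modules\<close>

definition regular_element :: "('a, 'r) ring_scheme \<Rightarrow> ('a, 'm) module \<Rightarrow> 'a \<Rightarrow> bool" where
  "regular_element R M r \<longleftrightarrow> r \<in> carrier R \<and>
     (\<forall>x\<in>carrier M. r \<odot>\<^bsub>M\<^esub> x = \<zero>\<^bsub>M\<^esub> \<longrightarrow> x = \<zero>\<^bsub>M\<^esub>)"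

definition regular_sequence :: "('a, 'r) ring_scheme \<Rightarrow> ('a, 'm) module \<Rightarrow> 'a list \<Rightarrow> bool" where
  "regular_sequence R M rs \<longleftrightarrow>
     (\<forall>i<length rs.
        regular_element R (quotient_module M (mult_submodule R (set (take i rs)) M)) (rs ! i)) \<and>
     mult_submodule R (set rs) M \<noteq> carrier M"

definition depth :: "('a, 'r) ring_scheme \<Rightarrow> 'a set \<Rightarrow> ('a, 'm) module \<Rightarrow> enat" where
  "depth R \<mm> M = Sup {enat (length rs) | rs. set rs \<subseteq> \<mm> \<and> regular_sequence R M rs}"

definition module_dim :: "('a, 'r) ring_scheme \<Rightarrow> ('a, 'm) module \<Rightarrow> enat" where
  "module_dim R M = krull_dim (R Quot annihilator R M)"

definition cohen_macaulay_module ::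
  "('a, 'r) ring_scheme \<Rightarrow> 'a set \<Rightarrow> ('a, 'm) module \<Rightarrow> bool" where
  "cohen_macaulay_module R \<mm> M \<longleftrightarrow> fin_gen_module R M \<and>
     (carrier M = {\<zero>\<^bsub>M\<^esub>} \<or> depth R \<mm> M = module_dim R M)"

end

theory Submission
  imports Defs
begin

text \<open>
  Right-exactness of the top local cohomology is replaced by a diagram chase in the \<open>\<aa>\<close>-torsion of the
  given injective resolution. If \<open>r\<close> kills \<open>H\<close> and \<open>dim R/r < d\<close>, then \<open>\<aa> + (r)\<close> is
  generated up to radical by \<open>r\<close> and \<open>d - 1\<close> further elements; this makes \<open>H\<close> a quotient of an
  \<open>r\<close>-divisible module, so \<open>H = 0\<close>. As \<open>E\<close> is a cogenerator, \<open>Ann K = Ann H\<close>, and prime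
  avoidance then shows \<open>dim K = d\<close>.

  If \<open>K\<close> is Cohen-Macaulay, it has a regular sequence of length at least \<open>d\<close>. Every associated
  prime \<open>p\<close> of a module with a regular sequence of length \<open>n\<close> starts a chain of primes of length
  \<open>n\<close>. So the associated primes of \<open>K\<close> are minimal primes of \<open>R\<close> and do not contain \<open>x\<close>, whence
  \<open>x\<close> is \<open>K\<close>-regular and \<open>K/xK\<close> has a regular sequence of length \<open>d - 1\<close>. An ideal \<open>\<bb>\<close> of zero
  divisors on \<open>K/xK\<close> lies in an associated prime, which gives \<open>dim R/\<bb> \<ge> d - 1 \<ge> 2\<close>.
\<close>

section \<open>Noetherian rings and chains of prime ideals\<close>

text \<open>Modules live on fixed HOL types, and this shapes both halves. Local cohomology comes
  from an arbitrary given injective resolution, so neither a Cech complex nor a change of resolution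
  is at hand. The long exact sequence relating the supports A and A + (r) is replaced by division
  inside an injective module: an element can be divided by \<open>r\<close> up to
  \<open>r\<close>-power torsion without shrinking its annihilator
  (\<open>injective_divide\<close>). For regular sequences, iterated quotients would change the type
  at each step, so M/N is studied inside M while N grows.

  Passing from a regular sequence on K to one on K/xK usually rests on the invariance of the length
  of maximal regular sequences, hence on Ext. Here it is an exchange argument: an element
  \<open>w\<close> that is regular modulo both \<open>x\<close> and the first member
  \<open>y\<close> of the sequence is a bridge between the two.

  Finite generation of K is read off from the Cohen-Macaulay assumption that is being refuted. Of
  dim K the argument uses the lower bound d; upper bounds on chains of primes come from dim R =
  d.\<close>

locale noetherian_cring = noetherian_ring R + cring R for R (structure)

sublocale noetherian_local_ring \<subseteq> noetherian_cring R
  by unfold_locales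

text \<open>The ascending chain condition is kept as well-foundedness of reversed inclusion: one
  relation then yields maximal members, as here, and also Noetherian induction and lexicographic
  combinations of ideals with submodules.\<close>

lemma wf_obtain_maximal:
  assumes "wf {(A, B). P A \<and> P B \<and> B \<subset> A}" "Q A" "\<And>A. Q A \<Longrightarrow> P A"
  obtains B where "Q B" "\<And>C. Q C \<Longrightarrow> B \<subseteq> C \<Longrightarrow> C = B"
proof -
  obtain B where B: "B \<in> Collect Q"
      "\<And>C. (C, B) \<in> {(A, B). P A \<and> P B \<and> B \<subset> A} \<Longrightarrow> C \<notin> Collect Q"
    using wfE_min[OF assms(1), of A "Collect Q"] assms(2) by auto
  show thesis
  proof (rule that)
    show "Q B" using B(1) by simp
    show "C = B" if "Q C" "B \<subseteq> C" for C
      using B(2)[of C] that assms(3)[OF \<open>Q B\<close>] assms(3)[OF that(1)] by auto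
  qed
qed

lemma (in primeideal) pow_memD: "a \<in> carrier R \<Longrightarrow> a [^] (n::nat) \<in> I \<Longrightarrow> a \<in> I"
proof (induction n)
  case 0
  then show ?case using I_notcarr one_imp_carrier by simp
next
  case (Suc n)
  then show ?case using I_prime[of "a [^] n" a] by auto
qed

lemma primeidealD:
  assumes "primeideal P R"
  shows "ideal P R" "P \<subseteq> carrier R" "\<one>\<^bsub>R\<^esub> \<notin> P"
    "a \<in> carrier R \<Longrightarrow> b \<in> carrier R \<Longrightarrow> a \<otimes>\<^bsub>R\<^esub> b \<in> P \<Longrightarrow> a \<in> P \<or> b \<in> P"
proof -
  interpret primeideal P R by fact
  show "ideal P R" by (rule is_ideal)
  show "P \<subseteq> carrier R" by (rule a_subset)
  show "\<one>\<^bsub>R\<^esub> \<notin> P" using I_notcarr one_imp_carrier by blast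
  show "a \<in> carrier R \<Longrightarrow> b \<in> carrier R \<Longrightarrow> a \<otimes>\<^bsub>R\<^esub> b \<in> P \<Longrightarrow> a \<in> P \<or> b \<in> P"
    by (rule I_prime)
qed

lemma (in cring) primeidealI':
  assumes "ideal P R" "\<one> \<notin> P"
    and "\<And>a b. a \<in> carrier R \<Longrightarrow> b \<in> carrier R \<Longrightarrow> a \<otimes> b \<in> P \<Longrightarrow> a \<in> P \<or> b \<in> P"
  shows "primeideal P R"
  using assms by (intro primeidealI is_cring) auto

abbreviation (in ring) adjoin :: "'a set \<Rightarrow> 'a \<Rightarrow> 'a set" where
  "adjoin I u \<equiv> I <+>\<^bsub>R\<^esub> PIdl u"

lemma (in cring) ideal_adjoin:
  assumes "ideal I R" "u \<in> carrier R"
  shows "ideal (adjoin I u) R" "I \<subseteq> adjoin I u" "u \<in> adjoin I u"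
    "y \<in> adjoin I u \<longleftrightarrow> (\<exists>i\<in>I. \<exists>s\<in>carrier R. y = i \<oplus> s \<otimes> u)"
proof -
  interpret ideal I R by fact
  show "ideal (adjoin I u) R" using assms by (simp add: add_ideals cgenideal_ideal)
  show *: "y \<in> adjoin I u \<longleftrightarrow> (\<exists>i\<in>I. \<exists>s\<in>carrier R. y = i \<oplus> s \<otimes> u)" for y
    unfolding set_add_def' cgenideal_def by blast
  show "u \<in> adjoin I u" unfolding * using assms(2)
    by (intro bexI[of _ \<zero>] bexI[of _ \<one>]) auto
  show "I \<subseteq> adjoin I u"
  proof
    fix i assume "i \<in> I"
    then show "i \<in> adjoin I u" unfolding * using assms(2)
      by (intro bexI[of _ i] bexI[of _ \<zero>]) (auto simp: a_Hcarr)
  qed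
qed

section \<open>Prime ideals, radicals and powers of ideals\<close>

context noetherian_cring
begin

lemma wf_ideals: "wf {(A, B). ideal A R \<and> ideal B R \<and> B \<subset> A}"
  unfolding wf_iff_no_infinite_down_chain
proof
  assume "\<exists>f. \<forall>i. (f (Suc i), f i) \<in> {(A, B). ideal A R \<and> ideal B R \<and> B \<subset> A}"
  then obtain f where f: "\<And>i. ideal (f i) R" "\<And>i. f i \<subset> f (Suc i)" by blast
  have mono: "f i \<subseteq> f j" if "i \<le> j" for i j
    using that f(2) by (metis lift_Suc_mono_le psubset_imp_subset)
  have "f i \<subset> f j \<or> f j \<subset> f i \<or> f i = f j" for i j
    using mono[of i j] mono[of j i] nle_le[of i j] by auto
  then have "subset.chain {I. ideal I R} (range f)"
    unfolding subset.chain_def using f(1) by (simp add: image_subset_iff) blast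
  then obtain n where "\<Union>(range f) = f n"
    using ideal_chain_is_trivial[of "range f"] by auto
  then show False using f(2)[of n] by blast
qed

lemmas ideal_induct = wf_induct_rule[OF wf_ideals]

text \<open>An ideal maximal among those that contain \<open>I\<close> and miss \<open>S\<close> is
  prime: if \<open>a\<close> and \<open>b\<close> both lay outside, adjoining either would meet
  \<open>S\<close>, and the product of the two elements found lies in \<open>S\<close> and, because
  of \<open>a \<otimes> b \<in> P\<close>, also in \<open>P\<close>.\<close>

lemma exists_prime_avoiding:
  assumes "ideal I R" "S \<subseteq> carrier R" "\<one> \<in> S"
    and mult: "\<And>s t. s \<in> S \<Longrightarrow> t \<in> S \<Longrightarrow> s \<otimes> t \<in> S" and "I \<inter> S = {}"
  obtains P where "primeideal P R" "I \<subseteq> P" "P \<inter> S = {}"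
proof -
  obtain P where P: "ideal P R" "I \<subseteq> P" "P \<inter> S = {}"
    and max: "\<And>C. ideal C R \<Longrightarrow> I \<subseteq> C \<Longrightarrow> C \<inter> S = {} \<Longrightarrow> P \<subseteq> C \<Longrightarrow> C = P"
    using wf_obtain_maximal[OF wf_ideals, of "\<lambda>C. ideal C R \<and> I \<subseteq> C \<and> C \<inter> S = {}" I] assms(1,5)
    by (metis order_refl)
  interpret P: ideal P R by fact
  have adj: "\<exists>p\<in>P. \<exists>s\<in>carrier R. p \<oplus> s \<otimes> a \<in> S" if a: "a \<in> carrier R" "a \<notin> P" for a
  proof -
    have "adjoin P a \<noteq> P" using ideal_adjoin(3)[OF P(1) a(1)] a(2) by blast
    then have "(adjoin P a) \<inter> S \<noteq> {}"
      using max[of "adjoin P a"] ideal_adjoin[OF P(1) a(1)] P(2) by blast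
    then obtain y where y: "y \<in> adjoin P a" "y \<in> S" by blast
    then show ?thesis using ideal_adjoin(4)[OF P(1) a(1), THEN iffD1, OF y(1)] by auto
  qed
  have "primeideal P R"
  proof (rule primeidealI'[OF P(1)])
    show "\<one> \<notin> P" using P(3) assms(3) by blast
    fix a b assume ab: "a \<in> carrier R" "b \<in> carrier R" "a \<otimes> b \<in> P"
    show "a \<in> P \<or> b \<in> P"
    proof (rule ccontr)
      assume "\<not> (a \<in> P \<or> b \<in> P)"
      then obtain p s q t where ps: "p \<in> P" "s \<in> carrier R" "p \<oplus> s \<otimes> a \<in> S"
        and qt: "q \<in> P" "t \<in> carrier R" "q \<oplus> t \<otimes> b \<in> S" using adj ab by metis
      have pc: "p \<in> carrier R" "q \<in> carrier R" using ps(1) qt(1) P.a_Hcarr by auto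
      have "(p \<oplus> s \<otimes> a) \<otimes> (q \<oplus> t \<otimes> b) = p \<otimes> (q \<oplus> t \<otimes> b) \<oplus> ((s \<otimes> a) \<otimes> q \<oplus> (s \<otimes> t) \<otimes> (a \<otimes> b))"
        using pc ab ps(2) qt(2) by algebra
      also have "\<dots> \<in> P"
        using pc ab ps(1,2) qt(1,2) by (intro P.a_closed[OF P.I_r_closed P.a_closed[OF P.I_l_closed P.I_l_closed]]) auto
      finally show False using mult[OF ps(3) qt(3)] P(3) by blast
    qed
  qed
  then show thesis using that P by blast
qed

text \<open>If all powers of \<open>a\<close> were outside \<open>I\<close>, some prime over
  \<open>I\<close> would miss this multiplicative set.\<close>

lemma radical_pow_mem:
  assumes "ideal I R" "a \<in> carrier R" "\<And>P. primeideal P R \<Longrightarrow> I \<subseteq> P \<Longrightarrow> a \<in> P"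
  shows "\<exists>n::nat. a [^] n \<in> I"
proof (rule ccontr)
  assume neg: "\<nexists>n::nat. a [^] n \<in> I"
  obtain P where "primeideal P R" "I \<subseteq> P" "P \<inter> range (\<lambda>n::nat. a [^] n) = {}"
  proof (rule exists_prime_avoiding[OF assms(1)])
    show "range (\<lambda>n::nat. a [^] n) \<subseteq> carrier R" using assms(2) by auto
    show "\<one> \<in> range (\<lambda>n::nat. a [^] n)" by (rule range_eqI[of _ _ 0]) simp
    show "s \<otimes> t \<in> range (\<lambda>n::nat. a [^] n)"
      if "s \<in> range (\<lambda>n::nat. a [^] n)" "t \<in> range (\<lambda>n::nat. a [^] n)" for s t
      using that assms(2) by (auto simp: nat_pow_mult)
    show "I \<inter> range (\<lambda>n::nat. a [^] n) = {}" using neg by auto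
  qed
  moreover have "a [^] (1::nat) = a" using assms(2) by simp
  ultimately show False using assms(3)[of P] by (metis disjoint_iff rangeI)
qed

text \<open>Noetherian induction: if \<open>a \<otimes> b \<in> I\<close> with neither factor in
  \<open>I\<close>, each prime over \<open>I\<close> contains \<open>a\<close> or \<open>b\<close>,
  hence lies over one of two larger ideals. The set obtained may also contain non-minimal primes;
  what counts is that every prime over \<open>I\<close> lies above a member.\<close>

lemma finite_minimal_primes:
  assumes "ideal I R"
  shows "\<exists>F. finite F \<and> (\<forall>p\<in>F. primeideal p R \<and> I \<subseteq> p) \<and>
    (\<forall>P. primeideal P R \<and> I \<subseteq> P \<longrightarrow> (\<exists>p\<in>F. p \<subseteq> P))"
  using assms
proof (induction I rule: ideal_induct)
  case (1 I)
  interpret ideal I R by fact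
  consider "\<one> \<in> I" | "primeideal I R"
    | a b where "a \<in> carrier R" "b \<in> carrier R" "a \<otimes> b \<in> I" "a \<notin> I" "b \<notin> I"
    using primeidealI'[OF 1(2)] by blast
  then show ?case
  proof cases
    case 1
    then show ?thesis by (intro exI[of _ "{}"]) (auto dest: primeidealD(3))
  next
    case 2
    then show ?thesis by (intro exI[of _ "{I}"]) auto
  next
    case ab: 3
    note adj = ideal_adjoin[OF 1(2) ab(1)] ideal_adjoin[OF 1(2) ab(2)]
    obtain F where F: "finite F" "\<forall>p\<in>F. primeideal p R \<and> adjoin I a \<subseteq> p"
      "\<forall>P. primeideal P R \<and> adjoin I a \<subseteq> P \<longrightarrow> (\<exists>p\<in>F. p \<subseteq> P)"
      using 1(1)[of "adjoin I a"] adj ab(4) 1(2) by blast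
    obtain G where G: "finite G" "\<forall>p\<in>G. primeideal p R \<and> adjoin I b \<subseteq> p"
      "\<forall>P. primeideal P R \<and> adjoin I b \<subseteq> P \<longrightarrow> (\<exists>p\<in>G. p \<subseteq> P)"
      using 1(1)[of "adjoin I b"] adj ab(5) 1(2) by blast
    have "\<exists>p\<in>F \<union> G. p \<subseteq> P" if P: "primeideal P R" "I \<subseteq> P" for P
    proof -
      interpret P: primeideal P R by fact
      have sub: "adjoin I c \<subseteq> P" if c: "c \<in> carrier R" "c \<in> P" for c
        using ideal_adjoin(4)[OF 1(2) c(1)] P(2) c by (auto intro!: P.a_closed P.I_l_closed)
      have "a \<in> P \<or> b \<in> P" using ab P by (intro P.I_prime) auto
      then show ?thesis
      proof
        assume "a \<in> P"
        then show ?thesis using F(3) P(1) sub[OF ab(1)] by blast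
      next
        assume "b \<in> P"
        then show ?thesis using G(3) P(1) sub[OF ab(2)] by blast
      qed
    qed
    moreover have "primeideal p R \<and> I \<subseteq> p" if "p \<in> F \<union> G" for p
      using that F(2) G(2) adj(2,6) by blast
    ultimately show ?thesis using F(1) G(1) by (intro exI[of _ "F \<union> G"]) simp
  qed
qed

lemma ideals_set_simps: "\<one>\<^bsub>ideals_set R\<^esub> = carrier R" "I \<otimes>\<^bsub>ideals_set R\<^esub> J = I \<cdot> J"
  by (simp_all add: ideals_set_def)

lemma ideal_pow_ideal: "ideal I R \<Longrightarrow> ideal (ideal_pow R I n) R"
  by (induction n) (auto simp: ideals_set_simps oneideal ideal_prod_is_ideal)

lemma pow_mem_ideal_pow: "s \<in> I \<Longrightarrow> s [^] n \<in> ideal_pow R I n" if "ideal I R" for I and n :: nat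
proof (induction n)
  case 0
  then show ?case by (simp add: ideals_set_simps)
next
  case (Suc n)
  then show ?case by (auto simp: ideals_set_simps intro: ideal_prod.prod)
qed

lemma ideal_prodE:
  assumes "y \<in> I \<cdot> J" "ideal C R" "\<And>i j. i \<in> I \<Longrightarrow> j \<in> J \<Longrightarrow> i \<otimes> j \<in> C"
  shows "y \<in> C"
  using assms(1)
proof induction
  case (sum s t)
  then show ?case using assms(2) by (simp add: additive_subgroup.a_closed ideal.axioms(1))
qed (use assms in auto)

lemma ideal_pow_add_mult:
  assumes "ideal I R" "ideal_pow R I m \<subseteq> A" "ideal_pow R I n \<subseteq> B" "ideal C R"
    and "\<And>i j. i \<in> A \<Longrightarrow> j \<in> B \<Longrightarrow> i \<otimes> j \<in> C"
  shows "ideal_pow R I (m + n) \<subseteq> C"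
proof -
  have "ideal_pow R I (m + n) = ideal_pow R I m \<cdot> ideal_pow R I n"
  proof (induction n)
    case 0
    then show ?case using ideal_pow_ideal[OF assms(1)]
      by (simp add: ideals_set_simps ideal_prod_one)
  next
    case (Suc n)
    then show ?case using ideal_pow_ideal[OF assms(1)] assms(1)
      by (simp add: ideals_set_simps ideal_prod_assoc)
  qed
  moreover have "y \<in> C" if y: "y \<in> ideal_pow R I m \<cdot> ideal_pow R I n" for y
    using y by (rule ideal_prodE[OF _ assms(4)]) (use assms(2,3,5) in blast)
  ultimately show ?thesis by auto
qed

text \<open>The exponent must be uniform although each \<open>s\<close> comes with its own.
  Noetherian induction on \<open>C\<close> avoids choosing generators of \<open>I\<close>: the
  product of \<open>adjoin C a\<close> and \<open>adjoin C b\<close> lies in \<open>C\<close> when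
  \<open>a \<otimes> b\<close> does, so the exponents for the two larger ideals add up.\<close>

lemma ideal_pow_subset_of_radical:
  assumes "ideal I R" "ideal C R" "\<And>s. s \<in> I \<Longrightarrow> \<exists>n::nat. s [^] n \<in> C"
  shows "\<exists>n. ideal_pow R I n \<subseteq> C"
  using assms(2,3)
proof (induction C rule: ideal_induct)
  case (1 C)
  interpret C: ideal C R by fact
  consider "\<one> \<in> C" | "primeideal C R"
    | a b where "a \<in> carrier R" "b \<in> carrier R" "a \<otimes> b \<in> C" "a \<notin> C" "b \<notin> C"
    using primeidealI'[OF 1(2)] by blast
  then show ?case
  proof cases
    case 1
    then show ?thesis using C.one_imp_carrier by (intro exI[of _ 0]) (simp add: ideals_set_simps)
  next
    case 2
    have "I \<subseteq> C"
    proof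
      fix s assume s: "s \<in> I"
      then obtain n :: nat where "s [^] n \<in> C" using 1(3) by blast
      then show "s \<in> C" using primeideal.pow_memD[OF 2 ideal.Icarr[OF assms(1) s]] by simp
    qed
    then show ?thesis using assms(1)
      by (intro exI[of _ "Suc 0"])
        (auto simp: ideals_set_simps elim!: ideal_prodE[OF _ C.is_ideal] intro: C.I_l_closed)
  next
    case ab: 3
    note adj = ideal_adjoin[OF 1(2) ab(1)] ideal_adjoin[OF 1(2) ab(2)]
    have "\<exists>m. ideal_pow R I m \<subseteq> adjoin C a"
    proof (rule 1(1))
      show "(adjoin C a, C) \<in> {(A, B). ideal A R \<and> ideal B R \<and> B \<subset> A}"
        using adj(1-3) ab(4) 1(2) by blast
      show "\<exists>n::nat. s [^] n \<in> adjoin C a" if "s \<in> I" for s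
        using 1(3)[OF that] adj(2) by blast
    qed (rule adj(1))
    then obtain m where m: "ideal_pow R I m \<subseteq> adjoin C a" ..
    have "\<exists>n. ideal_pow R I n \<subseteq> adjoin C b"
    proof (rule 1(1))
      show "(adjoin C b, C) \<in> {(A, B). ideal A R \<and> ideal B R \<and> B \<subset> A}"
        using adj(5-7) ab(5) 1(2) by blast
      show "\<exists>n::nat. s [^] n \<in> adjoin C b" if "s \<in> I" for s
        using 1(3)[OF that] adj(6) by blast
    qed (rule adj(5))
    then obtain n where n: "ideal_pow R I n \<subseteq> adjoin C b" ..
    have "y \<otimes> z \<in> C" if yz: "y \<in> adjoin C a" "z \<in> adjoin C b" for y z
    proof -
      obtain p s where ps: "p \<in> C" "s \<in> carrier R" "y = p \<oplus> s \<otimes> a"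
        using adj(4)[THEN iffD1, OF yz(1)] by blast
      obtain q t where qt: "q \<in> C" "t \<in> carrier R" "z = q \<oplus> t \<otimes> b"
        using adj(8)[THEN iffD1, OF yz(2)] by blast
      note * = ps qt
      have pc: "p \<in> carrier R" "q \<in> carrier R" using * C.a_Hcarr by auto
      have "y \<otimes> z = p \<otimes> (q \<oplus> t \<otimes> b) \<oplus> ((s \<otimes> a) \<otimes> q \<oplus> (s \<otimes> t) \<otimes> (a \<otimes> b))"
        using pc ab * by algebra
      also have "\<dots> \<in> C"
        using pc ab * by (intro C.a_closed[OF C.I_r_closed C.a_closed[OF C.I_l_closed C.I_l_closed]]) auto
      finally show ?thesis .
    qed
    then show ?thesis using ideal_pow_add_mult[OF assms(1) m n 1(2)] by blast
  qed
qed

end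

section \<open>Prime avoidance\<close>

context cring
begin

lemma prime_prod_not_mem:
  assumes "primeideal p R" "finite F" "\<And>q. q \<in> F \<Longrightarrow> ideal q R" "\<And>q. q \<in> F \<Longrightarrow> \<not> q \<subseteq> p"
    and "ideal I R" "\<not> I \<subseteq> p"
  shows "\<exists>s\<in>I. s \<notin> p \<and> (\<forall>q\<in>F. s \<in> q)"
  using assms(2-4)
proof (induction F)
  case empty
  then show ?case using assms(6) by blast
next
  case (insert q F)
  then obtain s where s: "s \<in> I" "s \<notin> p" "\<forall>q\<in>F. s \<in> q" by auto
  obtain t where t: "t \<in> q" "t \<notin> p" using insert.prems by auto
  have "s \<in> carrier R" "t \<in> carrier R"
    using s t insert.prems(1)[of q] assms(5) ideal.Icarr by auto
  note st = this
  have "s \<otimes> t \<in> I" by (rule ideal.I_r_closed[OF assms(5) s(1) st(2)])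
  moreover have "s \<otimes> t \<notin> p" using primeidealD(4)[OF assms(1) st] s(2) t(2) by blast
  moreover have "s \<otimes> t \<in> q" using ideal.I_l_closed[OF _ t(1) st(1)] insert.prems(1) by blast
  moreover have "s \<otimes> t \<in> q'" if "q' \<in> F" for q'
    using ideal.I_r_closed[OF _ _ st(2)] insert.prems(1) s(3) that by blast
  ultimately show ?case by blast
qed

lemma prime_avoidance:
  assumes "finite F" "\<And>p. p \<in> F \<Longrightarrow> primeideal p R" "ideal I R" "\<And>p. p \<in> F \<Longrightarrow> \<not> I \<subseteq> p"
  shows "\<exists>r\<in>I. \<forall>p\<in>F. r \<notin> p"
  using assms(1,2,4)
proof (induction F rule: finite_psubset_induct)
  case (psubset F)
  interpret I: ideal I R by fact
  show ?case
  proof (cases "F = {}")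
    case True
    then show ?thesis using I.zero_closed by blast
  next
    case False
    then obtain p where p: "p \<in> F" by blast
    show ?thesis
    proof (cases "\<exists>q\<in>F - {p}. q \<subseteq> p")
      case True
      then obtain q where q: "q \<in> F" "q \<noteq> p" "q \<subseteq> p" by blast
      have "\<exists>r\<in>I. \<forall>p\<in>F - {q}. r \<notin> p"
        using psubset.prems q(1) by (intro psubset.IH) blast+
      then obtain r where r: "r \<in> I" "\<forall>p\<in>F - {q}. r \<notin> p" by blast
      then show ?thesis using p q by (intro bexI[of _ r]) auto
    next
      case False
      have "\<exists>r\<in>I. \<forall>q\<in>F - {p}. r \<notin> q"
        using psubset.prems p by (intro psubset.IH) blast+
      then obtain r where r: "r \<in> I" "\<forall>q\<in>F - {p}. r \<notin> q" by blast
      have P: "primeideal p R" "\<not> I \<subseteq> p" using p psubset by auto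
      have "\<exists>s\<in>I. s \<notin> p \<and> (\<forall>q\<in>F - {p}. s \<in> q)"
        using psubset(1,3) P assms(3) False by (intro prime_prod_not_mem) (auto intro: primeidealD(1))
      then obtain s where s: "s \<in> I" "s \<notin> p" "\<forall>q\<in>F - {p}. s \<in> q" by blast
      have rs: "r \<in> carrier R" "s \<in> carrier R" using r s I.Icarr by auto
      have eq: "(r \<oplus> s) \<oplus> \<ominus> r = s" "(r \<oplus> s) \<oplus> \<ominus> s = r" using rs by algebra+
      have "r \<oplus> s \<notin> q" if r: "r \<in> p" and q: "q \<in> F" for q
      proof
        assume a: "r \<oplus> s \<in> q"
        interpret q: ideal q R using psubset(3) q primeidealD(1) by blast
        show False
        proof (cases "q = p")
          case True
          then show False using q.a_closed[OF a q.a_inv_closed[of r]] r s eq by auto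
        next
          case False
          then show False
            using q.a_closed[OF a q.a_inv_closed[of s]] q s \<open>\<forall>q\<in>F - {p}. r \<notin> q\<close> eq by auto
        qed
      qed
      then show ?thesis using r s I.a_closed[OF r(1) s(1)] by blast
    qed
  qed
qed

end

section \<open>Chains of primes and the dimension of quotient rings\<close>

definition prime_chain :: "('a, 'r) ring_scheme \<Rightarrow> nat \<Rightarrow> (nat \<Rightarrow> 'a set) \<Rightarrow> bool" where
  "prime_chain R n p \<longleftrightarrow> (\<forall>i\<le>n. primeideal (p i) R) \<and> (\<forall>i<n. p i \<subset> p (Suc i))"

lemma prime_chain_0: "primeideal q R \<Longrightarrow> prime_chain R 0 (\<lambda>_. q)"
  by (simp add: prime_chain_def)

lemma prime_chain_primeideal: "prime_chain R n p \<Longrightarrow> i \<le> n \<Longrightarrow> primeideal (p i) R"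
  by (simp add: prime_chain_def)

lemma prime_chain_mono: "prime_chain R n p \<Longrightarrow> i \<le> j \<Longrightarrow> j \<le> n \<Longrightarrow> p i \<subseteq> p j"
proof (induction j)
  case (Suc j)
  then show ?case
    by (cases "i = Suc j") (auto simp: prime_chain_def less_Suc_eq_le dest!: Suc_le_lessD)
qed auto

lemma prime_chain_Cons:
  assumes "prime_chain R n p" "primeideal q R" "q \<subset> p 0"
  shows "prime_chain R (Suc n) (case_nat q p)"
  using assms unfolding prime_chain_def by (auto split: nat.split simp: less_Suc_eq_0_disj)

lemma prime_chain_snoc:
  assumes "prime_chain R n p" "primeideal q R" "p n \<subset> q"
  shows "prime_chain R (Suc n) (p(Suc n := q))"
  using assms unfolding prime_chain_def by (auto simp: less_Suc_eq le_Suc_eq)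

lemma prime_chain_take: "prime_chain R n p \<Longrightarrow> m \<le> n \<Longrightarrow> prime_chain R m p"
  by (auto simp: prime_chain_def)

lemma krull_dim_prime_chain: "krull_dim R = Sup {enat n | n. \<exists>p. prime_chain R n p}"
  by (simp add: krull_dim_def prime_chain_def)

lemma prime_chain_le_krull_dim: "prime_chain R n p \<Longrightarrow> enat n \<le> krull_dim R"
  unfolding krull_dim_prime_chain by (rule Sup_upper) auto

text \<open>The supremum may be infinite and unattained, but \<open>n - 1\<close> lies strictly
  below it, so some member exceeds \<open>n - 1\<close>. For \<open>n = 0\<close> this would fail,
  as the empty set has supremum 0.\<close>

lemma Sup_enat_ge_obtain:
  assumes "enat n \<le> Sup A" "n > 0"
  obtains a where "a \<in> A" "enat n \<le> a"
proof -
  have "enat (n - 1) < Sup A" using assms by (metis diff_less enat_ord_simps(2) less_le_trans zero_less_one)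
  then obtain a where "a \<in> A" "enat (n - 1) < a" by (auto simp: less_Sup_iff)
  moreover from this have "enat n \<le> a" using assms(2)
    by (metis Suc_diff_1 Suc_ile_eq)
  ultimately show thesis using that by blast
qed

lemma (in cring) quotient_prime:
  assumes "ideal J R" "primeideal p R" "J \<subseteq> p"
  shows "primeideal ((+>) J ` p) (R Quot J)"
    and "(+>) J ` p = (+>) J ` q \<Longrightarrow> J \<subseteq> q \<Longrightarrow> ideal q R \<Longrightarrow> p \<subseteq> q"
proof -
  interpret J: ideal J R by fact
  interpret Q: cring "R Quot J" by (rule J.quotient_is_cring) (rule is_cring)
  interpret h: ring_hom_ring R "R Quot J" "(+>) J" by (rule J.rcos_ring_hom_ring)
  interpret p: primeideal p R by fact
  \<comment> \<open>The coset of \<open>a\<close> need only have some representative in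
    \<open>q\<close>; \<open>J \<subseteq> q\<close> then brings in \<open>a\<close> itself.
    Properness, primality and strict inclusion of the images all come from this.\<close>
  have mem: "a \<in> q" if a: "J +> a \<in> (+>) J ` q" "a \<in> carrier R" "ideal q R" "J \<subseteq> q" for a q
  proof -
    interpret q: ideal q R by fact
    obtain b where b: "b \<in> q" "J +> a = J +> b" using a(1) by (rule imageE)
    have "b \<in> carrier R" using b q.a_Hcarr by auto
    then have "a \<ominus> b \<in> J" using b a(2) quotient_eq_iff_same_a_r_cos[OF assms(1)] by blast
    then have "(a \<ominus> b) \<oplus> b \<in> q" using that(4) b by (intro q.a_closed) auto
    moreover have "(a \<ominus> b) \<oplus> b = a" using that(2) \<open>b \<in> carrier R\<close> by algebra
    ultimately show ?thesis by simp
  qed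
  show "p \<subseteq> q" if "(+>) J ` p = (+>) J ` q" "J \<subseteq> q" "ideal q R"
  proof
    fix a assume "a \<in> p"
    then show "a \<in> q" using mem[of a q] p.a_Hcarr[of a] that by (metis imageI)
  qed
  have car: "\<exists>a\<in>carrier R. U = J +> a" if "U \<in> carrier (R Quot J)" for U
    using that unfolding FactRing_def A_RCOSETS_def' by simp
  show "primeideal ((+>) J ` p) (R Quot J)"
  proof (rule Q.primeidealI')
    show "ideal ((+>) J ` p) (R Quot J)"
    proof (rule idealI[OF Q.ring_axioms])
      show "subgroup ((+>) J ` p) (add_monoid (R Quot J))"
      proof (rule Q.add.subgroupI)
        show "(+>) J ` p \<subseteq> carrier (R Quot J)" using p.a_Hcarr h.hom_closed by blast
        show "(+>) J ` p \<noteq> {}" using p.zero_closed by blast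
        fix U assume "U \<in> (+>) J ` p"
        then obtain a where a: "a \<in> p" "U = J +> a" by blast
        then have "\<ominus>\<^bsub>R Quot J\<^esub> U = J +> (\<ominus> a)" using p.a_Hcarr h.hom_a_inv by auto
        then show "\<ominus>\<^bsub>R Quot J\<^esub> U \<in> (+>) J ` p" using a(1) by (metis imageI p.a_inv_closed)
        fix V assume "V \<in> (+>) J ` p"
        then obtain b where b: "b \<in> p" "V = J +> b" by blast
        then have "U \<oplus>\<^bsub>R Quot J\<^esub> V = J +> (a \<oplus> b)" using a p.a_Hcarr h.hom_add by auto
        then show "U \<oplus>\<^bsub>R Quot J\<^esub> V \<in> (+>) J ` p" using a(1) b(1) by (metis imageI p.a_closed)
      qed
      fix U V assume "U \<in> (+>) J ` p" "V \<in> carrier (R Quot J)"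
      then obtain a b where a: "a \<in> p" "U = J +> a" and b: "b \<in> carrier R" "V = J +> b"
        using car by blast
      then have "V \<otimes>\<^bsub>R Quot J\<^esub> U = J +> (b \<otimes> a)" using p.a_Hcarr h.hom_mult by auto
      then show "V \<otimes>\<^bsub>R Quot J\<^esub> U \<in> (+>) J ` p" using p.I_l_closed[OF a(1) b(1)] by blast
      have "U \<otimes>\<^bsub>R Quot J\<^esub> V = J +> (a \<otimes> b)" using a b p.a_Hcarr h.hom_mult by auto
      then show "U \<otimes>\<^bsub>R Quot J\<^esub> V \<in> (+>) J ` p" using p.I_r_closed[OF a(1) b(1)] by blast
    qed
    show "\<one>\<^bsub>R Quot J\<^esub> \<notin> (+>) J ` p"
      using mem[of \<one> p] assms p.is_ideal primeidealD(3)[OF assms(2)] h.hom_one by auto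
    fix U V assume U: "U \<in> carrier (R Quot J)" and V: "V \<in> carrier (R Quot J)"
      and XY: "U \<otimes>\<^bsub>R Quot J\<^esub> V \<in> (+>) J ` p"
    then obtain a b where a: "a \<in> carrier R" "U = J +> a" and b: "b \<in> carrier R" "V = J +> b"
      using car by blast
    then have "J +> (a \<otimes> b) \<in> (+>) J ` p" using XY h.hom_mult by auto
    then have "a \<otimes> b \<in> p" using mem a b p.is_ideal assms(3) by blast
    then show "U \<in> (+>) J ` p \<or> V \<in> (+>) J ` p" using p.I_prime a b by blast
  qed
qed

lemma (in cring) krull_dim_Quot_ge:
  assumes "ideal J R" "prime_chain R n p" "J \<subseteq> p 0"
  shows "enat n \<le> krull_dim (R Quot J)"
proof (rule prime_chain_le_krull_dim)
  have J: "J \<subseteq> p i" if "i \<le> n" for i using prime_chain_mono[OF assms(2), of 0 i] assms(3) that by auto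
  show "prime_chain (R Quot J) n (\<lambda>i. (+>) J ` p i)"
    unfolding prime_chain_def
  proof safe
    show "primeideal ((+>) J ` p i) (R Quot J)" if "i \<le> n" for i
      using quotient_prime(1)[OF assms(1) prime_chain_primeideal[OF assms(2) that] J[OF that]] .
    fix i assume i: "i < n"
    then have sub: "p i \<subset> p (Suc i)" "primeideal (p (Suc i)) R" "primeideal (p i) R"
      using assms(2) by (auto simp: prime_chain_def)
    show "J +> a \<in> (+>) J ` p (Suc i)" if "a \<in> p i" for a
      using sub that by blast
    assume "(+>) J ` p i = (+>) J ` p (Suc i)"
    then have "p (Suc i) \<subseteq> p i"
      using quotient_prime(2)[OF assms(1) sub(2) J[of "Suc i"], of "p i"] i J[of i] primeidealD(1)[OF sub(3)]
      by simp
    then show False using sub by blast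
  qed
qed

section \<open>Associated primes and regular sequences modulo submodules\<close>

lemma (in noetherian_local_ring) proper_ideal_subset:
  assumes "ideal I R" "\<one> \<notin> I"
  shows "I \<subseteq> \<mm>"
proof -
  obtain J where J: "ideal J R" "\<one> \<notin> J" "I \<subseteq> J"
    and max: "\<And>C. ideal C R \<Longrightarrow> \<one> \<notin> C \<Longrightarrow> I \<subseteq> C \<Longrightarrow> J \<subseteq> C \<Longrightarrow> C = J"
    using wf_obtain_maximal[OF wf_ideals, of "\<lambda>C. ideal C R \<and> \<one> \<notin> C \<and> I \<subseteq> C" I] assms
    by (metis order_refl)
  have "maximalideal J R"
  proof (rule maximalidealI[OF J(1)])
    show "carrier R \<noteq> J" using J(2) by blast
    show "C = J \<or> C = carrier R" if "ideal C R" "J \<subseteq> C" "C \<subseteq> carrier R" for C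
      using that J(3) max[of C] ideal.one_imp_carrier[of C R] by blast
  qed
  then show ?thesis using maximal_unique J(3) by blast
qed

lemma (in noetherian_local_ring) max_ideal: "ideal \<mm> R" "\<one> \<notin> \<mm>" "\<mm> \<subseteq> carrier R" "primeideal \<mm> R"
proof -
  interpret maximalideal \<mm> R by (rule maximal)
  show "ideal \<mm> R" by (rule is_ideal)
  show "\<mm> \<subseteq> carrier R" by (rule a_subset)
  show "\<one> \<notin> \<mm>" using I_notcarr one_imp_carrier by blast
  show "primeideal \<mm> R" by (rule maximalideal_prime[OF maximal])
qed

lemma (in noetherian_local_ring) unit_one_minus:
  assumes "y \<in> \<mm>" "s \<in> carrier R"
  obtains t where "t \<in> carrier R" "t \<otimes> (\<one> \<ominus> s \<otimes> y) = \<one>"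
proof -
  interpret m: ideal \<mm> R by (rule max_ideal)
  have y: "y \<in> carrier R" using assms(1) m.a_Hcarr by blast
  let ?e = "\<one> \<ominus> s \<otimes> y"
  have e: "?e \<in> carrier R" using y assms(2) by simp
  have "?e \<notin> \<mm>"
  proof
    assume "?e \<in> \<mm>"
    then have "?e \<oplus> s \<otimes> y \<in> \<mm>" using assms by (intro m.a_closed m.I_l_closed)
    moreover have "?e \<oplus> s \<otimes> y = \<one>" using y assms(2) by algebra
    ultimately show False using max_ideal(2) by simp
  qed
  then have "\<one> \<in> PIdl ?e"
    using proper_ideal_subset[OF cgenideal_ideal[OF e]] cgenideal_self[OF e] by blast
  then obtain t where "t \<in> carrier R" "\<one> = t \<otimes> ?e" unfolding cgenideal_def by blast
  then show thesis using that by simp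
qed

section \<open>Module notions relative to a submodule\<close>

context module
begin

lemma submoduleD:
  assumes "submodule N R M"
  shows "\<And>x. x \<in> N \<Longrightarrow> x \<in> carrier M" "\<zero>\<^bsub>M\<^esub> \<in> N"
    "\<And>x y. x \<in> N \<Longrightarrow> y \<in> N \<Longrightarrow> x \<oplus>\<^bsub>M\<^esub> y \<in> N" "\<And>x. x \<in> N \<Longrightarrow> \<ominus>\<^bsub>M\<^esub> x \<in> N"
    "\<And>x y. x \<in> N \<Longrightarrow> y \<in> N \<Longrightarrow> x \<ominus>\<^bsub>M\<^esub> y \<in> N"
    "\<And>r x. r \<in> carrier R \<Longrightarrow> x \<in> N \<Longrightarrow> r \<odot>\<^bsub>M\<^esub> x \<in> N"
proof -
  note E = submoduleE[OF assms]
  show "\<And>x. x \<in> N \<Longrightarrow> x \<in> carrier M" "\<And>x y. x \<in> N \<Longrightarrow> y \<in> N \<Longrightarrow> x \<oplus>\<^bsub>M\<^esub> y \<in> N"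
    "\<And>x. x \<in> N \<Longrightarrow> \<ominus>\<^bsub>M\<^esub> x \<in> N" "\<And>r x. r \<in> carrier R \<Longrightarrow> x \<in> N \<Longrightarrow> r \<odot>\<^bsub>M\<^esub> x \<in> N"
    using E by auto
  then show "\<And>x y. x \<in> N \<Longrightarrow> y \<in> N \<Longrightarrow> x \<ominus>\<^bsub>M\<^esub> y \<in> N" by (simp add: a_minus_def)
  obtain x where "x \<in> N" using E(2) by blast
  then show "\<zero>\<^bsub>M\<^esub> \<in> N" using E(1) E(4)[of \<zero> x] by auto
qed

lemma submodule_add_cancel:
  assumes "submodule N R M" "n \<in> N" "u \<in> carrier M" "n \<oplus>\<^bsub>M\<^esub> u \<in> N"
  shows "u \<in> N"
proof -
  note N = submoduleD[OF assms(1)]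
  have "n \<in> carrier M" using N(1) assms(2) .
  then have "u = (\<ominus>\<^bsub>M\<^esub> n) \<oplus>\<^bsub>M\<^esub> (n \<oplus>\<^bsub>M\<^esub> u)" using assms(3) by (simp add: M.r_neg1)
  then show ?thesis using N(3)[OF N(4)[OF assms(2)] assms(4)] by simp
qed

lemma submoduleI':
  assumes "N \<subseteq> carrier M" "\<zero>\<^bsub>M\<^esub> \<in> N" "\<And>x y. x \<in> N \<Longrightarrow> y \<in> N \<Longrightarrow> x \<oplus>\<^bsub>M\<^esub> y \<in> N"
    "\<And>r x. r \<in> carrier R \<Longrightarrow> x \<in> N \<Longrightarrow> r \<odot>\<^bsub>M\<^esub> x \<in> N"
  shows "submodule N R M"
proof (rule submoduleI)
  fix a assume "a \<in> N"
  then have "\<ominus>\<^bsub>M\<^esub> a = (\<ominus> \<one>) \<odot>\<^bsub>M\<^esub> a" using assms(1) by (auto simp: smult_l_minus)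
  then show "\<ominus>\<^bsub>M\<^esub> a \<in> N" using assms(4)[of "\<ominus> \<one>" a] \<open>a \<in> N\<close> by simp
qed (use assms in auto)

lemma submodule_zero: "submodule {\<zero>\<^bsub>M\<^esub>} R M"
  by (rule submoduleI') auto

lemma submodule_Int: "submodule A R M \<Longrightarrow> submodule B R M \<Longrightarrow> submodule (A \<inter> B) R M"
  by (rule submoduleI') (auto simp: submoduleD)

lemma submodule_sum:
  assumes "submodule A R M" "submodule B R M"
  shows "submodule {a \<oplus>\<^bsub>M\<^esub> b | a b. a \<in> A \<and> b \<in> B} R M"
proof (rule submoduleI')
  note A = submoduleD[OF assms(1)] and B = submoduleD[OF assms(2)]
  let ?S = "{a \<oplus>\<^bsub>M\<^esub> b | a b. a \<in> A \<and> b \<in> B}"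
  show "?S \<subseteq> carrier M" using A(1) B(1) by auto
  show "\<zero>\<^bsub>M\<^esub> \<in> ?S" using A(2) B(2) by force
  fix x assume "x \<in> ?S"
  then obtain a b where x: "a \<in> A" "b \<in> B" "x = a \<oplus>\<^bsub>M\<^esub> b" by blast
  show "r \<odot>\<^bsub>M\<^esub> x \<in> ?S" if "r \<in> carrier R" for r
  proof -
    have "r \<odot>\<^bsub>M\<^esub> x = r \<odot>\<^bsub>M\<^esub> a \<oplus>\<^bsub>M\<^esub> r \<odot>\<^bsub>M\<^esub> b" using that x A(1) B(1) by (simp add: smult_r_distr)
    then show ?thesis using that x A(6) B(6) by blast
  qed
  fix y assume "y \<in> ?S"
  then obtain c d where y: "c \<in> A" "d \<in> B" "y = c \<oplus>\<^bsub>M\<^esub> d" by blast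
  have "x \<oplus>\<^bsub>M\<^esub> y = (a \<oplus>\<^bsub>M\<^esub> c) \<oplus>\<^bsub>M\<^esub> (b \<oplus>\<^bsub>M\<^esub> d)"
    using x y A(1) B(1) by (simp add: M.a_ac)
  then show "x \<oplus>\<^bsub>M\<^esub> y \<in> ?S" using x y A(3) B(3) by blast
qed

lemma submodule_cyclic:
  assumes "u \<in> carrier M"
  shows "submodule {s \<odot>\<^bsub>M\<^esub> u | s. s \<in> carrier R} R M"
proof (rule submoduleI')
  show "{s \<odot>\<^bsub>M\<^esub> u | s. s \<in> carrier R} \<subseteq> carrier M" using assms by auto
  show "\<zero>\<^bsub>M\<^esub> \<in> {s \<odot>\<^bsub>M\<^esub> u | s. s \<in> carrier R}"
    using assms by (auto intro!: exI[of _ \<zero>])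
  show "x \<oplus>\<^bsub>M\<^esub> y \<in> {s \<odot>\<^bsub>M\<^esub> u | s. s \<in> carrier R}"
    if "x \<in> {s \<odot>\<^bsub>M\<^esub> u | s. s \<in> carrier R}" "y \<in> {s \<odot>\<^bsub>M\<^esub> u | s. s \<in> carrier R}" for x y
    using that assms by (auto simp flip: smult_l_distr intro: R.a_closed)
  show "r \<odot>\<^bsub>M\<^esub> x \<in> {s \<odot>\<^bsub>M\<^esub> u | s. s \<in> carrier R}"
    if "r \<in> carrier R" "x \<in> {s \<odot>\<^bsub>M\<^esub> u | s. s \<in> carrier R}" for r x
    using that assms by (auto simp flip: smult_assoc1 intro: R.m_closed)
qed

lemma submodule_mult:
  assumes "y \<in> carrier R"
  shows "submodule {y \<odot>\<^bsub>M\<^esub> u | u. u \<in> carrier M} R M"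
proof (rule submoduleI')
  show "{y \<odot>\<^bsub>M\<^esub> u | u. u \<in> carrier M} \<subseteq> carrier M" using assms by auto
  show "\<zero>\<^bsub>M\<^esub> \<in> {y \<odot>\<^bsub>M\<^esub> u | u. u \<in> carrier M}"
    using assms by (auto intro!: exI[of _ "\<zero>\<^bsub>M\<^esub>"])
  show "v \<oplus>\<^bsub>M\<^esub> w \<in> {y \<odot>\<^bsub>M\<^esub> u | u. u \<in> carrier M}"
    if "v \<in> {y \<odot>\<^bsub>M\<^esub> u | u. u \<in> carrier M}" "w \<in> {y \<odot>\<^bsub>M\<^esub> u | u. u \<in> carrier M}" for v w
    using that assms by (auto simp flip: smult_r_distr)
  fix r v assume "r \<in> carrier R" "v \<in> {y \<odot>\<^bsub>M\<^esub> u | u. u \<in> carrier M}"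
  then obtain u where u: "u \<in> carrier M" "v = y \<odot>\<^bsub>M\<^esub> u" "r \<in> carrier R" by blast
  then have "r \<odot>\<^bsub>M\<^esub> v = y \<odot>\<^bsub>M\<^esub> (r \<odot>\<^bsub>M\<^esub> u)"
    using assms by (simp flip: smult_assoc1 add: R.m_comm)
  then show "r \<odot>\<^bsub>M\<^esub> v \<in> {y \<odot>\<^bsub>M\<^esub> u | u. u \<in> carrier M}" using u by blast
qed

text \<open>Forming M/N changes the element type, and an induction along a regular sequence would do
  so at each step. The notions for M/N are therefore phrased inside \<open>M\<close>, and passing to
  a further quotient enlarges \<open>N\<close>.\<close>

definition add_cyclic :: "'c set \<Rightarrow> 'c \<Rightarrow> 'c set" where
  "add_cyclic N u = {n \<oplus>\<^bsub>M\<^esub> v | n v. n \<in> N \<and> v \<in> {s \<odot>\<^bsub>M\<^esub> u | s. s \<in> carrier R}}"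

definition add_mult :: "'c set \<Rightarrow> 'a \<Rightarrow> 'c set" where
  "add_mult N y = {n \<oplus>\<^bsub>M\<^esub> v | n v. n \<in> N \<and> v \<in> {y \<odot>\<^bsub>M\<^esub> u | u. u \<in> carrier M}}"

text \<open>The annihilator of the class of \<open>u\<close> in M/N.\<close>

definition colon :: "'c set \<Rightarrow> 'c \<Rightarrow> 'a set" where
  "colon N u = {r \<in> carrier R. r \<odot>\<^bsub>M\<^esub> u \<in> N}"

definition assoc_prime :: "'c set \<Rightarrow> 'a set \<Rightarrow> bool" where
  "assoc_prime N p \<longleftrightarrow> primeideal p R \<and> (\<exists>u\<in>carrier M. colon N u = p)"

definition regular_mod :: "'c set \<Rightarrow> 'a \<Rightarrow> bool" where
  "regular_mod N r \<longleftrightarrow> r \<in> carrier R \<and> (\<forall>u\<in>carrier M. r \<odot>\<^bsub>M\<^esub> u \<in> N \<longrightarrow> u \<in> N)"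

text \<open>For an ideal \<open>J\<close> this says Hom(R/J, M/N) = 0. Over Noetherian modules it
  amounts to an element of \<open>J\<close> being regular on M/N, but unlike that element it can be
  transported from M/yM to M/xM.\<close>

definition torsionless_mod :: "'a set \<Rightarrow> 'c set \<Rightarrow> bool" where
  "torsionless_mod J N \<longleftrightarrow> (\<forall>u\<in>carrier M. (\<forall>s\<in>J. s \<odot>\<^bsub>M\<^esub> u \<in> N) \<longrightarrow> u \<in> N)"

text \<open>Properness is demanded at the end, which gives it at every stage because the submodules
  increase.\<close>

fun regular_seq_mod :: "'c set \<Rightarrow> 'a list \<Rightarrow> bool" where
  "regular_seq_mod N [] \<longleftrightarrow> N \<noteq> carrier M"
| "regular_seq_mod N (y # ys) \<longleftrightarrow> regular_mod N y \<and> regular_seq_mod (add_mult N y) ys"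

lemma mem_add_cyclic:
  "x \<in> add_cyclic N u \<longleftrightarrow> (\<exists>n\<in>N. \<exists>s\<in>carrier R. x = n \<oplus>\<^bsub>M\<^esub> s \<odot>\<^bsub>M\<^esub> u)"
  unfolding add_cyclic_def by blast

lemma mem_add_mult:
  "x \<in> add_mult N y \<longleftrightarrow> (\<exists>n\<in>N. \<exists>u\<in>carrier M. x = n \<oplus>\<^bsub>M\<^esub> y \<odot>\<^bsub>M\<^esub> u)"
  unfolding add_mult_def by blast

lemma add_cyclic:
  assumes "submodule N R M" "u \<in> carrier M"
  shows "submodule (add_cyclic N u) R M" "N \<subseteq> add_cyclic N u" "u \<in> add_cyclic N u"
proof -
  note N = submoduleD[OF assms(1)]
  show "submodule (add_cyclic N u) R M"
    unfolding add_cyclic_def by (rule submodule_sum[OF assms(1) submodule_cyclic[OF assms(2)]])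
  show "N \<subseteq> add_cyclic N u"
  proof
    fix n assume "n \<in> N"
    then show "n \<in> add_cyclic N u"
      unfolding mem_add_cyclic using assms(2) N(1)
      by (intro bexI[of _ n] bexI[of _ \<zero>]) auto
  qed
  show "u \<in> add_cyclic N u" unfolding mem_add_cyclic using assms(2) N(2)
    by (intro bexI[of _ "\<zero>\<^bsub>M\<^esub>"] bexI[of _ \<one>]) auto
qed

lemma add_mult:
  assumes "submodule N R M" "y \<in> carrier R"
  shows "submodule (add_mult N y) R M" "N \<subseteq> add_mult N y"
    "u \<in> carrier M \<Longrightarrow> y \<odot>\<^bsub>M\<^esub> u \<in> add_mult N y"
proof -
  note N = submoduleD[OF assms(1)]
  show "submodule (add_mult N y) R M"
    unfolding add_mult_def by (rule submodule_sum[OF assms(1) submodule_mult[OF assms(2)]])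
  show "N \<subseteq> add_mult N y"
  proof
    fix n assume "n \<in> N"
    then show "n \<in> add_mult N y"
      unfolding mem_add_mult using assms(2) N(1)
      by (intro bexI[of _ n] bexI[of _ "\<zero>\<^bsub>M\<^esub>"]) auto
  qed
  show "y \<odot>\<^bsub>M\<^esub> u \<in> add_mult N y" if "u \<in> carrier M" unfolding mem_add_mult using assms(2) N(2) that
    by (intro bexI[of _ "\<zero>\<^bsub>M\<^esub>"] bexI[of _ u]) auto
qed

lemma add_mult_commute:
  assumes "submodule N R M" "y \<in> carrier R" "z \<in> carrier R"
  shows "add_mult (add_mult N y) z = add_mult (add_mult N z) y"
proof -
  have "add_mult (add_mult N y) z \<subseteq> add_mult (add_mult N z) y"
    if yz: "y \<in> carrier R" "z \<in> carrier R" for y z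
  proof
    fix x assume "x \<in> add_mult (add_mult N y) z"
    then obtain t v where t: "t \<in> add_mult N y" "v \<in> carrier M" "x = t \<oplus>\<^bsub>M\<^esub> z \<odot>\<^bsub>M\<^esub> v"
      using mem_add_mult[of x "add_mult N y" z] by blast
    then obtain n u where "n \<in> N" "u \<in> carrier M" "t = n \<oplus>\<^bsub>M\<^esub> y \<odot>\<^bsub>M\<^esub> u"
      using mem_add_mult[of t N y] by blast
    note * = this t(2,3)
    have "x = (n \<oplus>\<^bsub>M\<^esub> z \<odot>\<^bsub>M\<^esub> v) \<oplus>\<^bsub>M\<^esub> y \<odot>\<^bsub>M\<^esub> u"
      using * yz submoduleD(1)[OF assms(1)] by (simp add: M.a_ac)
    moreover have "n \<oplus>\<^bsub>M\<^esub> z \<odot>\<^bsub>M\<^esub> v \<in> add_mult N z" using * mem_add_mult by blast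
    ultimately show "x \<in> add_mult (add_mult N z) y" using * mem_add_mult by blast
  qed
  then show ?thesis using assms by blast
qed

lemma colon_ideal:
  assumes "submodule N R M" "u \<in> carrier M"
  shows "ideal (colon N u) R"
proof (rule idealI[OF R.ring_axioms])
  note N = submoduleD[OF assms(1)]
  show "subgroup (colon N u) (add_monoid R)"
  proof (rule R.add.subgroupI)
    show "colon N u \<subseteq> carrier R" by (auto simp: colon_def)
    show "colon N u \<noteq> {}" using N(2) assms(2) by (auto simp: colon_def intro!: exI[of _ \<zero>])
    show "\<ominus> a \<in> colon N u" if "a \<in> colon N u" for a
      using that N(4) assms(2) by (auto simp: colon_def smult_l_minus)
    show "a \<oplus> b \<in> colon N u" if "a \<in> colon N u" "b \<in> colon N u" for a b
      using that N(3) assms(2) by (auto simp: colon_def smult_l_distr)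
  qed
  fix a x assume *: "a \<in> colon N u" "x \<in> carrier R"
  show "x \<otimes> a \<in> colon N u" using * N(6) assms(2) by (auto simp: colon_def smult_assoc1)
  then show "a \<otimes> x \<in> colon N u" using * by (auto simp: colon_def R.m_comm)
qed

lemma one_mem_colon: "u \<in> carrier M \<Longrightarrow> \<one> \<in> colon N u \<longleftrightarrow> u \<in> N"
  by (simp add: colon_def)

lemma colon_smult:
  "s \<in> carrier R \<Longrightarrow> u \<in> carrier M \<Longrightarrow> r \<in> carrier R \<Longrightarrow> r \<in> colon N (s \<odot>\<^bsub>M\<^esub> u) \<longleftrightarrow> r \<otimes> s \<in> colon N u"
  by (simp add: colon_def smult_assoc1)

lemma regular_modD:
  "regular_mod N r \<Longrightarrow> u \<in> carrier M \<Longrightarrow> r \<odot>\<^bsub>M\<^esub> u \<in> N \<Longrightarrow> u \<in> N"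
  by (simp add: regular_mod_def)

lemma smult_comm:
  "r \<in> carrier R \<Longrightarrow> s \<in> carrier R \<Longrightarrow> u \<in> carrier M \<Longrightarrow> r \<odot>\<^bsub>M\<^esub> (s \<odot>\<^bsub>M\<^esub> u) = s \<odot>\<^bsub>M\<^esub> (r \<odot>\<^bsub>M\<^esub> u)"
  by (simp flip: smult_assoc1 add: R.m_comm)

text \<open>If \<open>y u = n + x v\<close> with \<open>u \<in> (N + xM : J)\<close>, then \<open>v \<in> (N + yM : J)\<close>: the assignment
  \<open>u \<mapsto> v\<close> is the elementary form of \<open>Hom(R/J, M/xM) \<cong> Ext\<^sup>1(R/J, M) \<cong> Hom(R/J, M/yM)\<close>.\<close>

lemma torsionless_exchange:
  assumes N: "submodule N R M" and J: "J \<subseteq> carrier R" "y \<in> J" and x: "x \<in> carrier R"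
    and reg: "regular_mod N x" "regular_mod N y" and tl: "torsionless_mod J (add_mult N y)"
  shows "torsionless_mod J (add_mult N x)"
  unfolding torsionless_mod_def
proof (intro ballI impI)
  note D = submoduleD[OF N]
  fix u assume u: "u \<in> carrier M" and Ju: "\<forall>s\<in>J. s \<odot>\<^bsub>M\<^esub> u \<in> add_mult N x"
  have y: "y \<in> carrier R" using J by blast
  obtain n v where nv: "n \<in> N" "v \<in> carrier M" "y \<odot>\<^bsub>M\<^esub> u = n \<oplus>\<^bsub>M\<^esub> x \<odot>\<^bsub>M\<^esub> v"
    using Ju J(2) mem_add_mult by metis
  have "s \<odot>\<^bsub>M\<^esub> v \<in> add_mult N y" if s: "s \<in> J" for s
  proof -
    have sR: "s \<in> carrier R" using s J by blast
    obtain n1 u1 where 1: "n1 \<in> N" "u1 \<in> carrier M" "s \<odot>\<^bsub>M\<^esub> u = n1 \<oplus>\<^bsub>M\<^esub> x \<odot>\<^bsub>M\<^esub> u1"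
      using Ju s mem_add_mult by metis
    have nM: "n \<in> carrier M" "n1 \<in> carrier M" using nv 1 D(1) by auto
    let ?w = "s \<odot>\<^bsub>M\<^esub> v \<ominus>\<^bsub>M\<^esub> y \<odot>\<^bsub>M\<^esub> u1"
    have w: "?w \<in> carrier M" using nv 1 sR y by simp
    \<comment> \<open>Both sides are \<open>s y u\<close>, expanded once through
      \<open>y u = n + x v\<close> and once through \<open>s u = n1 + x u1\<close>.\<close>
    have e: "s \<odot>\<^bsub>M\<^esub> n \<oplus>\<^bsub>M\<^esub> x \<odot>\<^bsub>M\<^esub> (s \<odot>\<^bsub>M\<^esub> v) = y \<odot>\<^bsub>M\<^esub> n1 \<oplus>\<^bsub>M\<^esub> x \<odot>\<^bsub>M\<^esub> (y \<odot>\<^bsub>M\<^esub> u1)"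
    proof -
      have "s \<odot>\<^bsub>M\<^esub> (y \<odot>\<^bsub>M\<^esub> u) = s \<odot>\<^bsub>M\<^esub> n \<oplus>\<^bsub>M\<^esub> x \<odot>\<^bsub>M\<^esub> (s \<odot>\<^bsub>M\<^esub> v)"
        using nv nM sR x by (simp add: smult_r_distr smult_comm)
      moreover have "y \<odot>\<^bsub>M\<^esub> (s \<odot>\<^bsub>M\<^esub> u) = y \<odot>\<^bsub>M\<^esub> n1 \<oplus>\<^bsub>M\<^esub> x \<odot>\<^bsub>M\<^esub> (y \<odot>\<^bsub>M\<^esub> u1)"
        using 1 nM y x by (simp add: smult_r_distr smult_comm)
      ultimately show ?thesis using smult_comm[OF sR y u] by simp
    qed
    have "x \<odot>\<^bsub>M\<^esub> ?w = x \<odot>\<^bsub>M\<^esub> (s \<odot>\<^bsub>M\<^esub> v) \<ominus>\<^bsub>M\<^esub> x \<odot>\<^bsub>M\<^esub> (y \<odot>\<^bsub>M\<^esub> u1)"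
      using nv 1 sR y x by (simp add: a_minus_def smult_r_distr smult_r_minus)
    then have "s \<odot>\<^bsub>M\<^esub> n \<oplus>\<^bsub>M\<^esub> x \<odot>\<^bsub>M\<^esub> ?w
        = (s \<odot>\<^bsub>M\<^esub> n \<oplus>\<^bsub>M\<^esub> x \<odot>\<^bsub>M\<^esub> (s \<odot>\<^bsub>M\<^esub> v)) \<ominus>\<^bsub>M\<^esub> x \<odot>\<^bsub>M\<^esub> (y \<odot>\<^bsub>M\<^esub> u1)"
      using nv 1 sR y x nM by (simp add: a_minus_def M.a_assoc)
    also have "\<dots> = y \<odot>\<^bsub>M\<^esub> n1"
      unfolding e using 1 y x nM by (simp add: a_minus_def M.a_assoc M.r_neg)
    finally have "s \<odot>\<^bsub>M\<^esub> n \<oplus>\<^bsub>M\<^esub> x \<odot>\<^bsub>M\<^esub> ?w \<in> N" using D(6)[OF y 1(1)] by simp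
    then have "x \<odot>\<^bsub>M\<^esub> ?w \<in> N"
      using submodule_add_cancel[OF N D(6)[OF sR nv(1)]] x w by blast
    then have "?w \<in> N" using regular_modD[OF reg(1) w] by blast
    moreover have "s \<odot>\<^bsub>M\<^esub> v = ?w \<oplus>\<^bsub>M\<^esub> y \<odot>\<^bsub>M\<^esub> u1"
      using nv 1 sR y by (simp add: a_minus_def M.a_assoc M.l_neg)
    ultimately show ?thesis unfolding mem_add_mult using 1 by blast
  qed
  then have "v \<in> add_mult N y" using tl nv(2) unfolding torsionless_mod_def by blast
  then obtain n2 v2 where 2: "n2 \<in> N" "v2 \<in> carrier M" "v = n2 \<oplus>\<^bsub>M\<^esub> y \<odot>\<^bsub>M\<^esub> v2"
    unfolding mem_add_mult by blast
  have nM: "n \<in> carrier M" "n2 \<in> carrier M" using nv 2 D(1) by auto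
  \<comment> \<open>Substituting \<open>v = n2 + y v2\<close> collects everything divisible by
    \<open>y\<close>: then \<open>y\<close> carries \<open>u - x v2\<close> into \<open>N\<close>
    and can be cancelled.\<close>
  have "y \<odot>\<^bsub>M\<^esub> u = (n \<oplus>\<^bsub>M\<^esub> x \<odot>\<^bsub>M\<^esub> n2) \<oplus>\<^bsub>M\<^esub> y \<odot>\<^bsub>M\<^esub> (x \<odot>\<^bsub>M\<^esub> v2)"
    using nv 2 nM x y by (simp add: smult_r_distr M.a_assoc smult_comm)
  then have "y \<odot>\<^bsub>M\<^esub> (u \<ominus>\<^bsub>M\<^esub> x \<odot>\<^bsub>M\<^esub> v2) = n \<oplus>\<^bsub>M\<^esub> x \<odot>\<^bsub>M\<^esub> n2"
    using u 2 nM x y by (simp add: a_minus_def smult_r_distr smult_r_minus M.a_assoc M.r_neg)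
  then have "y \<odot>\<^bsub>M\<^esub> (u \<ominus>\<^bsub>M\<^esub> x \<odot>\<^bsub>M\<^esub> v2) \<in> N" using D(3)[OF nv(1) D(6)[OF x 2(1)]] by simp
  then have "u \<ominus>\<^bsub>M\<^esub> x \<odot>\<^bsub>M\<^esub> v2 \<in> N" using regular_modD[OF reg(2)] u x 2 by simp
  moreover have "u = (u \<ominus>\<^bsub>M\<^esub> x \<odot>\<^bsub>M\<^esub> v2) \<oplus>\<^bsub>M\<^esub> x \<odot>\<^bsub>M\<^esub> v2"
    using u 2 x by (simp add: a_minus_def M.a_assoc M.l_neg)
  ultimately show "u \<in> add_mult N x" unfolding mem_add_mult using 2 by blast
qed

end

section \<open>Noetherian modules and associated primes\<close>

locale noetherian_module = noetherian_cring R + module R M for R (structure) and M (structure) +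
  assumes wf_submodules: "wf {(A, B). submodule A R M \<and> submodule B R M \<and> B \<subset> A}"

locale local_noetherian_module = noetherian_local_ring R \<mm> + noetherian_module R M
  for R (structure) and \<mm> and M (structure)

text \<open>A submodule \<open>A\<close> of L + Rg is measured by its intersection with
  \<open>L\<close> and by the ideal \<open>I A\<close> of all \<open>r\<close> with
  \<open>r g\<close> in A + L. A strict enlargement of \<open>A\<close> strictly enlarges one of the
  two and shrinks neither, so the lexicographic product applies.\<close>

lemma (in module) wf_submodules_add_cyclic:
  assumes "noetherian_cring R" and L: "submodule L R M" "g \<in> carrier M"
    and wf: "wf {(A, B). submodule A R M \<and> submodule B R M \<and> B \<subset> A \<and> A \<subseteq> L}" (is "wf ?r")
  shows "wf {(A, B). submodule A R M \<and> submodule B R M \<and> B \<subset> A \<and> A \<subseteq> add_cyclic L g}"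
proof -
  interpret noetherian_cring R by fact
  let ?s = "{(A, B). ideal A R \<and> ideal B R \<and> B \<subset> A}"
  define I where "I A = colon {a \<oplus>\<^bsub>M\<^esub> l | a l. a \<in> A \<and> l \<in> L} g" for A
  have "wf (inv_image (?r <*lex*> ?s) (\<lambda>A. (A \<inter> L, I A)))"
    by (intro wf_inv_image wf_lex_prod wf wf_ideals)
  then show ?thesis
  proof (rule wf_subset, intro subrelI)
    fix A B assume "(A, B) \<in> {(A, B). submodule A R M \<and> submodule B R M \<and> B \<subset> A \<and> A \<subseteq> add_cyclic L g}"
    then have AB: "submodule A R M" "submodule B R M" "B \<subset> A" "A \<subseteq> add_cyclic L g" by auto
    note A = submoduleD[OF AB(1)] and B = submoduleD[OF AB(2)] and LD = submoduleD[OF L(1)]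
    have id: "ideal (I A) R" "ideal (I B) R"
      unfolding I_def using AB L by (auto intro!: colon_ideal submodule_sum)
    have sub: "I B \<subseteq> I A" unfolding I_def colon_def using AB(3) by blast
    have "I B \<noteq> I A" if eq: "A \<inter> L = B \<inter> L"
    proof
      assume IBA: "I B = I A"
      have "A \<subseteq> B"
      proof
        fix a assume a: "a \<in> A"
        then obtain l r where lr: "l \<in> L" "r \<in> carrier R" "a = l \<oplus>\<^bsub>M\<^esub> r \<odot>\<^bsub>M\<^esub> g"
          using AB(4) mem_add_cyclic by blast
        have lM: "l \<in> carrier M" using lr(1) LD(1) by blast
        have "r \<odot>\<^bsub>M\<^esub> g = a \<oplus>\<^bsub>M\<^esub> (\<ominus>\<^bsub>M\<^esub> l)"
          using lr lM L(2) by (simp add: M.a_comm[of l "r \<odot>\<^bsub>M\<^esub> g"] M.a_assoc M.r_neg)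
        then have "r \<in> I A" unfolding I_def colon_def using lr a LD(4) by blast
        then have "r \<in> I B" using IBA by simp
        then obtain b l' where b: "b \<in> B" "l' \<in> L" "r \<odot>\<^bsub>M\<^esub> g = b \<oplus>\<^bsub>M\<^esub> l'"
          unfolding I_def colon_def by blast
        have bM: "b \<in> carrier M" "l' \<in> carrier M" "b \<in> A" using b B LD AB(3) by auto
        have ae: "a = b \<oplus>\<^bsub>M\<^esub> (l \<oplus>\<^bsub>M\<^esub> l')" using lr b bM lM by (simp add: M.a_ac)
        then have "l \<oplus>\<^bsub>M\<^esub> l' \<in> A"
          using submodule_add_cancel[OF AB(1) bM(3), of "l \<oplus>\<^bsub>M\<^esub> l'"] a bM lM by simp
        then have "l \<oplus>\<^bsub>M\<^esub> l' \<in> B" using eq LD(3)[OF lr(1) b(2)] by blast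
        then show "a \<in> B" using ae B(3) b(1) by simp
      qed
      then show False using AB(3) by blast
    qed
    then show "(A, B) \<in> inv_image (?r <*lex*> ?s) (\<lambda>A. (A \<inter> L, I A))"
      using AB id sub submodule_Int[OF AB(1) L(1)] submodule_Int[OF AB(2) L(1)]
      unfolding in_inv_image in_lex_prod by blast
  qed
qed

text \<open>Generators are adjoined one at a time to the zero module; the last \<open>L\<close> is
  all of \<open>M\<close>, where the bound \<open>A \<subseteq> L\<close> is vacuous.\<close>

lemma noetherian_module_of_fin_gen:
  fixes R :: "('a, 'r) ring_scheme" and M :: "('a, 'm) module"
  assumes R: "noetherian_cring R" and "fin_gen_module R M" and "module R M"
  shows "noetherian_module R M"
proof -
  interpret module R M by fact
  obtain S where S: "S \<subseteq> carrier M" "finite S" "submodule_gen R M S = carrier M"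
    using assms(2) unfolding fin_gen_module_def by blast
  have "\<exists>L. submodule L R M \<and> S \<subseteq> L \<and>
      wf {(A, B). submodule A R M \<and> submodule B R M \<and> B \<subset> A \<and> A \<subseteq> L}"
    using S(2,1)
  proof (induction S)
    case empty
    have "{(A, B). submodule A R M \<and> submodule B R M \<and> B \<subset> A \<and> A \<subseteq> {\<zero>\<^bsub>M\<^esub>}} = {}"
      using submoduleD(2) by blast
    then show ?case using submodule_zero
      by (intro exI[of _ "{\<zero>\<^bsub>M\<^esub>}"]) (simp only: wf_def, simp)
  next
    case (insert g S)
    then obtain L where L: "submodule L R M" "S \<subseteq> L"
      "wf {(A, B). submodule A R M \<and> submodule B R M \<and> B \<subset> A \<and> A \<subseteq> L}" by auto
    have g: "g \<in> carrier M" using insert by auto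
    show ?case
      using wf_submodules_add_cyclic[OF R L(1) g L(3)] add_cyclic[OF L(1) g] L(2)
      by (intro exI[of _ "add_cyclic L g"]) auto
  qed
  then obtain L where L: "submodule L R M" "S \<subseteq> L"
    "wf {(A, B). submodule A R M \<and> submodule B R M \<and> B \<subset> A \<and> A \<subseteq> L}" by blast
  have "carrier M \<subseteq> L" using S(3) L unfolding submodule_gen_def by blast
  then have "{(A, B). submodule A R M \<and> submodule B R M \<and> B \<subset> A}
      = {(A, B). submodule A R M \<and> submodule B R M \<and> B \<subset> A \<and> A \<subseteq> L}"
    using submoduleD(1) by blast
  then show ?thesis using L(3) R module_axioms
    by (simp add: noetherian_module_def noetherian_module_axioms_def)
qed

context noetherian_module
begin

text \<open>A maximal annihilator of a nonzero class is prime: if \<open>a \<otimes> b\<close> kills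
  the class of \<open>v\<close> and \<open>b\<close> does not, then the annihilator of
  \<open>b v\<close> contains that of \<open>v\<close>, so by maximality equals it, and it contains
  \<open>a\<close>.\<close>

lemma exists_assoc_prime:
  assumes N: "submodule N R M" and u: "u \<in> carrier M" "u \<notin> N"
  obtains p where "assoc_prime N p" "colon N u \<subseteq> p"
proof -
  let ?Q = "\<lambda>J. \<exists>v\<in>carrier M. v \<notin> N \<and> J = colon N v \<and> colon N u \<subseteq> J"
  have "\<exists>p. ?Q p \<and> (\<forall>C. ?Q C \<longrightarrow> p \<subseteq> C \<longrightarrow> C = p)"
    using wf_obtain_maximal[OF wf_ideals, of ?Q "colon N u"] u colon_ideal[OF N]
    by (metis (no_types, lifting) order_refl)
  then obtain p where p: "?Q p" and max: "\<And>C. ?Q C \<Longrightarrow> p \<subseteq> C \<Longrightarrow> C = p" by blast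
  obtain v where v: "v \<in> carrier M" "v \<notin> N" "p = colon N v" "colon N u \<subseteq> p" using p by blast
  have "primeideal p R"
  proof (rule primeidealI')
    show "ideal p R" unfolding v(3) by (rule colon_ideal[OF N v(1)])
    show "\<one> \<notin> p" using v one_mem_colon by simp
    fix a b assume ab: "a \<in> carrier R" "b \<in> carrier R" "a \<otimes> b \<in> p"
    show "a \<in> p \<or> b \<in> p"
    proof (cases "b \<in> p")
      case False
      then have bv: "b \<odot>\<^bsub>M\<^esub> v \<notin> N" using v ab by (simp add: colon_def)
      have "p \<subseteq> colon N (b \<odot>\<^bsub>M\<^esub> v)"
        unfolding v(3) using colon_smult[OF ab(2) v(1)] ideal.I_r_closed[OF colon_ideal[OF N v(1)]] ab(2)
        by (auto simp: colon_def)
      then have "colon N (b \<odot>\<^bsub>M\<^esub> v) = p" using v ab bv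
        by (intro max bexI[of _ "b \<odot>\<^bsub>M\<^esub> v"]) auto
      then show ?thesis using colon_smult[OF ab(2) v(1) ab(1)] ab(3) v(3) by blast
    qed simp
  qed
  then show thesis using that v unfolding assoc_prime_def by blast
qed

text \<open>For \<open>p = colon N u\<close> the module (N + Ru)/N is a copy of R/p, where every
  nonzero element has annihilator \<open>p\<close>. An associated prime other than \<open>p\<close>
  thus survives modulo N + Ru, and Noetherian induction adds one prime per step.\<close>

lemma finite_assoc_primes:
  assumes "submodule N R M"
  shows "finite {p. assoc_prime N p}"
  using assms
proof (induction N rule: wf_induct_rule[OF wf_submodules])
  case (1 N)
  note N = submoduleD[OF 1(2)]
  show ?case
  proof (cases "\<exists>p. assoc_prime N p")
    case True
    then obtain p u where p: "primeideal p R" "u \<in> carrier M" "colon N u = p"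
      unfolding assoc_prime_def by blast
    have "u \<notin> N" using one_mem_colon[OF p(2)] primeidealD(3)[OF p(1)] p(3) by blast
    let ?N = "add_cyclic N u"
    note N' = add_cyclic[OF 1(2) p(2)]
    have "finite {p. assoc_prime ?N p}" using 1 N' \<open>u \<notin> N\<close> by (intro 1(1)) auto
    moreover have "q = p \<or> assoc_prime ?N q" if q: "assoc_prime N q" for q
    proof -
      obtain v where v: "v \<in> carrier M" "colon N v = q" and qp: "primeideal q R"
        using q unfolding assoc_prime_def by blast
      note qD = primeidealD[OF qp] and pD = primeidealD[OF p(1)]
      show ?thesis
      proof (cases "\<exists>s\<in>carrier R. s \<notin> q \<and> s \<odot>\<^bsub>M\<^esub> v \<in> ?N")
        case True
        then obtain s n t where s: "s \<in> carrier R" "s \<notin> q" "n \<in> N" "t \<in> carrier R"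
          "s \<odot>\<^bsub>M\<^esub> v = n \<oplus>\<^bsub>M\<^esub> t \<odot>\<^bsub>M\<^esub> u" unfolding mem_add_cyclic by blast
        have nM: "n \<in> carrier M" using s N by blast
        \<comment> \<open>\<open>s v\<close> and \<open>t u\<close> differ by
          \<open>n \<in> N\<close>, so their classes have the same annihilator. It is
          \<open>q\<close> because \<open>s \<notin> q\<close>, and it is \<open>p\<close> once
          \<open>t \<notin> p\<close> is known, which is the case \<open>r = \<one>\<close>.\<close>
        have iff: "r \<otimes> s \<in> q \<longleftrightarrow> r \<otimes> t \<in> p" if r: "r \<in> carrier R" for r
        proof -
          have e: "r \<odot>\<^bsub>M\<^esub> (s \<odot>\<^bsub>M\<^esub> v) = r \<odot>\<^bsub>M\<^esub> n \<oplus>\<^bsub>M\<^esub> r \<odot>\<^bsub>M\<^esub> (t \<odot>\<^bsub>M\<^esub> u)"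
            unfolding s(5) using s r p(2) nM by (simp add: smult_r_distr)
          have "r \<otimes> s \<in> q \<longleftrightarrow> r \<odot>\<^bsub>M\<^esub> (s \<odot>\<^bsub>M\<^esub> v) \<in> N"
            using r s v by (auto simp: colon_def smult_assoc1)
          also have "\<dots> \<longleftrightarrow> r \<odot>\<^bsub>M\<^esub> (t \<odot>\<^bsub>M\<^esub> u) \<in> N"
            unfolding e using submodule_add_cancel[OF 1(2) N(6)[OF r s(3)]] N(3)[OF N(6)[OF r s(3)]] r s p(2)
            by auto
          also have "\<dots> \<longleftrightarrow> r \<otimes> t \<in> p" using r s p by (auto simp: colon_def smult_assoc1)
          finally show ?thesis .
        qed
        have "t \<notin> p" using iff[of \<one>] s by auto
        then have "r \<in> q \<longleftrightarrow> r \<in> p" if r: "r \<in> carrier R" for r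
          using iff[OF r] qD(4)[OF r s(1)] pD(4)[OF r s(4)] s
            ideal.I_r_closed[OF qD(1)] ideal.I_r_closed[OF pD(1)] by blast
        then show ?thesis using qD(2) pD(2) by blast
      next
        case False
        have "colon ?N v = q"
        proof
          show "colon ?N v \<subseteq> q" using False by (auto simp: colon_def)
          show "q \<subseteq> colon ?N v" using v(2) N'(2) by (auto simp: colon_def)
        qed
        then show ?thesis using v(1) qp unfolding assoc_prime_def by blast
      qed
    qed
    ultimately show ?thesis by (auto intro: finite_subset[of _ "insert p {p. assoc_prime ?N p}"])
  qed simp
qed

text \<open>If \<open>J\<close> lay in an associated prime \<open>colon N u\<close>, it would kill
  the nonzero class of \<open>u\<close>. So prime avoidance yields an element of \<open>J\<close>
  outside all associated primes, and every zero divisor lies in one of these. Two submodules are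
  treated at once because the exchange argument needs one element regular modulo both.\<close>

lemma exists_common_regular:
  assumes "submodule N R M" "submodule L R M" "ideal J R" "torsionless_mod J N" "torsionless_mod J L"
  obtains w where "w \<in> J" "regular_mod N w" "regular_mod L w"
proof -
  interpret J: ideal J R by fact
  have nsub: "\<not> J \<subseteq> p" if a: "assoc_prime N p" "torsionless_mod J N" for p N
  proof
    assume "J \<subseteq> p"
    obtain u where u: "u \<in> carrier M" "colon N u = p" "\<one> \<notin> p"
      using a(1) primeidealD(3)[of p R] unfolding assoc_prime_def by auto
    have "\<forall>s\<in>J. s \<odot>\<^bsub>M\<^esub> u \<in> N" using \<open>J \<subseteq> p\<close> u by (auto simp: colon_def)
    then have "u \<in> N" using a u unfolding torsionless_mod_def by blast
    then show False using one_mem_colon[OF u(1), of N] u(2,3) by simp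
  qed
  let ?F = "{p. assoc_prime N p} \<union> {p. assoc_prime L p}"
  have "\<exists>w\<in>J. \<forall>p\<in>?F. w \<notin> p"
  proof (rule prime_avoidance)
    show "finite ?F" using finite_assoc_primes assms by auto
    show "primeideal p R" if "p \<in> ?F" for p using that by (auto simp: assoc_prime_def)
    show "\<not> J \<subseteq> p" if "p \<in> ?F" for p using that nsub assms by blast
  qed (rule assms)
  then obtain w where w: "w \<in> J" "\<And>p. p \<in> ?F \<Longrightarrow> w \<notin> p" by blast
  have "regular_mod K w" if K: "submodule K R M" "\<And>p. assoc_prime K p \<Longrightarrow> w \<notin> p" for K
    unfolding regular_mod_def
  proof (intro conjI ballI impI)
    show wR: "w \<in> carrier R" using w(1) J.Icarr by blast
    fix u assume u: "u \<in> carrier M" "w \<odot>\<^bsub>M\<^esub> u \<in> K"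
    show "u \<in> K"
    proof (rule ccontr)
      assume "u \<notin> K"
      then obtain p where "assoc_prime K p" "colon K u \<subseteq> p" using exists_assoc_prime K u by blast
      then show False using K(2) u wR by (auto simp: colon_def)
    qed
  qed
  then show thesis using that w assms by blast
qed

end

section \<open>Regular sequences over a local ring\<close>

context local_noetherian_module
begin

text \<open>Choose \<open>u\<close> in \<open>L\<close> outside \<open>N\<close> with N + Ru
  maximal. From \<open>u = n + y v\<close> follows N + Ru \<subseteq> N + Rv, so maximality puts
  \<open>v\<close> into N + Ru; then a factor \<open>\<one> \<ominus> s \<otimes> y\<close>, which
  is a unit, carries \<open>v\<close> into \<open>N\<close>.\<close>

lemma nakayama:
  assumes N: "submodule N R M" and L: "submodule L R M" and y: "y \<in> \<mm>"
    and dec: "\<And>u. u \<in> L \<Longrightarrow> \<exists>n\<in>N. \<exists>v\<in>L. u = n \<oplus>\<^bsub>M\<^esub> y \<odot>\<^bsub>M\<^esub> v"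
  shows "L \<subseteq> N"
proof (rule ccontr)
  assume "\<not> L \<subseteq> N"
  note ND = submoduleD[OF N] and LD = submoduleD[OF L]
  have yR: "y \<in> carrier R" using y max_ideal(3) by blast
  let ?Q = "\<lambda>A. \<exists>u\<in>L. u \<notin> N \<and> A = add_cyclic N u"
  obtain w where "w \<in> L" "w \<notin> N" using \<open>\<not> L \<subseteq> N\<close> by blast
  then have "?Q (add_cyclic N w)" by blast
  moreover have "submodule A R M" if "?Q A" for A using that add_cyclic(1)[OF N] LD(1) by blast
  ultimately obtain A where A: "?Q A" and max: "\<And>C. ?Q C \<Longrightarrow> A \<subseteq> C \<Longrightarrow> C = A"
    using wf_obtain_maximal[OF wf_submodules, of ?Q] by metis
  obtain u where u: "u \<in> L" "u \<notin> N" "A = add_cyclic N u" using A by blast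
  obtain n v where nv: "n \<in> N" "v \<in> L" "u = n \<oplus>\<^bsub>M\<^esub> y \<odot>\<^bsub>M\<^esub> v" using dec[OF u(1)] by blast
  have M: "u \<in> carrier M" "v \<in> carrier M" "n \<in> carrier M" using u nv LD ND by auto
  have "v \<notin> N" using u nv ND(3)[OF nv(1) ND(6)[OF yR]] by blast
  note V = submoduleD[OF add_cyclic(1)[OF N M(2)]] and V' = add_cyclic(2,3)[OF N M(2)]
  have "u \<in> add_cyclic N v" unfolding mem_add_cyclic using nv yR by blast
  have "A \<subseteq> add_cyclic N v"
  proof
    fix z assume "z \<in> A"
    then obtain n' s where "n' \<in> N" "s \<in> carrier R" "z = n' \<oplus>\<^bsub>M\<^esub> s \<odot>\<^bsub>M\<^esub> u"
      unfolding u(3) mem_add_cyclic by blast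
    then show "z \<in> add_cyclic N v" using V(3)[OF _ V(6)[OF _ \<open>u \<in> add_cyclic N v\<close>]] V'(1) by blast
  qed
  then have "add_cyclic N v = A" using max nv(2) \<open>v \<notin> N\<close> by blast
  then have "v \<in> add_cyclic N u" using V'(2) u(3) by simp
  then obtain n' s where s: "n' \<in> N" "s \<in> carrier R" "v = n' \<oplus>\<^bsub>M\<^esub> s \<odot>\<^bsub>M\<^esub> u"
    unfolding mem_add_cyclic by blast
  have n'M: "n' \<in> carrier M" using s ND by blast
  obtain t where t: "t \<in> carrier R" "t \<otimes> (\<one> \<ominus> s \<otimes> y) = \<one>" using unit_one_minus[OF y s(2)] .
  have "v = (n' \<oplus>\<^bsub>M\<^esub> s \<odot>\<^bsub>M\<^esub> n) \<oplus>\<^bsub>M\<^esub> (s \<otimes> y) \<odot>\<^bsub>M\<^esub> v"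
    using s(3) nv(3) M n'M s(2) yR by (simp add: smult_r_distr smult_assoc1 M.a_assoc)
  then have "v \<ominus>\<^bsub>M\<^esub> (s \<otimes> y) \<odot>\<^bsub>M\<^esub> v = n' \<oplus>\<^bsub>M\<^esub> s \<odot>\<^bsub>M\<^esub> n"
    using M n'M s(2) yR
    by (metis M.add.inv_solve_right a_minus_def M.a_closed m_closed smult_closed)
  moreover have "(\<one> \<ominus> s \<otimes> y) \<odot>\<^bsub>M\<^esub> v = v \<ominus>\<^bsub>M\<^esub> (s \<otimes> y) \<odot>\<^bsub>M\<^esub> v"
    using M s(2) yR by (simp add: a_minus_def smult_l_distr smult_l_minus)
  ultimately have "(\<one> \<ominus> s \<otimes> y) \<odot>\<^bsub>M\<^esub> v \<in> N" using ND(3)[OF s(1) ND(6)[OF s(2) nv(1)]] by simp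
  then have "t \<odot>\<^bsub>M\<^esub> ((\<one> \<ominus> s \<otimes> y) \<odot>\<^bsub>M\<^esub> v) \<in> N" using ND(6)[OF t(1)] by blast
  moreover have "t \<odot>\<^bsub>M\<^esub> ((\<one> \<ominus> s \<otimes> y) \<odot>\<^bsub>M\<^esub> v) = v"
    using t M s(2) yR by (simp flip: smult_assoc1)
  ultimately show False using \<open>v \<notin> N\<close> by simp
qed

text \<open>Let \<open>L\<close> consist of the elements killed by \<open>p\<close> modulo
  \<open>N\<close>. Cancelling \<open>y\<close> shows that an element of \<open>L\<close> in N + yM
  lies in N + yL, so if all of \<open>L\<close> were in N + yM, Nakayama would put it into
  \<open>N\<close>. An element of \<open>L\<close> outside N + yM therefore exists, and an
  associated prime over its annihilator contains \<open>p\<close> and also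
  \<open>y \<notin> p\<close>: one strict step of the chain.\<close>

lemma assoc_prime_chain:
  assumes "submodule N R M" "set ys \<subseteq> \<mm>" "regular_seq_mod N ys" "assoc_prime N p"
  shows "\<exists>c. prime_chain R (length ys) c \<and> c 0 = p"
  using assms
proof (induction ys arbitrary: N p)
  case Nil
  then show ?case using prime_chain_0[of p R]
    by (intro exI[of _ "\<lambda>_. p"]) (simp add: assoc_prime_def)
next
  case (Cons y ys)
  note N = Cons.prems(1) and ND = submoduleD[OF Cons.prems(1)]
  obtain u0 where u0: "u0 \<in> carrier M" "colon N u0 = p" and p: "primeideal p R"
    using Cons.prems(4) unfolding assoc_prime_def by blast
  note pD = primeidealD[OF p]
  have y: "y \<in> \<mm>" "y \<in> carrier R" "regular_mod N y" "regular_seq_mod (add_mult N y) ys"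
    using Cons.prems max_ideal(3) by auto
  have "u0 \<notin> N" using one_mem_colon[OF u0(1)] u0(2) pD(3) by blast
  then have "y \<notin> p" using regular_modD[OF y(3) u0(1)] u0 by (auto simp: colon_def)
  define L where "L = {u \<in> carrier M. \<forall>r\<in>p. r \<odot>\<^bsub>M\<^esub> u \<in> N}"
  have L: "submodule L R M"
  proof (rule submoduleI')
    show "\<zero>\<^bsub>M\<^esub> \<in> L" using ND(2) pD(2) by (auto simp: L_def)
    show "u \<oplus>\<^bsub>M\<^esub> v \<in> L" if "u \<in> L" "v \<in> L" for u v
      using that ND(3) pD(2) by (auto simp: L_def smult_r_distr subsetD)
    show "r \<odot>\<^bsub>M\<^esub> u \<in> L" if r: "r \<in> carrier R" and u: "u \<in> L" for r u
      using u r ND(6)[OF r] pD(2) smult_comm[of _ r u] by (auto simp: L_def subsetD)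
  qed (auto simp: L_def)
  have "\<exists>u\<in>L. u \<notin> add_mult N y"
  proof (rule ccontr)
    assume neg: "\<not> (\<exists>u\<in>L. u \<notin> add_mult N y)"
    have "L \<subseteq> N"
    proof (rule nakayama[OF N L y(1)])
      fix u assume u: "u \<in> L"
      then obtain n v where nv: "n \<in> N" "v \<in> carrier M" "u = n \<oplus>\<^bsub>M\<^esub> y \<odot>\<^bsub>M\<^esub> v"
        using neg mem_add_mult by blast
      have nM: "n \<in> carrier M" using nv ND by blast
      have "r \<odot>\<^bsub>M\<^esub> v \<in> N" if r: "r \<in> p" for r
      proof -
        have rR: "r \<in> carrier R" using r pD by blast
        have "r \<odot>\<^bsub>M\<^esub> u = r \<odot>\<^bsub>M\<^esub> n \<oplus>\<^bsub>M\<^esub> y \<odot>\<^bsub>M\<^esub> (r \<odot>\<^bsub>M\<^esub> v)"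
          using nv nM rR y(2) by (simp add: smult_r_distr smult_comm)
        moreover have "r \<odot>\<^bsub>M\<^esub> u \<in> N" using u r by (simp add: L_def)
        ultimately have "y \<odot>\<^bsub>M\<^esub> (r \<odot>\<^bsub>M\<^esub> v) \<in> N"
          using submodule_add_cancel[OF N ND(6)[OF rR nv(1)]] nv rR y(2) by simp
        then show ?thesis using regular_modD[OF y(3)] nv rR by simp
      qed
      then show "\<exists>n\<in>N. \<exists>v\<in>L. u = n \<oplus>\<^bsub>M\<^esub> y \<odot>\<^bsub>M\<^esub> v" using nv by (auto simp: L_def)
    qed
    moreover have "u0 \<in> L" using u0 by (auto simp: L_def colon_def)
    ultimately show False using \<open>u0 \<notin> N\<close> by blast
  qed
  then obtain u where u: "u \<in> L" "u \<notin> add_mult N y" by blast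
  have uM: "u \<in> carrier M" using u by (simp add: L_def)
  note Y = add_mult[OF N y(2)]
  obtain q where q: "assoc_prime (add_mult N y) q" "colon (add_mult N y) u \<subseteq> q"
    using exists_assoc_prime[OF Y(1) uM u(2)] .
  have "p \<subseteq> q" using u(1) q(2) Y(2) pD(2) by (auto simp: L_def colon_def)
  moreover have "y \<in> q" using q(2) Y(3)[OF uM] y(2) by (auto simp: colon_def)
  ultimately have "p \<subset> q" using \<open>y \<notin> p\<close> by blast
  obtain c where c: "prime_chain R (length ys) c" "c 0 = q"
    using Cons.IH[OF Y(1) _ y(4) q(1)] Cons.prems(2) by auto
  then show ?case using prime_chain_Cons[OF c(1) p] \<open>p \<subset> q\<close>
    by (intro exI[of _ "case_nat p c"]) simp
qed

text \<open>Nakayama permits the swap: if \<open>w u\<close> lies in \<open>N\<close>, then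
  \<open>u = n + x v\<close>, and cancelling \<open>x\<close> shows that \<open>w v\<close> lies in
  \<open>N\<close> again. The second claim is cancellation alone.\<close>

lemma regular_permute:
  assumes N: "submodule N R M" and x: "x \<in> \<mm>" "regular_mod N x" and w: "regular_mod (add_mult N x) w"
  shows "regular_mod N w" "regular_mod (add_mult N w) x"
proof -
  note ND = submoduleD[OF N]
  have xR: "x \<in> carrier R" using x max_ideal(3) by blast
  have wR: "w \<in> carrier R" using w by (simp add: regular_mod_def)
  note X = add_mult[OF N xR] and W = add_mult[OF N wR]
  note XD = submoduleD[OF X(1)]
  define L where "L = {u \<in> carrier M. w \<odot>\<^bsub>M\<^esub> u \<in> N}"
  have L: "submodule L R M"
  proof (rule submoduleI')
    show "\<zero>\<^bsub>M\<^esub> \<in> L" using ND(2) wR by (auto simp: L_def)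
    show "u \<oplus>\<^bsub>M\<^esub> v \<in> L" if "u \<in> L" "v \<in> L" for u v
      using that ND(3) wR by (auto simp: L_def smult_r_distr)
    show "r \<odot>\<^bsub>M\<^esub> u \<in> L" if r: "r \<in> carrier R" and u: "u \<in> L" for r u
      using u r ND(6)[OF r] wR smult_comm[of w r u] by (auto simp: L_def)
  qed (auto simp: L_def)
  have "L \<subseteq> N"
  proof (rule nakayama[OF N L x(1)])
    fix u assume u: "u \<in> L"
    then have "u \<in> add_mult N x" using regular_modD[OF w] X(2) by (auto simp: L_def)
    then obtain n v where nv: "n \<in> N" "v \<in> carrier M" "u = n \<oplus>\<^bsub>M\<^esub> x \<odot>\<^bsub>M\<^esub> v"
      unfolding mem_add_mult by blast
    have nM: "n \<in> carrier M" using nv ND by blast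
    have "w \<odot>\<^bsub>M\<^esub> u = w \<odot>\<^bsub>M\<^esub> n \<oplus>\<^bsub>M\<^esub> x \<odot>\<^bsub>M\<^esub> (w \<odot>\<^bsub>M\<^esub> v)"
      using nv nM xR wR by (simp add: smult_r_distr smult_comm)
    then have "x \<odot>\<^bsub>M\<^esub> (w \<odot>\<^bsub>M\<^esub> v) \<in> N"
      using submodule_add_cancel[OF N ND(6)[OF wR nv(1)]] nv xR wR u by (simp add: L_def)
    then have "v \<in> L" using regular_modD[OF x(2)] nv wR by (simp add: L_def)
    then show "\<exists>n\<in>N. \<exists>v\<in>L. u = n \<oplus>\<^bsub>M\<^esub> x \<odot>\<^bsub>M\<^esub> v" using nv by blast
  qed
  then show "regular_mod N w" using wR by (auto simp: regular_mod_def L_def)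
  show "regular_mod (add_mult N w) x"
    unfolding regular_mod_def
  proof (intro conjI ballI impI xR)
    fix u assume u: "u \<in> carrier M" "x \<odot>\<^bsub>M\<^esub> u \<in> add_mult N w"
    then obtain n v where nv: "n \<in> N" "v \<in> carrier M" "x \<odot>\<^bsub>M\<^esub> u = n \<oplus>\<^bsub>M\<^esub> w \<odot>\<^bsub>M\<^esub> v"
      unfolding mem_add_mult by blast
    have "w \<odot>\<^bsub>M\<^esub> v \<in> add_mult N x"
      using submodule_add_cancel[OF X(1), of n "w \<odot>\<^bsub>M\<^esub> v"] nv(1,2) nv(3)[symmetric]
        X(2) X(3)[OF u(1)] wR by auto
    then have "v \<in> add_mult N x" using regular_modD[OF w nv(2)] by blast
    then obtain n' v' where nv': "n' \<in> N" "v' \<in> carrier M" "v = n' \<oplus>\<^bsub>M\<^esub> x \<odot>\<^bsub>M\<^esub> v'"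
      unfolding mem_add_mult by blast
    have nM: "n \<in> carrier M" "n' \<in> carrier M" using nv nv' ND by auto
    have "x \<odot>\<^bsub>M\<^esub> u = (n \<oplus>\<^bsub>M\<^esub> w \<odot>\<^bsub>M\<^esub> n') \<oplus>\<^bsub>M\<^esub> x \<odot>\<^bsub>M\<^esub> (w \<odot>\<^bsub>M\<^esub> v')"
      using nv nv' nM xR wR by (simp add: smult_r_distr M.a_assoc smult_comm)
    then have "x \<odot>\<^bsub>M\<^esub> (u \<ominus>\<^bsub>M\<^esub> w \<odot>\<^bsub>M\<^esub> v') = n \<oplus>\<^bsub>M\<^esub> w \<odot>\<^bsub>M\<^esub> n'"
      using u nv' nM xR wR by (simp add: a_minus_def smult_r_distr smult_r_minus M.a_assoc M.r_neg)
    then have "x \<odot>\<^bsub>M\<^esub> (u \<ominus>\<^bsub>M\<^esub> w \<odot>\<^bsub>M\<^esub> v') \<in> N" using ND(3)[OF nv(1) ND(6)[OF wR nv'(1)]] by simp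
    then have "u \<ominus>\<^bsub>M\<^esub> w \<odot>\<^bsub>M\<^esub> v' \<in> N" using regular_modD[OF x(2)] u wR nv' by simp
    moreover have "u = (u \<ominus>\<^bsub>M\<^esub> w \<odot>\<^bsub>M\<^esub> v') \<oplus>\<^bsub>M\<^esub> w \<odot>\<^bsub>M\<^esub> v'"
      using u nv' wR by (simp add: a_minus_def M.a_assoc M.l_neg)
    ultimately show "u \<in> add_mult N w" unfolding mem_add_mult using nv' by blast
  qed
qed

text \<open>An element \<open>w\<close> regular modulo both N + xM and N + yM can be permuted in
  front of \<open>x\<close> and of \<open>y\<close>. Modulo N + wM there is then a regular sequence
  starting with \<open>y\<close>, one member shorter than \<open>ys\<close>, so \<open>x\<close> can
  be divided out there by induction; \<open>w\<close> is put back in front at the end.\<close>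

lemma regular_seq_quotient:
  assumes "submodule N R M" "set ys \<subseteq> \<mm>" "regular_seq_mod N ys" "length ys = Suc n"
    "x \<in> \<mm>" "regular_mod N x"
  shows "\<exists>zs. set zs \<subseteq> \<mm> \<and> length zs = n \<and> regular_seq_mod (add_mult N x) zs"
  using assms
proof (induction n arbitrary: N x ys)
  case 0
  note N = 0(1) and ND = submoduleD[OF 0(1)]
  obtain y where y: "ys = [y]" using 0(4) by (cases ys) auto
  have yR: "y \<in> carrier R" using 0 y max_ideal(3) by auto
  have ne: "N \<noteq> carrier M" using 0(3) y add_mult(2)[OF N yR] submoduleD(1)[OF add_mult(1)[OF N yR]] by auto
  \<comment> \<open>M = N + xM would give M = N by Nakayama.\<close>
  have "add_mult N x \<noteq> carrier M"
  proof
    assume eq: "add_mult N x = carrier M"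
    have "carrier M \<subseteq> N"
      using eq mem_add_mult by (intro nakayama[OF N carrier_is_submodule 0(5)]) blast
    then show False using ne ND(1) by blast
  qed
  then show ?case by (intro exI[of _ "[]"]) simp
next
  case (Suc n)
  note N = Suc.prems(1)
  obtain y y2 ys' where ys: "ys = y # y2 # ys'" using Suc.prems(4) by (metis length_Suc_conv)
  have y: "y \<in> \<mm>" "y2 \<in> \<mm>" "regular_mod N y" "regular_mod (add_mult N y) y2"
    using Suc.prems ys by auto
  have R: "y \<in> carrier R" "x \<in> carrier R" using y Suc.prems max_ideal(3) by auto
  note X = add_mult[OF N R(2)] and Y = add_mult[OF N R(1)]
  \<comment> \<open>A second member \<open>y2\<close> exists since the length is at least 2; being
    regular modulo N + yM, it provides the vanishing that the exchange carries over to N +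
    xM.\<close>
  have tl: "torsionless_mod \<mm> (add_mult N y)"
    using y(2,4) regular_modD unfolding torsionless_mod_def by blast
  have "torsionless_mod \<mm> (add_mult N x)"
    by (rule torsionless_exchange[OF N max_ideal(3) y(1) R(2) Suc.prems(6) y(3) tl])
  then obtain w where w: "w \<in> \<mm>" "regular_mod (add_mult N x) w" "regular_mod (add_mult N y) w"
    using exists_common_regular[OF X(1) Y(1) max_ideal(1) _ tl] by metis
  have wR: "w \<in> carrier R" using w max_ideal(3) by blast
  note W = add_mult[OF N wR]
  have wx: "regular_mod (add_mult N w) x" and wN: "regular_mod N w"
    using regular_permute[OF N Suc.prems(5,6) w(2)] by auto
  have wy: "regular_mod (add_mult N w) y" using regular_permute[OF N y(1,3) w(3)] by auto
  \<comment> \<open>First use of the induction hypothesis: the tail of \<open>ys\<close>, a regular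
    sequence modulo N + yM, is divided by \<open>w\<close>.\<close>
  obtain zs where zs: "set zs \<subseteq> \<mm>" "length zs = n" "regular_seq_mod (add_mult (add_mult N y) w) zs"
    using Suc.IH[OF Y(1), of "y2 # ys'" w] Suc.prems ys w by auto
  then have "regular_seq_mod (add_mult N w) (y # zs)"
    using wy add_mult_commute[OF N R(1) wR] by simp
  \<comment> \<open>Second use, now modulo N + wM: the sequence \<open>y # zs\<close> has length
    \<open>Suc n\<close> again and is divided by \<open>x\<close>.\<close>
  then obtain zs' where "set zs' \<subseteq> \<mm>" "length zs' = n" "regular_seq_mod (add_mult (add_mult N w) x) zs'"
    using Suc.IH[OF W(1), of "y # zs" x] zs y(1) Suc.prems(5) wx by auto
  then show ?case using add_mult_commute[OF N R(2) wR] w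
    by (intro exI[of _ "w # zs'"]) auto
qed

lemma zero_divisor_ideal_chain:
  assumes N: "submodule N R M" and ys: "set ys \<subseteq> \<mm>" "regular_seq_mod N ys" "length ys = Suc n"
    and x: "x \<in> \<mm>" "regular_mod N x" and J: "ideal J R"
    and zd: "\<And>y. y \<in> J \<Longrightarrow> \<not> regular_mod (add_mult N x) y"
  shows "\<exists>c. prime_chain R n c \<and> J \<subseteq> c 0"
proof -
  have xR: "x \<in> carrier R" using x max_ideal(3) by blast
  note X = add_mult[OF N xR]
  obtain zs where zs: "set zs \<subseteq> \<mm>" "length zs = n" "regular_seq_mod (add_mult N x) zs"
    using regular_seq_quotient[OF N ys x] by blast
  \<comment> \<open>With the same submodule in both places, prime avoidance would give a regular
    element of \<open>J\<close>. So the zero divisors in \<open>J\<close> have a common witness: one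
    nonzero class killed by all of \<open>J\<close>.\<close>
  have "\<not> torsionless_mod J (add_mult N x)" using exists_common_regular[OF X(1) X(1) J] zd by metis
  then obtain u where u: "u \<in> carrier M" "u \<notin> add_mult N x" "\<And>s. s \<in> J \<Longrightarrow> s \<odot>\<^bsub>M\<^esub> u \<in> add_mult N x"
    unfolding torsionless_mod_def by blast
  obtain q where q: "assoc_prime (add_mult N x) q" "colon (add_mult N x) u \<subseteq> q"
    using exists_assoc_prime[OF X(1) u(1,2)] .
  have "J \<subseteq> q" using q(2) u(3) ideal.Icarr[OF J] by (auto simp: colon_def)
  then show ?thesis using assoc_prime_chain[OF X(1) zs(1,3) q(1)] zs(2) by auto
qed

end

section \<open>Quotient modules and modules of homomorphisms\<close>

lemma submodule_abelian_subgroup: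
  assumes "module R M" "submodule N R M"
  shows "abelian_subgroup N M"
proof -
  interpret module R M by fact
  interpret N: submodule N R M by fact
  show ?thesis
    by (intro abelian_subgroupI3 additive_subgroup.intro N.subgroup_axioms M.abelian_group_axioms)
qed

context
  fixes R :: "('a, 'r) ring_scheme" (structure) and M :: "('a, 'm) module" (structure) and N :: "'m set"
  assumes M: "module R M" and N: "submodule N R M"
begin

interpretation module R M by (rule M)
interpretation N: abelian_subgroup N M by (rule submodule_abelian_subgroup[OF M N])

lemma quotient_coset_eq_iff:
  "a \<in> carrier M \<Longrightarrow> b \<in> carrier M \<Longrightarrow> N +>\<^bsub>M\<^esub> a = N +>\<^bsub>M\<^esub> b \<longleftrightarrow> a \<ominus>\<^bsub>M\<^esub> b \<in> N"
  unfolding a_minus_def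
  by (metis N.a_rcos_module N.a_rcos_self N.a_repr_independence')

lemma quotient_coset_eq_zero_iff: "a \<in> carrier M \<Longrightarrow> N +>\<^bsub>M\<^esub> a = N \<longleftrightarrow> a \<in> N"
  using N.a_rcos_self N.a_rcos_const by blast

lemma quotient_carrier: "carrier (quotient_module M N) = {N +>\<^bsub>M\<^esub> a | a. a \<in> carrier M}"
  unfolding quotient_module_def A_RCOSETS_def' by auto

lemma quotient_zero: "\<zero>\<^bsub>quotient_module M N\<^esub> = N"
  by (simp add: quotient_module_def)

lemma quotient_add:
  "a \<in> carrier M \<Longrightarrow> b \<in> carrier M \<Longrightarrow>
    (N +>\<^bsub>M\<^esub> a) \<oplus>\<^bsub>quotient_module M N\<^esub> (N +>\<^bsub>M\<^esub> b) = N +>\<^bsub>M\<^esub> (a \<oplus>\<^bsub>M\<^esub> b)"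
  by (simp add: quotient_module_def N.a_rcos_sum)

text \<open>\<open>quotient_module\<close> scales a coset by a union over all its representatives;
  the union collapses because they all give the same coset.\<close>

lemma quotient_smult:
  assumes "r \<in> carrier R" "a \<in> carrier M"
  shows "r \<odot>\<^bsub>quotient_module M N\<^esub> (N +>\<^bsub>M\<^esub> a) = N +>\<^bsub>M\<^esub> (r \<odot>\<^bsub>M\<^esub> a)"
proof -
  have "N +>\<^bsub>M\<^esub> (r \<odot>\<^bsub>M\<^esub> x) = N +>\<^bsub>M\<^esub> (r \<odot>\<^bsub>M\<^esub> a)" if x: "x \<in> N +>\<^bsub>M\<^esub> a" for x
  proof -
    obtain n where n: "n \<in> N" "x = n \<oplus>\<^bsub>M\<^esub> a" using x unfolding a_r_coset_def' by blast
    have nM: "n \<in> carrier M" using n submoduleD[OF N] by blast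
    have "r \<odot>\<^bsub>M\<^esub> x \<ominus>\<^bsub>M\<^esub> r \<odot>\<^bsub>M\<^esub> a = r \<odot>\<^bsub>M\<^esub> n"
      using n nM assms by (simp add: smult_r_distr a_minus_def M.a_assoc M.r_neg)
    then show ?thesis
      using quotient_coset_eq_iff[of "r \<odot>\<^bsub>M\<^esub> x" "r \<odot>\<^bsub>M\<^esub> a"] submoduleD(6)[OF N assms(1) n(1)] n nM assms
      by simp
  qed
  then have "(\<Union>x\<in>N +>\<^bsub>M\<^esub> a. N +>\<^bsub>M\<^esub> (r \<odot>\<^bsub>M\<^esub> x)) = (\<Union>x\<in>N +>\<^bsub>M\<^esub> a. N +>\<^bsub>M\<^esub> (r \<odot>\<^bsub>M\<^esub> a))"
    by (rule SUP_cong[OF refl])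
  moreover have "N +>\<^bsub>M\<^esub> a \<noteq> {}" using N.a_rcos_self assms by blast
  ultimately show ?thesis unfolding quotient_module_def by (simp only: module.simps UN_constant if_False)
qed

lemma module_quotient: "module R (quotient_module M N)"
proof -
  note simps = quotient_carrier quotient_add quotient_smult quotient_zero
  have z: "N +>\<^bsub>M\<^esub> \<zero>\<^bsub>M\<^esub> = N" using quotient_coset_eq_zero_iff[of "\<zero>\<^bsub>M\<^esub>"] submoduleD(2)[OF N] by simp
  have zl: "N \<oplus>\<^bsub>quotient_module M N\<^esub> (N +>\<^bsub>M\<^esub> a) = N +>\<^bsub>M\<^esub> a" if "a \<in> carrier M" for a
    using quotient_add[OF M.zero_closed that] z that by simp
  have mem: "N \<in> carrier (quotient_module M N)" unfolding quotient_carrier using z M.zero_closed by blast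
  have "abelian_group (quotient_module M N)"
  proof (rule abelian_groupI)
    show "\<exists>y\<in>carrier (quotient_module M N). y \<oplus>\<^bsub>quotient_module M N\<^esub> x = \<zero>\<^bsub>quotient_module M N\<^esub>"
      if x: "x \<in> carrier (quotient_module M N)" for x
    proof -
      obtain a where a: "a \<in> carrier M" "x = N +>\<^bsub>M\<^esub> a" using x by (auto simp: simps)
      have "(N +>\<^bsub>M\<^esub> (\<ominus>\<^bsub>M\<^esub> a)) \<oplus>\<^bsub>quotient_module M N\<^esub> x = \<zero>\<^bsub>quotient_module M N\<^esub>"
        using a z by (simp add: simps M.l_neg)
      then show ?thesis
        using a by (intro bexI[of _ "N +>\<^bsub>M\<^esub> (\<ominus>\<^bsub>M\<^esub> a)"]) (auto simp: quotient_carrier)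
    qed
    show "\<zero>\<^bsub>quotient_module M N\<^esub> \<in> carrier (quotient_module M N)" using mem by (simp add: quotient_zero)
  qed (auto simp: simps zl M.a_ac)
  then show ?thesis
  proof (intro moduleI R.is_cring)
    show "a \<odot>\<^bsub>quotient_module M N\<^esub> x \<in> carrier (quotient_module M N)"
      if "a \<in> carrier R" "x \<in> carrier (quotient_module M N)" for a x
      using that by (auto simp: simps)
  qed (auto simp: simps smult_l_distr smult_r_distr smult_assoc1)
qed

text \<open>The bridge from regularity on an actual quotient module to the relative notion inside
  \<open>M\<close>.\<close>

lemma regular_element_quotient_iff:
  "regular_element R (quotient_module M N) r \<longleftrightarrow> regular_mod N r"
proof -
  have "r \<odot>\<^bsub>quotient_module M N\<^esub> (N +>\<^bsub>M\<^esub> a) = N \<longleftrightarrow> r \<odot>\<^bsub>M\<^esub> a \<in> N"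
    if "r \<in> carrier R" "a \<in> carrier M" for a
    using that by (simp add: quotient_smult quotient_coset_eq_zero_iff)
  then show ?thesis
    unfolding regular_element_def regular_mod_def quotient_carrier quotient_zero
    using quotient_coset_eq_zero_iff by (auto; metis)
qed

end

lemma submodule_gen_mem:
  assumes "module R M" "S \<subseteq> carrier M"
  shows "submodule (submodule_gen R M S) R M" "S \<subseteq> submodule_gen R M S"
    "\<And>N. submodule N R M \<Longrightarrow> S \<subseteq> N \<Longrightarrow> submodule_gen R M S \<subseteq> N"
proof -
  interpret module R M by fact
  show "submodule (submodule_gen R M S) R M"
    unfolding submodule_gen_def
  proof (rule submoduleI')
    show "\<Inter> {N. submodule N R M \<and> S \<subseteq> N} \<subseteq> carrier M"
      using carrier_is_submodule assms(2) by blast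
  qed (auto simp: submoduleD)
qed (auto simp: submodule_gen_def)

context
  fixes R :: "('a, 'r) ring_scheme" (structure) and M :: "('a, 'm) module" (structure)
  assumes M: "module R M"
begin

interpretation module R M by (rule M)

lemma mult_submodule_props:
  assumes "S \<subseteq> carrier R"
  shows "submodule (mult_submodule R S M) R M"
    "s \<in> S \<Longrightarrow> u \<in> carrier M \<Longrightarrow> s \<odot>\<^bsub>M\<^esub> u \<in> mult_submodule R S M"
    "submodule N R M \<Longrightarrow> (\<And>s u. s \<in> S \<Longrightarrow> u \<in> carrier M \<Longrightarrow> s \<odot>\<^bsub>M\<^esub> u \<in> N) \<Longrightarrow> mult_submodule R S M \<subseteq> N"
proof -
  have "{s \<odot>\<^bsub>M\<^esub> x | s x. s \<in> S \<and> x \<in> carrier M} \<subseteq> carrier M" using assms by auto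
  note G = submodule_gen_mem[OF M this]
  show "submodule (mult_submodule R S M) R M" unfolding mult_submodule_def by (rule G)
  show "s \<in> S \<Longrightarrow> u \<in> carrier M \<Longrightarrow> s \<odot>\<^bsub>M\<^esub> u \<in> mult_submodule R S M"
    unfolding mult_submodule_def using G(2) by blast
  show "submodule N R M \<Longrightarrow> (\<And>s u. s \<in> S \<Longrightarrow> u \<in> carrier M \<Longrightarrow> s \<odot>\<^bsub>M\<^esub> u \<in> N) \<Longrightarrow> mult_submodule R S M \<subseteq> N"
    unfolding mult_submodule_def by (rule G(3)) auto
qed

lemma mult_submodule_empty: "mult_submodule R {} M = {\<zero>\<^bsub>M\<^esub>}"
  using mult_submodule_props[of "{}"] submodule_zero submoduleD(2) by fast

lemma mult_submodule_insert:
  assumes S: "S \<subseteq> carrier R" and y: "y \<in> carrier R"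
  shows "mult_submodule R (insert y S) M = add_mult (mult_submodule R S M) y"
proof
  note P = mult_submodule_props[OF S]
  have "insert y S \<subseteq> carrier R" using assms by blast
  note Q = mult_submodule_props[OF this]
  note A = add_mult[OF P(1) y]
  show "mult_submodule R (insert y S) M \<subseteq> add_mult (mult_submodule R S M) y"
    using A P(2) by (intro Q(3)) auto
  have "mult_submodule R S M \<subseteq> mult_submodule R (insert y S) M"
    using Q(1,2) by (intro P(3)) auto
  then show "add_mult (mult_submodule R S M) y \<subseteq> mult_submodule R (insert y S) M"
    using Q(2) submoduleD(3)[OF Q(1)] by (fastforce simp: mem_add_mult)
qed

text \<open>\<open>S\<close> holds the members already consumed: \<open>regular_sequence\<close>
  divides by a whole prefix at once, \<open>regular_seq_mod\<close> by one member at a time, and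
  only with a general start does the induction match the two.\<close>

lemma regular_seq_mod_of_regular_sequence:
  assumes "S \<subseteq> carrier R" "set rs \<subseteq> carrier R"
    and "\<And>i. i < length rs \<Longrightarrow> regular_mod (mult_submodule R (S \<union> set (take i rs)) M) (rs ! i)"
    and "mult_submodule R (S \<union> set rs) M \<noteq> carrier M"
  shows "regular_seq_mod (mult_submodule R S M) rs"
  using assms
proof (induction rs arbitrary: S)
  case (Cons r rs)
  have "regular_seq_mod (mult_submodule R (insert r S) M) rs"
  proof (rule Cons.IH)
    show "regular_mod (mult_submodule R (insert r S \<union> set (take i rs)) M) (rs ! i)" if "i < length rs" for i
      using Cons.prems(3)[of "Suc i"] that by simp
  qed (use Cons.prems in auto)
  then show ?case using Cons.prems(3)[of 0] Cons.prems mult_submodule_insert by auto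
qed auto

lemma regular_sequence_imp:
  assumes "regular_sequence R M rs" "set rs \<subseteq> carrier R"
  shows "regular_seq_mod {\<zero>\<^bsub>M\<^esub>} rs"
proof -
  have "regular_seq_mod (mult_submodule R {} M) rs"
  proof (rule regular_seq_mod_of_regular_sequence)
    fix i assume "i < length rs"
    moreover have "set (take i rs) \<subseteq> carrier R" using assms(2) set_take_subset by fast
    ultimately show "regular_mod (mult_submodule R ({} \<union> set (take i rs)) M) (rs ! i)"
      using assms(1) regular_element_quotient_iff[OF M mult_submodule_props(1)]
      unfolding regular_sequence_def by auto
  qed (use assms in \<open>auto simp: regular_sequence_def\<close>)
  then show ?thesis by (simp add: mult_submodule_empty)
qed

end

lemma module_homD:
  assumes "f \<in> module_hom R M N"
  shows "x \<in> carrier M \<Longrightarrow> f x \<in> carrier N"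
    "x \<in> carrier M \<Longrightarrow> y \<in> carrier M \<Longrightarrow> f (x \<oplus>\<^bsub>M\<^esub> y) = f x \<oplus>\<^bsub>N\<^esub> f y"
    "r \<in> carrier R \<Longrightarrow> x \<in> carrier M \<Longrightarrow> f (r \<odot>\<^bsub>M\<^esub> x) = r \<odot>\<^bsub>N\<^esub> f x"
  using assms by (auto simp: module_hom_def)

lemma module_homD2:
  assumes "f \<in> module_hom R M N" "module R M" "module R N"
  shows "f \<zero>\<^bsub>M\<^esub> = \<zero>\<^bsub>N\<^esub>"
    "x \<in> carrier M \<Longrightarrow> f (\<ominus>\<^bsub>M\<^esub> x) = \<ominus>\<^bsub>N\<^esub> f x"
    "x \<in> carrier M \<Longrightarrow> y \<in> carrier M \<Longrightarrow> f (x \<ominus>\<^bsub>M\<^esub> y) = f x \<ominus>\<^bsub>N\<^esub> f y"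
proof -
  interpret M: module R M by fact
  interpret N: module R N by fact
  note D = module_homD[OF assms(1)]
  have "f (\<zero>\<^bsub>R\<^esub> \<odot>\<^bsub>M\<^esub> \<zero>\<^bsub>M\<^esub>) = \<zero>\<^bsub>R\<^esub> \<odot>\<^bsub>N\<^esub> f \<zero>\<^bsub>M\<^esub>" using D(3) by blast
  then show "f \<zero>\<^bsub>M\<^esub> = \<zero>\<^bsub>N\<^esub>" using D(1) by simp
  have neg: "f (\<ominus>\<^bsub>M\<^esub> x) = \<ominus>\<^bsub>N\<^esub> f x" if x: "x \<in> carrier M" for x
  proof -
    have "f ((\<ominus>\<^bsub>R\<^esub> \<one>\<^bsub>R\<^esub>) \<odot>\<^bsub>M\<^esub> x) = (\<ominus>\<^bsub>R\<^esub> \<one>\<^bsub>R\<^esub>) \<odot>\<^bsub>N\<^esub> f x" using D(3) x by simp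
    then show ?thesis using D(1)[OF x] x by (simp add: M.smult_l_minus N.smult_l_minus)
  qed
  then show "x \<in> carrier M \<Longrightarrow> f (\<ominus>\<^bsub>M\<^esub> x) = \<ominus>\<^bsub>N\<^esub> f x" .
  show "x \<in> carrier M \<Longrightarrow> y \<in> carrier M \<Longrightarrow> f (x \<ominus>\<^bsub>M\<^esub> y) = f x \<ominus>\<^bsub>N\<^esub> f y"
    using D(2) neg by (simp add: a_minus_def)
qed

lemma module_Hom_module:
  fixes R :: "('a, 'r) ring_scheme" and M :: "('a, 'm) module" and E :: "('a, 'e) module"
  assumes "module R M" "module R E"
  shows "module R (Hom_module R M E)" (is "module R ?H")
proof -
  interpret M: module R M by fact
  interpret E: module R E by fact
  let ?res = "\<lambda>f. restrict f (carrier M)"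
  have carr: "f \<in> carrier ?H \<longleftrightarrow> f \<in> module_hom R M E \<and> f \<in> extensional (carrier M)" for f
    by (simp add: Hom_module_def)
  have eqI: "f = g" if "f \<in> carrier ?H" "g \<in> carrier ?H" "\<And>x. x \<in> carrier M \<Longrightarrow> f x = g x" for f g
    using that by (auto simp: carr intro: extensionalityI)
  have hom: "?res f \<in> carrier ?H"
    if "\<And>x. x \<in> carrier M \<Longrightarrow> f x \<in> carrier E"
      "\<And>x y. x \<in> carrier M \<Longrightarrow> y \<in> carrier M \<Longrightarrow> f (x \<oplus>\<^bsub>M\<^esub> y) = f x \<oplus>\<^bsub>E\<^esub> f y"
      "\<And>r x. r \<in> carrier R \<Longrightarrow> x \<in> carrier M \<Longrightarrow> f (r \<odot>\<^bsub>M\<^esub> x) = r \<odot>\<^bsub>E\<^esub> f x" for f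
    using that by (simp add: carr module_hom_def)
  have app: "f x \<in> carrier E" if "f \<in> carrier ?H" "x \<in> carrier M" for f x
    using that by (auto simp: carr dest: module_homD)
  have lin: "f (x \<oplus>\<^bsub>M\<^esub> y) = f x \<oplus>\<^bsub>E\<^esub> f y" "r \<in> carrier R \<Longrightarrow> f (r \<odot>\<^bsub>M\<^esub> x) = r \<odot>\<^bsub>E\<^esub> f x"
    if "f \<in> carrier ?H" "x \<in> carrier M" "y \<in> carrier M" for f x y r
    using that by (auto simp: carr dest: module_homD)
  have add: "f \<oplus>\<^bsub>?H\<^esub> g = ?res (\<lambda>x. f x \<oplus>\<^bsub>E\<^esub> g x)" for f g by (simp add: Hom_module_def)
  have smult: "r \<odot>\<^bsub>?H\<^esub> f = ?res (\<lambda>x. r \<odot>\<^bsub>E\<^esub> f x)" for f r by (simp add: Hom_module_def)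
  have zero: "\<zero>\<^bsub>?H\<^esub> = ?res (\<lambda>x. \<zero>\<^bsub>E\<^esub>)" by (simp add: Hom_module_def)
  have add_c: "f \<oplus>\<^bsub>?H\<^esub> g \<in> carrier ?H" if "f \<in> carrier ?H" "g \<in> carrier ?H" for f g
    unfolding add using that
    by (intro hom) (simp_all add: app lin E.smult_r_distr E.a_ac)
  have smult_c: "r \<odot>\<^bsub>?H\<^esub> f \<in> carrier ?H" if "r \<in> carrier R" "f \<in> carrier ?H" for r f
    unfolding smult using that
    by (intro hom) (simp_all add: app lin E.smult_r_distr E.smult_comm)
  have zero_c: "\<zero>\<^bsub>?H\<^esub> \<in> carrier ?H" unfolding zero by (intro hom) auto
  have add_app: "(f \<oplus>\<^bsub>?H\<^esub> g) x = f x \<oplus>\<^bsub>E\<^esub> g x" if "x \<in> carrier M" for f g x using that by (simp add: add)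
  have smult_app: "(r \<odot>\<^bsub>?H\<^esub> f) x = r \<odot>\<^bsub>E\<^esub> f x" if "x \<in> carrier M" for r f x using that by (simp add: smult)
  have zero_app: "\<zero>\<^bsub>?H\<^esub> x = \<zero>\<^bsub>E\<^esub>" if "x \<in> carrier M" for x using that by (simp add: zero)
  have "abelian_group ?H"
  proof (rule abelian_groupI)
    fix f assume f: "f \<in> carrier ?H"
    have "(\<ominus>\<^bsub>R\<^esub> \<one>\<^bsub>R\<^esub>) \<odot>\<^bsub>?H\<^esub> f \<oplus>\<^bsub>?H\<^esub> f = \<zero>\<^bsub>?H\<^esub>"
      using f by (intro eqI add_c smult_c zero_c)
        (auto simp: add_app smult_app zero_app app E.smult_l_minus E.l_neg)
    then show "\<exists>g\<in>carrier ?H. g \<oplus>\<^bsub>?H\<^esub> f = \<zero>\<^bsub>?H\<^esub>" using smult_c[OF _ f] by blast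
    show "\<zero>\<^bsub>?H\<^esub> \<oplus>\<^bsub>?H\<^esub> f = f"
      using f by (intro eqI add_c zero_c) (auto simp: add_app zero_app app)
    fix g assume g: "g \<in> carrier ?H"
    show "f \<oplus>\<^bsub>?H\<^esub> g = g \<oplus>\<^bsub>?H\<^esub> f"
      using f g by (intro eqI add_c) (auto simp: add_app app E.a_comm)
    fix h assume h: "h \<in> carrier ?H"
    show "f \<oplus>\<^bsub>?H\<^esub> g \<oplus>\<^bsub>?H\<^esub> h = f \<oplus>\<^bsub>?H\<^esub> (g \<oplus>\<^bsub>?H\<^esub> h)"
      using f g h by (intro eqI add_c) (auto simp: add_app app E.a_assoc)
  qed (auto intro: add_c zero_c)
  then show ?thesis
  proof (intro moduleI M.R.is_cring smult_c)
    fix r s f assume *: "r \<in> carrier R" "s \<in> carrier R" "f \<in> carrier ?H"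
    show "(r \<oplus>\<^bsub>R\<^esub> s) \<odot>\<^bsub>?H\<^esub> f = r \<odot>\<^bsub>?H\<^esub> f \<oplus>\<^bsub>?H\<^esub> s \<odot>\<^bsub>?H\<^esub> f"
      using * by (intro eqI add_c smult_c) (auto simp: add_app smult_app app E.smult_l_distr)
    show "(r \<otimes>\<^bsub>R\<^esub> s) \<odot>\<^bsub>?H\<^esub> f = r \<odot>\<^bsub>?H\<^esub> (s \<odot>\<^bsub>?H\<^esub> f)"
      using * by (intro eqI add_c smult_c) (auto simp: add_app smult_app app E.smult_assoc1)
  next
    fix r f g assume *: "r \<in> carrier R" "f \<in> carrier ?H" "g \<in> carrier ?H"
    show "r \<odot>\<^bsub>?H\<^esub> (f \<oplus>\<^bsub>?H\<^esub> g) = r \<odot>\<^bsub>?H\<^esub> f \<oplus>\<^bsub>?H\<^esub> r \<odot>\<^bsub>?H\<^esub> g"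
      using * by (intro eqI add_c smult_c) (auto simp: add_app smult_app app E.smult_r_distr)
  next
    fix f assume "f \<in> carrier ?H"
    then show "\<one>\<^bsub>R\<^esub> \<odot>\<^bsub>?H\<^esub> f = f"
      by (intro eqI smult_c) (auto simp: smult_app app)
  qed auto
qed

section \<open>Injective modules\<close>

text \<open>The graph of a homomorphism to \<open>E\<close> from a submodule of \<open>M\<close>; by linearity it is single-valued
  as soon as \<open>0\<close> has only one value.\<close>

definition hom_graph ::
  "('a, 'r) ring_scheme \<Rightarrow> ('a, 'm) module \<Rightarrow> ('a, 'e) module \<Rightarrow> ('m \<times> 'e) set \<Rightarrow> bool" where
  "hom_graph R M E G \<longleftrightarrow> G \<subseteq> carrier M \<times> carrier E \<and> (\<zero>\<^bsub>M\<^esub>, \<zero>\<^bsub>E\<^esub>) \<in> G \<and>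
     (\<forall>x a y b. (x, a) \<in> G \<and> (y, b) \<in> G \<longrightarrow> (x \<oplus>\<^bsub>M\<^esub> y, a \<oplus>\<^bsub>E\<^esub> b) \<in> G) \<and>
     (\<forall>r x a. r \<in> carrier R \<and> (x, a) \<in> G \<longrightarrow> (r \<odot>\<^bsub>M\<^esub> x, r \<odot>\<^bsub>E\<^esub> a) \<in> G) \<and>
     (\<forall>a. (\<zero>\<^bsub>M\<^esub>, a) \<in> G \<longrightarrow> a = \<zero>\<^bsub>E\<^esub>)"

lemma hom_graphD:
  assumes "hom_graph R M E G"
  shows "(x, a) \<in> G \<Longrightarrow> x \<in> carrier M" "(x, a) \<in> G \<Longrightarrow> a \<in> carrier E" "(\<zero>\<^bsub>M\<^esub>, \<zero>\<^bsub>E\<^esub>) \<in> G"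
    "(x, a) \<in> G \<Longrightarrow> (y, b) \<in> G \<Longrightarrow> (x \<oplus>\<^bsub>M\<^esub> y, a \<oplus>\<^bsub>E\<^esub> b) \<in> G"
    "r \<in> carrier R \<Longrightarrow> (x, a) \<in> G \<Longrightarrow> (r \<odot>\<^bsub>M\<^esub> x, r \<odot>\<^bsub>E\<^esub> a) \<in> G"
    "(\<zero>\<^bsub>M\<^esub>, a) \<in> G \<Longrightarrow> a = \<zero>\<^bsub>E\<^esub>"
  using assms unfolding hom_graph_def by blast+

lemma hom_graph_unique:
  assumes "hom_graph R M E G" "module R M" "module R E" "(x, a) \<in> G" "(x, b) \<in> G"
  shows "a = b"
proof -
  interpret M: module R M by fact
  interpret E: module R E by fact
  note G = hom_graphD[OF assms(1)]
  have c: "x \<in> carrier M" "a \<in> carrier E" "b \<in> carrier E" using G(1,2) assms(4,5) by auto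
  have "((\<ominus>\<^bsub>R\<^esub> \<one>\<^bsub>R\<^esub>) \<odot>\<^bsub>M\<^esub> x, (\<ominus>\<^bsub>R\<^esub> \<one>\<^bsub>R\<^esub>) \<odot>\<^bsub>E\<^esub> b) \<in> G" using G(5)[OF _ assms(5)] by simp
  then have "(x \<oplus>\<^bsub>M\<^esub> (\<ominus>\<^bsub>R\<^esub> \<one>\<^bsub>R\<^esub>) \<odot>\<^bsub>M\<^esub> x, a \<oplus>\<^bsub>E\<^esub> (\<ominus>\<^bsub>R\<^esub> \<one>\<^bsub>R\<^esub>) \<odot>\<^bsub>E\<^esub> b) \<in> G"
    using G(4)[OF assms(4)] by blast
  then have "(\<zero>\<^bsub>M\<^esub>, a \<oplus>\<^bsub>E\<^esub> (\<ominus>\<^bsub>E\<^esub> b)) \<in> G"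
    using c by (simp add: M.smult_l_minus E.smult_l_minus M.M.r_neg)
  then have "a \<oplus>\<^bsub>E\<^esub> (\<ominus>\<^bsub>E\<^esub> b) = \<zero>\<^bsub>E\<^esub>" by (rule G(6))
  then show ?thesis using c by (metis E.M.minus_equality E.M.minus_minus E.M.a_inv_closed E.M.a_comm)
qed

lemma module_ring_module:
  fixes R (structure)
  assumes "cring R"
  shows "module R (ring_module R)"
proof -
  interpret cring R by fact
  have "abelian_group (ring_module R)"
    by (rule abelian_groupI) (auto simp: ring_module_def a_ac intro: bexI[of _ "\<ominus> _"] l_neg)
  then show ?thesis
    by (intro moduleI is_cring) (auto simp: ring_module_def l_distr r_distr m_assoc)
qed

lemma ideal_submodule_ring_module:
  fixes R (structure)
  assumes "cring R" "ideal J R"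
  shows "submodule J R (ring_module R)"
proof -
  interpret cring R by fact
  interpret J: ideal J R by fact
  interpret module R "ring_module R" by (rule module_ring_module[OF assms(1)])
  show ?thesis
    by (rule submoduleI') (auto simp: ring_module_def J.a_Hcarr J.I_l_closed)
qed

lemma submodule_ring_module_ideal:
  fixes R (structure)
  assumes "cring R" "submodule J R (ring_module R)"
  shows "ideal J R"
proof -
  interpret cring R by fact
  interpret M: module R "ring_module R" by (rule module_ring_module[OF assms(1)])
  note J = M.submoduleD[OF assms(2)]
  have sm: "r \<in> carrier R \<Longrightarrow> x \<in> J \<Longrightarrow> r \<otimes> x \<in> J" for r x using J(6) by (simp add: ring_module_def)
  have Jc: "x \<in> J \<Longrightarrow> x \<in> carrier R" for x using J(1) by (simp add: ring_module_def)
  have "subgroup J (add_monoid R)"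
  proof (rule add.subgroupI)
    show "\<ominus> x \<in> J" if "x \<in> J" for x using sm[of "\<ominus> \<one>" x] Jc that by (simp add: l_minus)
    show "x \<oplus> y \<in> J" if "x \<in> J" "y \<in> J" for x y using J(3)[OF that] by (simp add: ring_module_def)
  qed (use J(2) Jc in auto)
  then show ?thesis using sm Jc by (intro idealI ring_axioms) (simp_all, metis m_comm)
qed

text \<open>An ideal and \<open>R\<close> itself are test modules on the element type of
  \<open>R\<close>, so the definition of injectivity applies; \<open>e\<close> is the value at
  \<open>\<one>\<close> of the extension to \<open>R\<close>.\<close>

lemma injective_module_ideal_hom:
  fixes R :: "('a, 'r) ring_scheme" (structure) and E :: "('a, 'e) module"
  assumes "cring R" "injective_module R E" "ideal J R" "\<And>r. r \<in> J \<Longrightarrow> f r \<in> carrier E"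
    and "\<And>r s. r \<in> J \<Longrightarrow> s \<in> J \<Longrightarrow> f (r \<oplus>\<^bsub>R\<^esub> s) = f r \<oplus>\<^bsub>E\<^esub> f s"
    and "\<And>r s. r \<in> carrier R \<Longrightarrow> s \<in> J \<Longrightarrow> f (r \<otimes>\<^bsub>R\<^esub> s) = r \<odot>\<^bsub>E\<^esub> f s"
  shows "\<exists>e\<in>carrier E. \<forall>r\<in>J. f r = r \<odot>\<^bsub>E\<^esub> e"
proof -
  interpret cring R by fact
  interpret J: ideal J R by fact
  let ?B = "ring_module R" and ?A = "(ring_module R)\<lparr>carrier := J\<rparr>"
  have A: "module R ?A"
    by (rule submodule.submodule_is_module[OF ideal_submodule_ring_module module_ring_module]) fact+
  have "(\<lambda>r. r) \<in> module_hom R ?A ?B" using J.a_Hcarr by (auto simp: module_hom_def ring_module_def)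
  moreover have "f \<in> module_hom R ?A E" using assms(4-6) by (auto simp: module_hom_def ring_module_def)
  moreover have "inj_on (\<lambda>r. r) (carrier ?A)" by simp
  ultimately obtain g where g: "g \<in> module_hom R ?B E" "\<forall>r\<in>carrier ?A. g r = f r"
    using assms(2) A module_ring_module[OF assms(1)] unfolding injective_module_def by meson
  have "f r = r \<odot>\<^bsub>E\<^esub> g \<one>" if r: "r \<in> J" for r
  proof -
    have "g (r \<odot>\<^bsub>?B\<^esub> \<one>) = r \<odot>\<^bsub>E\<^esub> g \<one>"
      using g(1) r J.a_Hcarr by (intro module_homD(3)) (auto simp: ring_module_def)
    then show ?thesis using g(2) r J.a_Hcarr by (simp add: ring_module_def)
  qed
  moreover have "g \<one> \<in> carrier E" using g(1) by (auto simp: module_hom_def ring_module_def)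
  ultimately show ?thesis by blast
qed

text \<open>One step of Baer's argument: the old graph prescribes values on the ideal
  \<open>J\<close> of all \<open>r\<close> with \<open>r u\<close> in its domain, injectivity
  realises them as \<open>r e\<close>, and \<open>e\<close> becomes the value at
  \<open>u\<close>.\<close>

lemma hom_graph_extend:
  fixes R :: "('a, 'r) ring_scheme" and M :: "('a, 'm) module" and E :: "('a, 'e) module"
  assumes "injective_module R E" "module R M" "hom_graph R M E G" "u \<in> carrier M"
  obtains G' where "hom_graph R M E G'" "G \<subseteq> G'" "u \<in> fst ` G'"
proof -
  interpret M: module R M by fact
  have mE: "module R E" using assms(1) by (simp add: injective_module_def)
  interpret E: module R E by (rule mE)
  note G = hom_graphD[OF assms(3)] and uniq = hom_graph_unique[OF assms(3,2) mE]
  define J where "J = {r \<in> carrier R. \<exists>a. (r \<odot>\<^bsub>M\<^esub> u, a) \<in> G}"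
  define f where "f r = (THE a. (r \<odot>\<^bsub>M\<^esub> u, a) \<in> G)" for r
  have f: "(r \<odot>\<^bsub>M\<^esub> u, f r) \<in> G" if r: "r \<in> J" for r
  proof -
    obtain a where "(r \<odot>\<^bsub>M\<^esub> u, a) \<in> G" using r by (auto simp: J_def)
    then show ?thesis unfolding f_def by (rule theI) (use uniq \<open>(r \<odot>\<^bsub>M\<^esub> u, a) \<in> G\<close> in blast)
  qed
  have JR: "r \<in> carrier R" if "r \<in> J" for r using that by (simp add: J_def)
  have feq: "f r = a" if "r \<in> J" "(r \<odot>\<^bsub>M\<^esub> u, a) \<in> G" for r a using uniq f that by blast
  have Jadd: "r \<oplus>\<^bsub>R\<^esub> s \<in> J \<and> f (r \<oplus>\<^bsub>R\<^esub> s) = f r \<oplus>\<^bsub>E\<^esub> f s" if "r \<in> J" "s \<in> J" for r s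
  proof -
    have "((r \<oplus>\<^bsub>R\<^esub> s) \<odot>\<^bsub>M\<^esub> u, f r \<oplus>\<^bsub>E\<^esub> f s) \<in> G"
      using G(4)[OF f[OF that(1)] f[OF that(2)]] JR that assms(4) by (simp add: M.smult_l_distr)
    moreover from this have "r \<oplus>\<^bsub>R\<^esub> s \<in> J" using JR that unfolding J_def by auto
    ultimately show ?thesis using feq by blast
  qed
  have Jmult: "r \<otimes>\<^bsub>R\<^esub> s \<in> J \<and> f (r \<otimes>\<^bsub>R\<^esub> s) = r \<odot>\<^bsub>E\<^esub> f s" if "r \<in> carrier R" "s \<in> J" for r s
  proof -
    have "((r \<otimes>\<^bsub>R\<^esub> s) \<odot>\<^bsub>M\<^esub> u, r \<odot>\<^bsub>E\<^esub> f s) \<in> G"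
      using G(5)[OF that(1) f[OF that(2)]] JR that assms(4) by (simp add: M.smult_assoc1)
    moreover from this have "r \<otimes>\<^bsub>R\<^esub> s \<in> J" using JR that unfolding J_def by auto
    ultimately show ?thesis using feq by blast
  qed
  have "ideal J R"
  proof (rule submodule_ring_module_ideal[OF M.R.is_cring])
    interpret B: module R "ring_module R" by (rule module_ring_module[OF M.R.is_cring])
    have "\<zero>\<^bsub>R\<^esub> \<in> J" using G(3) assms(4) by (auto simp: J_def)
    then show "submodule J R (ring_module R)"
      using Jadd Jmult JR by (intro B.submoduleI') (auto simp: ring_module_def)
  qed
  then have "\<exists>e\<in>carrier E. \<forall>r\<in>J. f r = r \<odot>\<^bsub>E\<^esub> e"
    using Jadd Jmult f G(2)
    by (intro injective_module_ideal_hom[OF M.R.is_cring assms(1)]) blast+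
  then obtain e where e: "e \<in> carrier E" "\<And>r. r \<in> J \<Longrightarrow> f r = r \<odot>\<^bsub>E\<^esub> e" by blast
  define G' where "G' = {(x \<oplus>\<^bsub>M\<^esub> r \<odot>\<^bsub>M\<^esub> u, a \<oplus>\<^bsub>E\<^esub> r \<odot>\<^bsub>E\<^esub> e) | x a r. (x, a) \<in> G \<and> r \<in> carrier R}"
  have G'I: "(x \<oplus>\<^bsub>M\<^esub> r \<odot>\<^bsub>M\<^esub> u, a \<oplus>\<^bsub>E\<^esub> r \<odot>\<^bsub>E\<^esub> e) \<in> G'" if "(x, a) \<in> G" "r \<in> carrier R" for x a r
    using that unfolding G'_def by blast
  have sub: "G \<subseteq> G'"
  proof
    fix z assume "z \<in> G"
    then obtain x a where z: "z = (x, a)" "(x, a) \<in> G" by (cases z) auto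
    then show "z \<in> G'" using G'I[OF z(2), of "\<zero>\<^bsub>R\<^esub>"] G(1,2)[OF z(2)] assms(4) e by simp
  qed
  have "hom_graph R M E G'"
    unfolding hom_graph_def
  proof (intro conjI allI impI)
    show "G' \<subseteq> carrier M \<times> carrier E" using G(1,2) assms(4) e by (auto simp: G'_def)
    show "(\<zero>\<^bsub>M\<^esub>, \<zero>\<^bsub>E\<^esub>) \<in> G'" using sub G(3) by blast
  next
    fix z c w d assume zw: "(z, c) \<in> G' \<and> (w, d) \<in> G'"
    then obtain x a r where 1: "(x, a) \<in> G" "r \<in> carrier R"
      "z = x \<oplus>\<^bsub>M\<^esub> r \<odot>\<^bsub>M\<^esub> u" "c = a \<oplus>\<^bsub>E\<^esub> r \<odot>\<^bsub>E\<^esub> e" unfolding G'_def by blast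
    obtain y b s where 2: "(y, b) \<in> G" "s \<in> carrier R"
      "w = y \<oplus>\<^bsub>M\<^esub> s \<odot>\<^bsub>M\<^esub> u" "d = b \<oplus>\<^bsub>E\<^esub> s \<odot>\<^bsub>E\<^esub> e" using zw unfolding G'_def by blast
    have "z \<oplus>\<^bsub>M\<^esub> w = (x \<oplus>\<^bsub>M\<^esub> y) \<oplus>\<^bsub>M\<^esub> (r \<oplus>\<^bsub>R\<^esub> s) \<odot>\<^bsub>M\<^esub> u"
      using 1 2 G(1) assms(4) by (simp add: M.smult_l_distr M.M.a_ac)
    moreover have "c \<oplus>\<^bsub>E\<^esub> d = (a \<oplus>\<^bsub>E\<^esub> b) \<oplus>\<^bsub>E\<^esub> (r \<oplus>\<^bsub>R\<^esub> s) \<odot>\<^bsub>E\<^esub> e"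
      using 1 2 G(2) e by (simp add: E.smult_l_distr E.M.a_ac)
    ultimately show "(z \<oplus>\<^bsub>M\<^esub> w, c \<oplus>\<^bsub>E\<^esub> d) \<in> G'" using G'I[OF G(4)[OF 1(1) 2(1)]] 1 2 by simp
  next
    fix r z c assume "r \<in> carrier R \<and> (z, c) \<in> G'"
    then obtain x a s where 1: "(x, a) \<in> G" "s \<in> carrier R" "r \<in> carrier R"
      "z = x \<oplus>\<^bsub>M\<^esub> s \<odot>\<^bsub>M\<^esub> u" "c = a \<oplus>\<^bsub>E\<^esub> s \<odot>\<^bsub>E\<^esub> e" unfolding G'_def by blast
    have "r \<odot>\<^bsub>M\<^esub> z = r \<odot>\<^bsub>M\<^esub> x \<oplus>\<^bsub>M\<^esub> (r \<otimes>\<^bsub>R\<^esub> s) \<odot>\<^bsub>M\<^esub> u"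
      using 1 G(1) assms(4) by (simp add: M.smult_r_distr M.smult_assoc1)
    moreover have "r \<odot>\<^bsub>E\<^esub> c = r \<odot>\<^bsub>E\<^esub> a \<oplus>\<^bsub>E\<^esub> (r \<otimes>\<^bsub>R\<^esub> s) \<odot>\<^bsub>E\<^esub> e"
      using 1 G(2) e by (simp add: E.smult_r_distr E.smult_assoc1)
    ultimately show "(r \<odot>\<^bsub>M\<^esub> z, r \<odot>\<^bsub>E\<^esub> c) \<in> G'" using G'I[OF G(5)[OF 1(3) 1(1)]] 1 by simp
  next
    \<comment> \<open>Here the choice of \<open>e\<close> pays off: \<open>r u = -x\<close> is in
      the old domain, so \<open>r \<in> J\<close> and \<open>r e\<close> is the prescribed value
      \<open>-a\<close>.\<close>
    fix c assume "(\<zero>\<^bsub>M\<^esub>, c) \<in> G'"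
    then obtain x a r where 1: "(x, a) \<in> G" "r \<in> carrier R"
      "\<zero>\<^bsub>M\<^esub> = x \<oplus>\<^bsub>M\<^esub> r \<odot>\<^bsub>M\<^esub> u" "c = a \<oplus>\<^bsub>E\<^esub> r \<odot>\<^bsub>E\<^esub> e" unfolding G'_def by blast
    have c: "x \<in> carrier M" "a \<in> carrier E" using G(1,2) 1 by auto
    have "(\<ominus>\<^bsub>R\<^esub> \<one>\<^bsub>R\<^esub> \<odot>\<^bsub>M\<^esub> x, \<ominus>\<^bsub>R\<^esub> \<one>\<^bsub>R\<^esub> \<odot>\<^bsub>E\<^esub> a) \<in> G" using G(5)[OF _ 1(1)] by simp
    moreover have "r \<odot>\<^bsub>M\<^esub> u = \<ominus>\<^bsub>M\<^esub> x"
      using 1 c assms(4) by (metis M.M.minus_equality M.M.a_comm M.smult_closed)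
    ultimately have ra: "(r \<odot>\<^bsub>M\<^esub> u, \<ominus>\<^bsub>E\<^esub> a) \<in> G"
      using c by (simp add: M.smult_l_minus E.smult_l_minus)
    then have "r \<in> J" using 1(2) by (auto simp: J_def)
    then have "r \<odot>\<^bsub>E\<^esub> e = \<ominus>\<^bsub>E\<^esub> a" using feq[OF _ ra] e(2) by simp
    then show "c = \<zero>\<^bsub>E\<^esub>" using 1(4) c by (simp add: E.M.r_neg)
  qed
  moreover have "u \<in> fst ` G'"
    using G'I[OF G(3), of "\<one>\<^bsub>R\<^esub>"] assms(4) by (force intro!: image_eqI)
  ultimately show thesis using that sub by blast
qed

text \<open>Baer's criterion: injectivity with respect to the ideals of \<open>R\<close> is enough to extend
  homomorphisms from submodules of any module, on any type.\<close>

lemma injective_module_extend: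
  fixes R :: "('a, 'r) ring_scheme" and M :: "('a, 'm) module" and E :: "('a, 'e) module"
  assumes "injective_module R E" "module R M" "hom_graph R M E G"
  obtains h where "h \<in> module_hom R M E" "\<And>x a. (x, a) \<in> G \<Longrightarrow> h x = a"
proof -
  have mE: "module R E" using assms(1) by (simp add: injective_module_def)
  let ?S = "{G'. hom_graph R M E G' \<and> G \<subseteq> G'}"
  have "\<exists>K\<in>?S. \<forall>L\<in>?S. K \<subseteq> L \<longrightarrow> L = K"
  proof (rule subset_Zorn_nonempty)
    show "?S \<noteq> {}" using assms(3) by blast
    fix C assume C: "C \<noteq> {}" "subset.chain ?S C"
    have hg: "hom_graph R M E K" "G \<subseteq> K" if "K \<in> C" for K
      using C(2) that unfolding subset.chain_def by auto
    have tot: "K \<subseteq> L \<or> L \<subseteq> K" if "K \<in> C" "L \<in> C" for K L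
      using C(2) that unfolding subset.chain_def by blast
    have "hom_graph R M E (\<Union>C)"
      unfolding hom_graph_def
    proof (intro conjI allI impI)
      show "\<Union>C \<subseteq> carrier M \<times> carrier E" using hg(1) unfolding hom_graph_def by blast
      show "(\<zero>\<^bsub>M\<^esub>, \<zero>\<^bsub>E\<^esub>) \<in> \<Union>C" using hg(1) C(1) hom_graphD(3) by blast
    next
      fix x a y b assume "(x, a) \<in> \<Union>C \<and> (y, b) \<in> \<Union>C"
      then obtain K L where KL: "K \<in> C" "(x, a) \<in> K" "L \<in> C" "(y, b) \<in> L" by blast
      then obtain Y where "Y \<in> C" "(x, a) \<in> Y" "(y, b) \<in> Y" using tot[OF KL(1,3)] by blast
      then show "(x \<oplus>\<^bsub>M\<^esub> y, a \<oplus>\<^bsub>E\<^esub> b) \<in> \<Union>C" using hom_graphD(4)[OF hg(1)] by (intro UnionI)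
    next
      fix r x a assume "r \<in> carrier R \<and> (x, a) \<in> \<Union>C"
      then obtain Y where "Y \<in> C" "(x, a) \<in> Y" "r \<in> carrier R" by blast
      then show "(r \<odot>\<^bsub>M\<^esub> x, r \<odot>\<^bsub>E\<^esub> a) \<in> \<Union>C" using hom_graphD(5)[OF hg(1)] by (intro UnionI)
    next
      fix a assume "(\<zero>\<^bsub>M\<^esub>, a) \<in> \<Union>C"
      then obtain Y where "Y \<in> C" "(\<zero>\<^bsub>M\<^esub>, a) \<in> Y" by blast
      then show "a = \<zero>\<^bsub>E\<^esub>" using hom_graphD(6)[OF hg(1)] by metis
    qed
    then show "\<Union>C \<in> ?S" using C(1) hg(2) by blast
  qed
  then obtain K where K_mem: "K \<in> ?S" and K_max: "\<forall>L\<in>?S. K \<subseteq> L \<longrightarrow> L = K" by (rule bexE)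
  have K: "hom_graph R M E K" "G \<subseteq> K" using K_mem by simp_all
  have max: "Y = K" if "hom_graph R M E Y" "G \<subseteq> Y" "K \<subseteq> Y" for Y
    using K_max that by simp
  note uniq = hom_graph_unique[OF K(1) assms(2) mE] and KD = hom_graphD[OF K(1)]
  \<comment> \<open>A maximal graph is defined everywhere, since a missing \<open>u\<close> could be
    adjoined.\<close>
  have tot: "\<exists>a. (u, a) \<in> K" if u: "u \<in> carrier M" for u
  proof -
    obtain G' where "hom_graph R M E G'" "K \<subseteq> G'" "u \<in> fst ` G'"
      using hom_graph_extend[OF assms(1,2) K(1) u] .
    moreover from this have "G' = K" using max K(2) by blast
    ultimately show ?thesis by auto
  qed
  define h where "h u = (THE a. (u, a) \<in> K)" for u
  have heq: "h u = a" if "(u, a) \<in> K" for u a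
    unfolding h_def using that uniq by (intro the_equality) blast+
  have h: "(u, h u) \<in> K" if "u \<in> carrier M" for u using tot[OF that] heq by blast
  have "h \<in> module_hom R M E"
    unfolding module_hom_def using h KD(2,4,5) by (auto intro!: heq)
  then show thesis using that heq K(2) by blast
qed

text \<open>\<open>z\<close> plays the role of y/r in the localisation at \<open>r\<close>: it
  divides \<open>y\<close> up to \<open>r\<close>-power torsion. It is killed by everything that
  kills \<open>y\<close>, so any torsion condition on \<open>y\<close> passes to
  \<open>z\<close>.\<close>

lemma (in noetherian_cring) injective_divide:
  fixes Q :: "('a, 'q) module"
  assumes "injective_module R Q" "y \<in> carrier Q" "r \<in> carrier R"
  obtains z k where "z \<in> carrier Q" "(r [^] (k::nat)) \<odot>\<^bsub>Q\<^esub> (r \<odot>\<^bsub>Q\<^esub> z \<ominus>\<^bsub>Q\<^esub> y) = \<zero>\<^bsub>Q\<^esub>"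
    "\<And>s. s \<in> carrier R \<Longrightarrow> s \<odot>\<^bsub>Q\<^esub> y = \<zero>\<^bsub>Q\<^esub> \<Longrightarrow> s \<odot>\<^bsub>Q\<^esub> z = \<zero>\<^bsub>Q\<^esub>"
proof -
  have mQ: "module R Q" using assms(1) by (simp add: injective_module_def)
  interpret Q: module R Q by (rule mQ)
  note mR = module_ring_module[OF is_cring]
  define c where "c = Q.colon {\<zero>\<^bsub>Q\<^esub>}"
  have c: "ideal (c u) R" if "u \<in> carrier Q" for u
    unfolding c_def by (rule Q.colon_ideal[OF Q.submodule_zero that])
  have cmem: "s \<in> c u \<longleftrightarrow> s \<in> carrier R \<and> s \<odot>\<^bsub>Q\<^esub> u = \<zero>\<^bsub>Q\<^esub>" for s u by (simp add: c_def Q.colon_def)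
  have rk: "r [^] k \<odot>\<^bsub>Q\<^esub> y \<in> carrier Q" for k :: nat using assms by simp
  let ?c = "\<lambda>m::nat. c (r [^] m \<odot>\<^bsub>Q\<^esub> y)"
  \<comment> \<open>The annihilators of \<open>r^m y\<close> increase with \<open>m\<close>;
    \<open>k\<close> is an exponent from which the next step adds nothing.\<close>
  obtain B where B: "\<exists>m. B = ?c m" "\<And>C. \<exists>m. C = ?c m \<Longrightarrow> B \<subseteq> C \<Longrightarrow> C = B"
  proof (rule wf_obtain_maximal[OF wf_ideals, of "\<lambda>C. \<exists>m. C = ?c m" "?c 0"])
    show "\<exists>m. ?c 0 = ?c m" by blast
    show "ideal A R" if "\<exists>m. A = ?c m" for A using that c[OF rk] by blast
  qed blast
  obtain k where Bk: "B = ?c k" using B(1) by blast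
  have k: "?c k \<subseteq> ?c m \<Longrightarrow> ?c m = ?c k" for m using B(2)[of "?c m"] Bk by blast
  have pow: "r [^] Suc k \<odot>\<^bsub>Q\<^esub> y = r \<odot>\<^bsub>Q\<^esub> (r [^] k \<odot>\<^bsub>Q\<^esub> y)"
    using assms by (simp add: nat_pow_Suc m_comm Q.smult_assoc1)
  have "c (r [^] k \<odot>\<^bsub>Q\<^esub> y) \<subseteq> c (r [^] Suc k \<odot>\<^bsub>Q\<^esub> y)"
    unfolding pow using assms Q.smult_comm[OF _ assms(3) rk] by (auto simp: cmem)
  then have stable: "s \<odot>\<^bsub>Q\<^esub> (r [^] k \<odot>\<^bsub>Q\<^esub> y) = \<zero>\<^bsub>Q\<^esub>"
    if "s \<odot>\<^bsub>Q\<^esub> (r [^] Suc k \<odot>\<^bsub>Q\<^esub> y) = \<zero>\<^bsub>Q\<^esub>" "s \<in> carrier R" for s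
    using k cmem that by blast
  let ?w = "r [^] k \<odot>\<^bsub>Q\<^esub> y" and ?p = "r [^] Suc k"
  have p: "?p \<in> carrier R" by (rule nat_pow_closed[OF assms(3)])
  define G where "G = {(s \<otimes> ?p \<oplus> t, s \<odot>\<^bsub>Q\<^esub> ?w) | s t. s \<in> carrier R \<and> t \<in> c y}"
  note C = ideal.Icarr[OF c[OF assms(2)]] additive_subgroup.a_closed[OF ideal.axioms(1)[OF c[OF assms(2)]]]
    ideal.I_l_closed[OF c[OF assms(2)]] additive_subgroup.zero_closed[OF ideal.axioms(1)[OF c[OF assms(2)]]]
    additive_subgroup.a_inv_closed[OF ideal.axioms(1)[OF c[OF assms(2)]]]
  have GI: "(s \<otimes> ?p \<oplus> t, s \<odot>\<^bsub>Q\<^esub> ?w) \<in> G" if "s \<in> carrier R" "t \<in> c y" for s t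
    using that unfolding G_def by blast
  have hg: "hom_graph R (ring_module R) Q G"
    unfolding hom_graph_def
  proof (intro conjI allI impI)
    show "G \<subseteq> carrier (ring_module R) \<times> carrier Q"
      using p rk C(1) by (auto simp: G_def ring_module_def)
    show "(\<zero>\<^bsub>ring_module R\<^esub>, \<zero>\<^bsub>Q\<^esub>) \<in> G"
      using GI[OF zero_closed C(4)] p rk[of k] by (simp add: ring_module_def del: nat_pow_Suc)
  next
    fix x a x' a' assume "(x, a) \<in> G \<and> (x', a') \<in> G"
    then obtain s t s' t' where *: "s \<in> carrier R" "t \<in> c y" "x = s \<otimes> ?p \<oplus> t" "a = s \<odot>\<^bsub>Q\<^esub> ?w"
      "s' \<in> carrier R" "t' \<in> c y" "x' = s' \<otimes> ?p \<oplus> t'" "a' = s' \<odot>\<^bsub>Q\<^esub> ?w" unfolding G_def by blast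
    have "t \<in> carrier R" "t' \<in> carrier R" using * C(1) by auto
    then have "x \<oplus> x' = (s \<oplus> s') \<otimes> ?p \<oplus> (t \<oplus> t')"
      using * p by (simp add: l_distr a_ac del: nat_pow_Suc)
    moreover have "a \<oplus>\<^bsub>Q\<^esub> a' = (s \<oplus> s') \<odot>\<^bsub>Q\<^esub> ?w" using * rk by (simp add: Q.smult_l_distr)
    ultimately show "(x \<oplus>\<^bsub>ring_module R\<^esub> x', a \<oplus>\<^bsub>Q\<^esub> a') \<in> G"
      using GI[of "s \<oplus> s'" "t \<oplus> t'"] * C(2) by (simp add: ring_module_def del: nat_pow_Suc)
  next
    fix q x a assume "q \<in> carrier R \<and> (x, a) \<in> G"
    then obtain s t where *: "s \<in> carrier R" "t \<in> c y" "x = s \<otimes> ?p \<oplus> t" "a = s \<odot>\<^bsub>Q\<^esub> ?w"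
      "q \<in> carrier R" unfolding G_def by blast
    have "t \<in> carrier R" using * C(1) by auto
    then have "q \<otimes> x = (q \<otimes> s) \<otimes> ?p \<oplus> q \<otimes> t" using * p by (simp add: r_distr m_assoc del: nat_pow_Suc)
    moreover have "q \<odot>\<^bsub>Q\<^esub> a = (q \<otimes> s) \<odot>\<^bsub>Q\<^esub> ?w" using * rk by (simp add: Q.smult_assoc1)
    ultimately show "(q \<odot>\<^bsub>ring_module R\<^esub> x, q \<odot>\<^bsub>Q\<^esub> a) \<in> G"
      using GI[of "q \<otimes> s" "q \<otimes> t"] * C(3) by (simp add: ring_module_def del: nat_pow_Suc)
  next
    fix a assume "(\<zero>\<^bsub>ring_module R\<^esub>, a) \<in> G"
    then obtain s t where *: "s \<in> carrier R" "t \<in> c y" "\<zero> = s \<otimes> ?p \<oplus> t" "a = s \<odot>\<^bsub>Q\<^esub> ?w"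
      unfolding G_def ring_module_def by auto
    have "t \<in> carrier R" using * C(1) by auto
    then have "s \<otimes> ?p = \<ominus> t" using * p by (metis minus_equality m_closed)
    then have "s \<otimes> ?p \<in> c y" using C(5)[OF *(2)] by simp
    then have "s \<odot>\<^bsub>Q\<^esub> (?p \<odot>\<^bsub>Q\<^esub> y) = \<zero>\<^bsub>Q\<^esub>" using * p assms(2) by (simp add: cmem Q.smult_assoc1 del: nat_pow_Suc)
    then show "a = \<zero>\<^bsub>Q\<^esub>" using stable * by blast
  qed
  obtain h where h: "h \<in> module_hom R (ring_module R) Q" "\<And>x a. (x, a) \<in> G \<Longrightarrow> h x = a"
    by (rule injective_module_extend[OF assms(1) mR hg], rule that)
  have h1: "h \<one> \<in> carrier Q" by (rule module_homD(1)[OF h(1)]) (simp add: ring_module_def)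
  have hs: "h s = s \<odot>\<^bsub>Q\<^esub> h \<one>" if s: "s \<in> carrier R" for s
  proof -
    have "s \<odot>\<^bsub>ring_module R\<^esub> \<one> = s" "\<one> \<in> carrier (ring_module R)"
      using s by (simp_all add: ring_module_def)
    then show ?thesis using module_homD(3)[OF h(1) s, of \<one>] by metis
  qed
  show thesis
  proof (rule that)
    have "?p \<odot>\<^bsub>Q\<^esub> h \<one> = ?w"
      using h(2)[OF GI[OF one_closed C(4)]] hs[OF p] p rk[of k] by (simp del: nat_pow_Suc)
    moreover have "r [^] k \<odot>\<^bsub>Q\<^esub> (r \<odot>\<^bsub>Q\<^esub> h \<one> \<ominus>\<^bsub>Q\<^esub> y) = ?p \<odot>\<^bsub>Q\<^esub> h \<one> \<ominus>\<^bsub>Q\<^esub> ?w"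
      using h1 assms by (simp add: a_minus_def Q.smult_r_distr Q.smult_r_minus Q.smult_assoc1)
    ultimately show "r [^] k \<odot>\<^bsub>Q\<^esub> (r \<odot>\<^bsub>Q\<^esub> h \<one> \<ominus>\<^bsub>Q\<^esub> y) = \<zero>\<^bsub>Q\<^esub>"
      using rk by (simp add: a_minus_def Q.M.r_neg)
    show "s \<odot>\<^bsub>Q\<^esub> h \<one> = \<zero>\<^bsub>Q\<^esub>" if s: "s \<in> carrier R" "s \<odot>\<^bsub>Q\<^esub> y = \<zero>\<^bsub>Q\<^esub>" for s
      using h(2)[OF GI[OF zero_closed, of s]] hs[OF s(1)] s p rk[of k] by (simp add: cmem del: nat_pow_Suc)
  qed (rule h1)
qed

section \<open>Torsion in an injective resolution\<close>

text \<open>For an ideal of a Noetherian ring this is \<open>torsion_part\<close>; testing single elements allows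
  \<open>A\<close> to be a mere set of generators, so that one can induct on their number.\<close>

definition power_torsion :: "('a, 'r) ring_scheme \<Rightarrow> 'a set \<Rightarrow> ('a, 'm) module \<Rightarrow> 'm set" where
  "power_torsion R A M = {z \<in> carrier M. \<forall>s\<in>A. \<exists>n::nat. (s [^]\<^bsub>R\<^esub> n) \<odot>\<^bsub>M\<^esub> z = \<zero>\<^bsub>M\<^esub>}"

lemma power_torsion_insertD:
  "z \<in> power_torsion R (insert r A) M \<Longrightarrow> z \<in> power_torsion R {r} M"
  "z \<in> power_torsion R (insert r A) M \<Longrightarrow> z \<in> power_torsion R A M"
  by (auto simp: power_torsion_def)

lemma power_torsion_insertI:
  "z \<in> power_torsion R {r} M \<Longrightarrow> z \<in> power_torsion R A M \<Longrightarrow> z \<in> power_torsion R (insert r A) M"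
  by (auto simp: power_torsion_def)

lemma power_torsion_antimono: "A \<subseteq> B \<Longrightarrow> power_torsion R B M \<subseteq> power_torsion R A M"
  unfolding power_torsion_def by blast

context
  fixes R :: "('a, 'r) ring_scheme" (structure) and M :: "('a, 'm) module" (structure)
  assumes M: "module R M"
begin

interpretation module R M by (rule M)

lemma pow_kill_mono:
  assumes "s \<in> carrier R" "z \<in> carrier M" "(s [^] (m::nat)) \<odot>\<^bsub>M\<^esub> z = \<zero>\<^bsub>M\<^esub>" "m \<le> n"
  shows "(s [^] n) \<odot>\<^bsub>M\<^esub> z = \<zero>\<^bsub>M\<^esub>"
proof -
  have "s [^] n = s [^] (n - m) \<otimes> s [^] m" using assms by (simp add: R.nat_pow_mult)
  then show ?thesis using assms by (simp add: smult_assoc1)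
qed

lemma power_torsion_submodule:
  assumes "A \<subseteq> carrier R"
  shows "submodule (power_torsion R A M) R M"
proof (rule submoduleI')
  show "\<zero>\<^bsub>M\<^esub> \<in> power_torsion R A M" using assms by (auto simp: power_torsion_def)
  show "x \<oplus>\<^bsub>M\<^esub> y \<in> power_torsion R A M" if xy: "x \<in> power_torsion R A M" "y \<in> power_torsion R A M" for x y
  proof -
    have c: "x \<in> carrier M" "y \<in> carrier M" using xy by (auto simp: power_torsion_def)
    have "\<exists>n::nat. s [^] n \<odot>\<^bsub>M\<^esub> (x \<oplus>\<^bsub>M\<^esub> y) = \<zero>\<^bsub>M\<^esub>" if s: "s \<in> A" for s
    proof -
      have sR: "s \<in> carrier R" using s assms by blast
      obtain m n :: nat where "s [^] m \<odot>\<^bsub>M\<^esub> x = \<zero>\<^bsub>M\<^esub>" "s [^] n \<odot>\<^bsub>M\<^esub> y = \<zero>\<^bsub>M\<^esub>"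
        using xy s unfolding power_torsion_def by blast
      then have "s [^] (max m n) \<odot>\<^bsub>M\<^esub> x = \<zero>\<^bsub>M\<^esub>" "s [^] (max m n) \<odot>\<^bsub>M\<^esub> y = \<zero>\<^bsub>M\<^esub>"
        using pow_kill_mono sR c by (meson max.cobounded1 max.cobounded2)+
      then show ?thesis using c sR by (intro exI[of _ "max m n"]) (simp add: smult_r_distr)
    qed
    then show ?thesis using c by (simp add: power_torsion_def)
  qed
  show "r \<odot>\<^bsub>M\<^esub> x \<in> power_torsion R A M" if rx: "r \<in> carrier R" "x \<in> power_torsion R A M" for r x
  proof -
    have c: "x \<in> carrier M" using rx by (auto simp: power_torsion_def)
    have "\<exists>n::nat. s [^] n \<odot>\<^bsub>M\<^esub> (r \<odot>\<^bsub>M\<^esub> x) = \<zero>\<^bsub>M\<^esub>" if s: "s \<in> A" for s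
    proof -
      have sR: "s \<in> carrier R" using s assms by blast
      obtain n :: nat where "s [^] n \<odot>\<^bsub>M\<^esub> x = \<zero>\<^bsub>M\<^esub>" using rx s unfolding power_torsion_def by blast
      then show ?thesis using smult_comm[OF R.nat_pow_closed[OF sR, of n] rx(1) c] rx
        by (intro exI[of _ n]) simp
    qed
    then show ?thesis using c rx by (simp add: power_torsion_def)
  qed
qed (auto simp: power_torsion_def)

lemma power_torsion_of_ann:
  assumes "z \<in> power_torsion R A M" "w \<in> carrier M" "A \<subseteq> carrier R"
    and "\<And>s. s \<in> carrier R \<Longrightarrow> s \<odot>\<^bsub>M\<^esub> z = \<zero>\<^bsub>M\<^esub> \<Longrightarrow> s \<odot>\<^bsub>M\<^esub> w = \<zero>\<^bsub>M\<^esub>"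
  shows "w \<in> power_torsion R A M"
  unfolding power_torsion_def
proof (intro CollectI conjI ballI)
  fix s assume s: "s \<in> A"
  obtain n :: nat where "s [^] n \<odot>\<^bsub>M\<^esub> z = \<zero>\<^bsub>M\<^esub>" using assms(1) s unfolding power_torsion_def by blast
  then have "s [^] n \<odot>\<^bsub>M\<^esub> w = \<zero>\<^bsub>M\<^esub>" using assms(3,4) s R.nat_pow_closed by blast
  then show "\<exists>n::nat. s [^] n \<odot>\<^bsub>M\<^esub> w = \<zero>\<^bsub>M\<^esub>" ..
qed (rule assms)

lemma power_torsion_unsmult:
  assumes "r \<in> carrier R" "w \<in> carrier M" "r [^] (n::nat) \<odot>\<^bsub>M\<^esub> w \<in> power_torsion R {r} M"
  shows "w \<in> power_torsion R {r} M"
proof -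
  obtain m :: nat where "r [^] m \<odot>\<^bsub>M\<^esub> (r [^] n \<odot>\<^bsub>M\<^esub> w) = \<zero>\<^bsub>M\<^esub>"
    using assms(3) unfolding power_torsion_def by blast
  then have "r [^] (m + n) \<odot>\<^bsub>M\<^esub> w = \<zero>\<^bsub>M\<^esub>"
    using assms(1,2) by (simp add: R.nat_pow_mult[symmetric] smult_assoc1)
  then show ?thesis using assms(2) unfolding power_torsion_def by blast
qed

text \<open>A uniform exponent arises from the separate ones by applying
  \<open>ideal_pow_subset_of_radical\<close> to the annihilator of \<open>x\<close>.\<close>

lemma torsion_part_eq_power_torsion:
  assumes "noetherian_cring R" "ideal A R"
  shows "torsion_part R A M = power_torsion R A M"
proof -
  interpret noetherian_cring R by fact
  have "(\<exists>n. \<forall>r\<in>ideal_pow R A n. r \<odot>\<^bsub>M\<^esub> x = \<zero>\<^bsub>M\<^esub>) \<longleftrightarrow> (\<forall>s\<in>A. \<exists>n::nat. s [^] n \<odot>\<^bsub>M\<^esub> x = \<zero>\<^bsub>M\<^esub>)"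
    if x: "x \<in> carrier M" for x
  proof
    assume "\<exists>n. \<forall>r\<in>ideal_pow R A n. r \<odot>\<^bsub>M\<^esub> x = \<zero>\<^bsub>M\<^esub>"
    then show "\<forall>s\<in>A. \<exists>n::nat. s [^] n \<odot>\<^bsub>M\<^esub> x = \<zero>\<^bsub>M\<^esub>" using pow_mem_ideal_pow[OF assms(2)] by blast
  next
    assume l: "\<forall>s\<in>A. \<exists>n::nat. s [^] n \<odot>\<^bsub>M\<^esub> x = \<zero>\<^bsub>M\<^esub>"
    have "\<exists>n::nat. s [^] n \<in> colon {\<zero>\<^bsub>M\<^esub>} x" if "s \<in> A" for s
      using l that ideal.Icarr[OF assms(2) that] by (auto simp: colon_def)
    then obtain n where "ideal_pow R A n \<subseteq> colon {\<zero>\<^bsub>M\<^esub>} x"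
      using ideal_pow_subset_of_radical[OF assms(2) colon_ideal[OF submodule_zero x]] by blast
    then show "\<exists>n. \<forall>r\<in>ideal_pow R A n. r \<odot>\<^bsub>M\<^esub> x = \<zero>\<^bsub>M\<^esub>" by (auto simp: colon_def)
  qed
  then show ?thesis unfolding torsion_part_def power_torsion_def by blast
qed

end

lemma power_torsion_hom:
  assumes "f \<in> module_hom R M N" "module R M" "module R N" "A \<subseteq> carrier R" "z \<in> power_torsion R A M"
  shows "f z \<in> power_torsion R A N"
proof -
  interpret module R M by fact
  have c: "z \<in> carrier M" using assms(5) by (auto simp: power_torsion_def)
  have "\<exists>n::nat. s [^]\<^bsub>R\<^esub> n \<odot>\<^bsub>N\<^esub> f z = \<zero>\<^bsub>N\<^esub>" if s: "s \<in> A" for s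
  proof -
    obtain n :: nat where "s [^]\<^bsub>R\<^esub> n \<odot>\<^bsub>M\<^esub> z = \<zero>\<^bsub>M\<^esub>" using assms(5) s unfolding power_torsion_def by blast
    moreover have "s [^]\<^bsub>R\<^esub> n \<in> carrier R" using s assms(4) by auto
    ultimately show ?thesis using module_homD(3)[OF assms(1) _ c] module_homD2(1)[OF assms(1-3)] by metis
  qed
  then show ?thesis using module_homD(1)[OF assms(1) c] by (simp add: power_torsion_def)
qed

text \<open>An injective resolution with its augmentation forgotten: exactness is stated in positive
  degrees.\<close>

locale injective_complex = noetherian_cring R for R :: "('a, 'r) ring_scheme" (structure) +
  fixes I :: "nat \<Rightarrow> ('a, 'i) module" and \<delta> :: "nat \<Rightarrow> 'i \<Rightarrow> 'i"
  assumes inj: "injective_module R (I n)"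
    and hom: "\<delta> n \<in> module_hom R (I n) (I (Suc n))"
    and exact: "\<delta> n ` carrier (I n) = {x \<in> carrier (I (Suc n)). \<delta> (Suc n) x = \<zero>\<^bsub>I (Suc (Suc n))\<^esub>}"
begin

lemma mod: "module R (I n)" using inj by (simp add: injective_module_def)

lemmas \<delta> = module_homD[OF hom] module_homD2[OF hom mod mod]

lemma \<delta>\<delta>: "z \<in> carrier (I n) \<Longrightarrow> \<delta> (Suc n) (\<delta> n z) = \<zero>\<^bsub>I (Suc (Suc n))\<^esub>"
  using exact[of n] by blast

abbreviation \<Gamma> :: "'a set \<Rightarrow> nat \<Rightarrow> 'i set" where "\<Gamma> A n \<equiv> power_torsion R A (I n)"

lemma \<Gamma>_carrier: "z \<in> \<Gamma> A n \<Longrightarrow> z \<in> carrier (I n)" by (simp add: power_torsion_def)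

lemma \<Gamma>_\<delta>: "A \<subseteq> carrier R \<Longrightarrow> z \<in> \<Gamma> A n \<Longrightarrow> \<delta> n z \<in> \<Gamma> A (Suc n)"
  by (rule power_torsion_hom[OF hom mod mod])

text \<open>\<open>injective_divide\<close> with \<open>r^n\<close> in place of \<open>r\<close>:
  the \<open>A\<close>-torsion modulo the torsion for \<open>A\<close> and \<open>r\<close> is
  \<open>r\<close>-divisible. This stands in for surjectivity onto the localisation at
  \<open>r\<close>.\<close>

lemma \<Gamma>_divide:
  assumes "A \<subseteq> carrier R" "y \<in> \<Gamma> A i" "r \<in> carrier R"
  obtains z where "z \<in> \<Gamma> A i" "r [^] (n::nat) \<odot>\<^bsub>I i\<^esub> z \<ominus>\<^bsub>I i\<^esub> y \<in> \<Gamma> (insert r A) i"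
proof -
  interpret Q: module R "I i" by (rule mod)
  note P = Q.submoduleD[OF power_torsion_submodule[OF mod assms(1), of i]]
  have rn: "r [^] n \<in> carrier R" using assms by simp
  obtain z k where z: "z \<in> carrier (I i)"
    "(r [^] n) [^] (k::nat) \<odot>\<^bsub>I i\<^esub> (r [^] n \<odot>\<^bsub>I i\<^esub> z \<ominus>\<^bsub>I i\<^esub> y) = \<zero>\<^bsub>I i\<^esub>"
    "\<And>s. s \<in> carrier R \<Longrightarrow> s \<odot>\<^bsub>I i\<^esub> y = \<zero>\<^bsub>I i\<^esub> \<Longrightarrow> s \<odot>\<^bsub>I i\<^esub> z = \<zero>\<^bsub>I i\<^esub>"
    by (rule injective_divide[OF inj \<Gamma>_carrier[OF assms(2)] rn], rule that)
  have zA: "z \<in> \<Gamma> A i" by (rule power_torsion_of_ann[OF mod assms(2) z(1) assms(1) z(3)])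
  have d: "r [^] n \<odot>\<^bsub>I i\<^esub> z \<ominus>\<^bsub>I i\<^esub> y \<in> \<Gamma> A i" by (intro P(5) P(6) rn zA assms(2))
  have "r [^] (n * k) \<odot>\<^bsub>I i\<^esub> (r [^] n \<odot>\<^bsub>I i\<^esub> z \<ominus>\<^bsub>I i\<^esub> y) = \<zero>\<^bsub>I i\<^esub>"
    using z(2) assms(3) by (simp add: nat_pow_pow)
  then have "r [^] n \<odot>\<^bsub>I i\<^esub> z \<ominus>\<^bsub>I i\<^esub> y \<in> \<Gamma> {r} i"
    using \<Gamma>_carrier[OF d] unfolding power_torsion_def by blast
  then show thesis using that[OF zA] power_torsion_insertI[OF _ d] by blast
qed

text \<open>Cohomology vanishes above the number of generators of the support. By induction
  \<open>z = \<delta> w\<close> with \<open>w\<close> torsion for \<open>bs\<close> alone. Since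
  \<open>r^n z = 0\<close>, the element \<open>r^n w\<close> is a cocycle one degree lower, hence
  \<open>r^n w = \<delta> v\<close> by induction again. Dividing \<open>v\<close> by
  \<open>r^n\<close> gives a coboundary whose subtraction makes \<open>w\<close> torsion for
  \<open>r\<close> too.\<close>

lemma vanishing:
  assumes "set bs \<subseteq> carrier R" "length bs \<le> i" "z \<in> \<Gamma> (set bs) (Suc i)"
    "\<delta> (Suc i) z = \<zero>\<^bsub>I (Suc (Suc i))\<^esub>"
  shows "\<exists>w\<in>\<Gamma> (set bs) i. \<delta> i w = z"
  using assms
proof (induction bs arbitrary: i z)
  case Nil
  then have "z \<in> \<delta> i ` carrier (I i)" using exact[of i] \<Gamma>_carrier by auto
  then show ?case by (auto simp: power_torsion_def)
next
  case (Cons r bs)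
  obtain j where i: "i = Suc j" "length bs \<le> j" using Cons.prems(2) by (cases i) auto
  have A: "set bs \<subseteq> carrier R" and r: "r \<in> carrier R" using Cons.prems by auto
  interpret Mi: module R "I i" by (rule mod)
  interpret Mj: module R "I j" by (rule mod)
  interpret Ms: module R "I (Suc i)" by (rule mod)
  note P = Mi.submoduleD[OF power_torsion_submodule[OF mod A, of i]]
  have z: "z \<in> \<Gamma> {r} (Suc i)" "z \<in> \<Gamma> (set bs) (Suc i)"
    using Cons.prems(3) power_torsion_insertD by (metis list.simps(15))+
  obtain w where w: "w \<in> \<Gamma> (set bs) i" "\<delta> i w = z"
    using Cons.IH[OF A _ z(2) Cons.prems(4)] i by auto
  have wc: "w \<in> carrier (I i)" using \<Gamma>_carrier[OF w(1)] .
  obtain n :: nat where n: "r [^] n \<odot>\<^bsub>I (Suc i)\<^esub> z = \<zero>\<^bsub>I (Suc i)\<^esub>"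
    using z(1) unfolding power_torsion_def by blast
  have rn: "r [^] n \<in> carrier R" using r by simp
  have "\<delta> i (r [^] n \<odot>\<^bsub>I i\<^esub> w) = \<zero>\<^bsub>I (Suc i)\<^esub>" using n w(2) \<delta>(3)[OF rn wc] by simp
  moreover have "r [^] n \<odot>\<^bsub>I i\<^esub> w \<in> \<Gamma> (set bs) i" using P(6)[OF rn w(1)] .
  ultimately obtain v where v: "v \<in> \<Gamma> (set bs) j" "\<delta> j v = r [^] n \<odot>\<^bsub>I i\<^esub> w"
    using Cons.IH[OF A i(2), of "r [^] n \<odot>\<^bsub>I i\<^esub> w"] i(1) by auto
  obtain v' where v': "v' \<in> \<Gamma> (set bs) j" "r [^] n \<odot>\<^bsub>I j\<^esub> v' \<ominus>\<^bsub>I j\<^esub> v \<in> \<Gamma> (insert r (set bs)) j"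
    using \<Gamma>_divide[OF A v(1) r] .
  have vc: "v \<in> carrier (I j)" "v' \<in> carrier (I j)" using \<Gamma>_carrier v v' by auto
  have dv': "\<delta> j v' \<in> \<Gamma> (set bs) i" using \<Gamma>_\<delta>[OF A v'(1)] i(1) by simp
  \<comment> \<open>\<open>r^n w'\<close> is the coboundary of \<open>v - r^n v'\<close>, which is
    \<open>r\<close>-power torsion by the choice of \<open>v'\<close>.\<close>
  define w' where "w' = w \<ominus>\<^bsub>I i\<^esub> \<delta> j v'"
  have w': "w' \<in> \<Gamma> (set bs) i" unfolding w'_def by (intro P(5) w dv')
  have w'c: "w' \<in> carrier (I i)" using \<Gamma>_carrier[OF w'] .
  have dv'c: "\<delta> j v' \<in> carrier (I i)" using \<Gamma>_carrier[OF dv'] .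
  have "\<delta> i w' = z"
  proof -
    have "\<delta> i (\<delta> j v') = \<zero>\<^bsub>I (Suc i)\<^esub>" using \<delta>\<delta>[OF vc(2)] i(1) by simp
    then show ?thesis
      unfolding w'_def using \<delta>(6)[OF wc dv'c] w(2) \<Gamma>_carrier[OF z(1)] by (simp add: a_minus_def)
  qed
  moreover have "r [^] n \<odot>\<^bsub>I i\<^esub> w' \<in> \<Gamma> {r} i"
  proof -
    have "\<delta> j (r [^] n \<odot>\<^bsub>I j\<^esub> v' \<ominus>\<^bsub>I j\<^esub> v) = r [^] n \<odot>\<^bsub>I i\<^esub> \<delta> j v' \<ominus>\<^bsub>I i\<^esub> r [^] n \<odot>\<^bsub>I i\<^esub> w"
      using \<delta>(6)[of "r [^] n \<odot>\<^bsub>I j\<^esub> v'" j v] \<delta>(3)[OF rn vc(2)] v(2) vc rn i(1) by simp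
    also have "\<dots> = \<ominus>\<^bsub>I i\<^esub> (r [^] n \<odot>\<^bsub>I i\<^esub> w')"
      unfolding w'_def using rn wc dv'c
      by (simp add: a_minus_def Mi.smult_r_distr Mi.smult_r_minus Mi.M.minus_add Mi.M.a_comm)
    finally have "r [^] n \<odot>\<^bsub>I i\<^esub> w' = \<ominus>\<^bsub>I i\<^esub> (\<delta> j (r [^] n \<odot>\<^bsub>I j\<^esub> v' \<ominus>\<^bsub>I j\<^esub> v))"
      using rn w'c by simp
    moreover have "r [^] n \<odot>\<^bsub>I j\<^esub> v' \<ominus>\<^bsub>I j\<^esub> v \<in> \<Gamma> {r} j"
      using v'(2) by (rule power_torsion_insertD)
    then have "\<delta> j (r [^] n \<odot>\<^bsub>I j\<^esub> v' \<ominus>\<^bsub>I j\<^esub> v) \<in> \<Gamma> {r} i"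
      using \<Gamma>_\<delta>[of "{r}"] r i(1) by auto
    ultimately show ?thesis using Mi.submoduleD(4)[OF power_torsion_submodule[OF mod]] r by simp
  qed
  then have "w' \<in> \<Gamma> {r} i" by (rule power_torsion_unsmult[OF mod r w'c])
  ultimately show ?case using w' power_torsion_insertI by (metis list.simps(15))
qed

text \<open>By \<open>vanishing\<close>, \<open>z = \<delta> w\<close> with \<open>w\<close> torsion
  for \<open>bs\<close> alone. If \<open>v\<close> divides \<open>w\<close> by \<open>r\<close>,
  then \<open>z' = \<delta> v\<close> has a class whose \<open>r\<close>-multiple is that of
  \<open>z\<close>. It lies in the full torsion because \<open>r z'\<close> does, but it can be a
  nonzero class, as \<open>v\<close> need not be \<open>r\<close>-torsion.\<close>

lemma divisible_class:
  assumes A: "set bs \<subseteq> carrier R" "length bs \<le> i" and r: "r \<in> carrier R"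
    and z: "z \<in> \<Gamma> (insert r (set bs)) (Suc i)" "\<delta> (Suc i) z = \<zero>\<^bsub>I (Suc (Suc i))\<^esub>"
  obtains z' u where "z' \<in> \<Gamma> (insert r (set bs)) (Suc i)" "\<delta> (Suc i) z' = \<zero>\<^bsub>I (Suc (Suc i))\<^esub>"
    "u \<in> \<Gamma> (insert r (set bs)) i" "r \<odot>\<^bsub>I (Suc i)\<^esub> z' = z \<oplus>\<^bsub>I (Suc i)\<^esub> \<delta> i u"
proof -
  interpret Mi: module R "I i" by (rule mod)
  interpret Ms: module R "I (Suc i)" by (rule mod)
  have z': "z \<in> \<Gamma> {r} (Suc i)" "z \<in> \<Gamma> (set bs) (Suc i)"
    using z(1) by (rule power_torsion_insertD)+
  obtain w where w: "w \<in> \<Gamma> (set bs) i" "\<delta> i w = z"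
    using vanishing[OF A z'(2) z(2)] by blast
  obtain v where v: "v \<in> \<Gamma> (set bs) i" "r [^] (1::nat) \<odot>\<^bsub>I i\<^esub> v \<ominus>\<^bsub>I i\<^esub> w \<in> \<Gamma> (insert r (set bs)) i"
    using \<Gamma>_divide[OF A(1) w(1) r] .
  define u where "u = r \<odot>\<^bsub>I i\<^esub> v \<ominus>\<^bsub>I i\<^esub> w"
  have u: "u \<in> \<Gamma> (insert r (set bs)) i" using v(2) r by (simp add: u_def)
  have c: "v \<in> carrier (I i)" "w \<in> carrier (I i)" "u \<in> carrier (I i)" "\<delta> i u \<in> carrier (I (Suc i))"
      "z \<in> carrier (I (Suc i))" "\<delta> i v \<in> carrier (I (Suc i))"
    using v w u z \<Gamma>_carrier \<delta>(1) by auto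
  have "\<delta> i u = r \<odot>\<^bsub>I (Suc i)\<^esub> \<delta> i v \<ominus>\<^bsub>I (Suc i)\<^esub> z"
    unfolding u_def using \<delta>(6)[of "r \<odot>\<^bsub>I i\<^esub> v" i w] \<delta>(3)[OF r c(1)] w(2) c r by simp
  then have e: "r \<odot>\<^bsub>I (Suc i)\<^esub> \<delta> i v = z \<oplus>\<^bsub>I (Suc i)\<^esub> \<delta> i u"
    using c r
    by (simp add: a_minus_def Ms.M.a_lcomm[of z "r \<odot>\<^bsub>I (Suc i)\<^esub> \<delta> i v"] Ms.M.r_neg)
  have ru: "\<delta> i u \<in> \<Gamma> {r} (Suc i)"
    using \<Gamma>_\<delta>[of "{r}", OF _ power_torsion_insertD(1)[OF u]] r by simp
  have "r [^] (1::nat) \<odot>\<^bsub>I (Suc i)\<^esub> \<delta> i v \<in> \<Gamma> {r} (Suc i)"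
    using Ms.submoduleD(3)[OF power_torsion_submodule[OF mod] z'(1) ru] r e by simp
  then have "\<delta> i v \<in> \<Gamma> {r} (Suc i)" by (rule power_torsion_unsmult[OF mod r c(6)])
  moreover have "\<delta> i v \<in> \<Gamma> (set bs) (Suc i)" using \<Gamma>_\<delta>[OF A(1) v(1)] .
  ultimately have "\<delta> i v \<in> \<Gamma> (insert r (set bs)) (Suc i)" by (rule power_torsion_insertI)
  then show thesis using that \<delta>\<delta>[OF c(1)] u e by blast
qed

text \<open>A cocycle killed by \<open>r\<close> modulo coboundaries is cohomologous to one in the \<open>A + (r)\<close>-torsion,
  where classes are divisible by \<open>r\<close>; hence \<open>r H = 0\<close> forces \<open>H = 0\<close>.\<close>

lemma killed_cohomology_vanishes:
  assumes A: "A \<subseteq> carrier R" and r: "r \<in> carrier R" and bs: "set bs \<subseteq> carrier R" "length bs \<le> i"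
    and eq: "\<And>n. \<Gamma> (insert r (set bs)) n = \<Gamma> (insert r A) n"
    and kill: "\<And>z. z \<in> \<Gamma> A (Suc i) \<Longrightarrow> \<delta> (Suc i) z = \<zero>\<^bsub>I (Suc (Suc i))\<^esub> \<Longrightarrow>
      \<exists>v\<in>\<Gamma> A i. r \<odot>\<^bsub>I (Suc i)\<^esub> z = \<delta> i v"
    and z: "z \<in> \<Gamma> A (Suc i)" "\<delta> (Suc i) z = \<zero>\<^bsub>I (Suc (Suc i))\<^esub>"
  shows "\<exists>w\<in>\<Gamma> A i. \<delta> i w = z"
proof -
  interpret Mi: module R "I i" by (rule mod)
  interpret Ms: module R "I (Suc i)" by (rule mod)
  interpret Mss: module R "I (Suc (Suc i))" by (rule mod)
  note P = Mi.submoduleD[OF power_torsion_submodule[OF mod A, of i]]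
    and Ps = Ms.submoduleD[OF power_torsion_submodule[OF mod A, of "Suc i"]]
  have sub: "\<Gamma> (insert r A) n \<subseteq> \<Gamma> A n" for n by (rule power_torsion_antimono) blast
  obtain v where v: "v \<in> \<Gamma> A i" "r \<odot>\<^bsub>I (Suc i)\<^esub> z = \<delta> i v" using kill[OF z] by blast
  obtain v' where v': "v' \<in> \<Gamma> A i" "r [^] (1::nat) \<odot>\<^bsub>I i\<^esub> v' \<ominus>\<^bsub>I i\<^esub> v \<in> \<Gamma> (insert r A) i"
    using \<Gamma>_divide[OF A v(1) r] .
  have c: "v \<in> carrier (I i)" "v' \<in> carrier (I i)" "z \<in> carrier (I (Suc i))"
    "\<delta> i v' \<in> carrier (I (Suc i))" using v v' z \<Gamma>_carrier \<delta>(1) by auto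
  \<comment> \<open>\<open>r y\<close> is minus the coboundary of \<open>r v' - v\<close>, which is
    \<open>r\<close>-power torsion; hence so is \<open>y\<close>, a cocycle cohomologous to
    \<open>z\<close>.\<close>
  define y where "y = z \<ominus>\<^bsub>I (Suc i)\<^esub> \<delta> i v'"
  have yA: "y \<in> \<Gamma> A (Suc i)" unfolding y_def by (intro Ps(5) z \<Gamma>_\<delta>[OF A v'(1)])
  have yc: "y \<in> carrier (I (Suc i))" using \<Gamma>_carrier[OF yA] .
  have y0: "\<delta> (Suc i) y = \<zero>\<^bsub>I (Suc (Suc i))\<^esub>"
    unfolding y_def using \<delta>(6)[OF c(3,4)] z(2) \<delta>\<delta>[OF c(2)] by (simp add: a_minus_def)
  have "r \<odot>\<^bsub>I i\<^esub> v' \<ominus>\<^bsub>I i\<^esub> v \<in> \<Gamma> {r} i" using power_torsion_insertD(1)[OF v'(2)] r by simp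
  then have "\<delta> i (r \<odot>\<^bsub>I i\<^esub> v' \<ominus>\<^bsub>I i\<^esub> v) \<in> \<Gamma> {r} (Suc i)" using \<Gamma>_\<delta>[of "{r}"] r by auto
  moreover have "\<delta> i (r \<odot>\<^bsub>I i\<^esub> v' \<ominus>\<^bsub>I i\<^esub> v) = r \<odot>\<^bsub>I (Suc i)\<^esub> \<delta> i v' \<ominus>\<^bsub>I (Suc i)\<^esub> r \<odot>\<^bsub>I (Suc i)\<^esub> z"
    using \<delta>(6)[of "r \<odot>\<^bsub>I i\<^esub> v'" i v] \<delta>(3)[OF r c(2)] v(2) c r by simp
  moreover have "\<dots> = \<ominus>\<^bsub>I (Suc i)\<^esub> (r \<odot>\<^bsub>I (Suc i)\<^esub> y)"
    unfolding y_def using c r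
    by (simp add: a_minus_def Ms.smult_r_distr Ms.smult_r_minus Ms.M.minus_add Ms.M.a_comm)
  ultimately have "\<ominus>\<^bsub>I (Suc i)\<^esub> (r \<odot>\<^bsub>I (Suc i)\<^esub> y) \<in> \<Gamma> {r} (Suc i)" by simp
  then have "\<ominus>\<^bsub>I (Suc i)\<^esub> (\<ominus>\<^bsub>I (Suc i)\<^esub> (r \<odot>\<^bsub>I (Suc i)\<^esub> y)) \<in> \<Gamma> {r} (Suc i)"
    using Ms.submoduleD(4)[OF power_torsion_submodule[OF mod]] r by simp
  then have "r [^] (1::nat) \<odot>\<^bsub>I (Suc i)\<^esub> y \<in> \<Gamma> {r} (Suc i)" using yc r by simp
  then have "y \<in> \<Gamma> {r} (Suc i)" by (rule power_torsion_unsmult[OF mod r yc])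
  then have "y \<in> \<Gamma> (insert r (set bs)) (Suc i)" using power_torsion_insertI[OF _ yA] eq by blast
  then obtain z' u where zu: "z' \<in> \<Gamma> (insert r A) (Suc i)" "\<delta> (Suc i) z' = \<zero>\<^bsub>I (Suc (Suc i))\<^esub>"
    "u \<in> \<Gamma> (insert r A) i" "r \<odot>\<^bsub>I (Suc i)\<^esub> z' = y \<oplus>\<^bsub>I (Suc i)\<^esub> \<delta> i u"
    using divisible_class[OF bs r _ y0] eq by metis
  \<comment> \<open>The hypothesis is used again, for \<open>z'\<close>: \<open>r z'\<close> is a
    coboundary, while its class is that of \<open>y\<close>. So \<open>y\<close>, and with it
    \<open>z\<close>, is a coboundary.\<close>
  obtain t where t: "t \<in> \<Gamma> A i" "r \<odot>\<^bsub>I (Suc i)\<^esub> z' = \<delta> i t" using kill[OF subsetD[OF sub zu(1)] zu(2)] by blast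
  have uA: "u \<in> \<Gamma> A i" using zu(3) sub by blast
  have c': "t \<in> carrier (I i)" "u \<in> carrier (I i)" "\<delta> i u \<in> carrier (I (Suc i))" "\<delta> i t \<in> carrier (I (Suc i))"
    using t uA \<Gamma>_carrier \<delta>(1) by auto
  have "y = \<delta> i t \<ominus>\<^bsub>I (Suc i)\<^esub> \<delta> i u"
    using zu(4) t(2) c' yc by (simp add: a_minus_def Ms.M.a_assoc Ms.M.r_neg)
  moreover have "z = y \<oplus>\<^bsub>I (Suc i)\<^esub> \<delta> i v'"
    unfolding y_def using c by (simp add: a_minus_def Ms.M.a_assoc Ms.M.l_neg)
  ultimately have "z = \<delta> i ((t \<ominus>\<^bsub>I i\<^esub> u) \<oplus>\<^bsub>I i\<^esub> v')"
    using \<delta>(2)[of "t \<ominus>\<^bsub>I i\<^esub> u" i v'] \<delta>(6)[of t i u] c c' by simp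
  moreover have "(t \<ominus>\<^bsub>I i\<^esub> u) \<oplus>\<^bsub>I i\<^esub> v' \<in> \<Gamma> A i" by (intro P(3) P(5) t uA v')
  ultimately show ?thesis by blast
qed

end

section \<open>Generators up to radical, minimal primes and longest chains\<close>

context noetherian_cring
begin

text \<open>Each new element avoids the finitely many minimal primes over \<open>(r, bs)\<close> that do not contain
  \<open>A\<close>, so a prime containing \<open>(r, bs)\<close> but not \<open>A\<close> ends a chain above \<open>r\<close> of length \<open>k\<close>.\<close>

lemma generate_up_to_radical:
  assumes "ideal A R" "r \<in> carrier R"
  shows "\<exists>bs. set bs \<subseteq> A \<and> length bs = k \<and>
    (\<forall>P. primeideal P R \<longrightarrow> insert r (set bs) \<subseteq> P \<longrightarrow> \<not> A \<subseteq> P \<longrightarrow>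
      (\<exists>c. prime_chain R k c \<and> r \<in> c 0 \<and> c k = P))"
proof (induction k)
  case 0
  have "\<exists>c. prime_chain R 0 c \<and> r \<in> c 0 \<and> c 0 = P" if "primeideal P R" "r \<in> P" for P
    using prime_chain_0[OF that(1)] that(2) by blast
  then show ?case by (intro exI[of _ "[]"]) simp
next
  case (Suc k)
  then obtain bs where bs: "set bs \<subseteq> A" "length bs = k"
    and ch: "\<And>P. primeideal P R \<Longrightarrow> insert r (set bs) \<subseteq> P \<Longrightarrow> \<not> A \<subseteq> P \<Longrightarrow>
      \<exists>c. prime_chain R k c \<and> r \<in> c 0 \<and> c k = P" by metis
  have AR: "A \<subseteq> carrier R" using ideal.Icarr[OF assms(1)] by blast
  let ?J = "Idl (insert r (set bs))"
  have sub: "insert r (set bs) \<subseteq> carrier R" using bs AR assms by auto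
  have J: "ideal ?J R" by (rule genideal_ideal[OF sub])
  obtain F where F: "finite F" "\<And>p. p \<in> F \<Longrightarrow> primeideal p R \<and> ?J \<subseteq> p"
    "\<And>P. primeideal P R \<Longrightarrow> ?J \<subseteq> P \<Longrightarrow> \<exists>p\<in>F. p \<subseteq> P"
    using finite_minimal_primes[OF J] by metis
  have "\<exists>b\<in>A. \<forall>p\<in>{p \<in> F. \<not> A \<subseteq> p}. b \<notin> p"
    using F(1,2) by (intro prime_avoidance assms(1)) auto
  then obtain b where b: "b \<in> A" "\<And>p. p \<in> F \<Longrightarrow> \<not> A \<subseteq> p \<Longrightarrow> b \<notin> p" by blast
  have "\<exists>c. prime_chain R (Suc k) c \<and> r \<in> c 0 \<and> c (Suc k) = P"
    if P: "primeideal P R" "insert r (set (b # bs)) \<subseteq> P" "\<not> A \<subseteq> P" for P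
  proof -
    have "?J \<subseteq> P" using P(2) by (intro genideal_minimal primeidealD(1)[OF P(1)]) auto
    then obtain p where p: "p \<in> F" "p \<subseteq> P" using F(3) P(1) by blast
    have "\<not> A \<subseteq> p" using p P by blast
    then have "b \<notin> p" using b p by blast
    then have "p \<subset> P" using p P(2) by auto
    have "insert r (set bs) \<subseteq> p" using F(2)[OF p(1)] genideal_self[OF sub] by blast
    then obtain c where c: "prime_chain R k c" "r \<in> c 0" "c k = p"
      using ch F(2)[OF p(1)] \<open>\<not> A \<subseteq> p\<close> by blast
    show ?thesis
      using prime_chain_snoc[OF c(1) P(1)] c \<open>p \<subset> P\<close>
      by (intro exI[of _ "c(Suc k := P)"]) auto
  qed
  then show ?case using bs b by (intro exI[of _ "b # bs"]) auto
qed

text \<open>Torsion depends only on the primes over the support: a prime over the annihilator of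
  \<open>z\<close> contains \<open>bs\<close> and \<open>r\<close>, hence \<open>A\<close>, so every
  element of \<open>A\<close> has a power killing \<open>z\<close>.\<close>

lemma power_torsion_radical_eq:
  assumes "module R M" "A \<subseteq> carrier R" "set bs \<subseteq> A" "r \<in> carrier R"
    and "\<And>P. primeideal P R \<Longrightarrow> insert r (set bs) \<subseteq> P \<Longrightarrow> A \<subseteq> P"
  shows "power_torsion R (insert r (set bs)) M = power_torsion R (insert r A) M"
proof
  interpret module R M by fact
  show "power_torsion R (insert r A) M \<subseteq> power_torsion R (insert r (set bs)) M"
    using assms(3) by (intro power_torsion_antimono) auto
  show "power_torsion R (insert r (set bs)) M \<subseteq> power_torsion R (insert r A) M"
  proof
    fix z assume z: "z \<in> power_torsion R (insert r (set bs)) M"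
    then have zc: "z \<in> carrier M" by (simp add: power_torsion_def)
    note C = colon_ideal[OF submodule_zero zc]
    have "\<exists>n::nat. s [^]\<^bsub>R\<^esub> n \<odot>\<^bsub>M\<^esub> z = \<zero>\<^bsub>M\<^esub>" if s: "s \<in> insert r A" for s
    proof -
      have "\<exists>n::nat. s [^]\<^bsub>R\<^esub> n \<in> colon {\<zero>\<^bsub>M\<^esub>} z"
      proof (rule radical_pow_mem[OF C])
        show "s \<in> carrier R" using s assms by auto
        fix P assume P: "primeideal P R" "colon {\<zero>\<^bsub>M\<^esub>} z \<subseteq> P"
        have "b \<in> P" if b: "b \<in> insert r (set bs)" for b
        proof -
          have bR: "b \<in> carrier R" using b assms by auto
          obtain n :: nat where "b [^]\<^bsub>R\<^esub> n \<odot>\<^bsub>M\<^esub> z = \<zero>\<^bsub>M\<^esub>" using z b unfolding power_torsion_def by blast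
          then have "b [^]\<^bsub>R\<^esub> n \<in> P" using P(2) bR by (auto simp: colon_def)
          then show ?thesis using primeideal.pow_memD[OF P(1) bR] by simp
        qed
        then show "s \<in> P" using assms(5)[OF P(1)] s by blast
      qed
      then show ?thesis by (auto simp: colon_def)
    qed
    then show "z \<in> power_torsion R (insert r A) M" using zc by (simp add: power_torsion_def)
  qed
qed

text \<open>A stand-in for localising at \<open>p\<close>: products of powers of \<open>x\<close>
  with elements outside \<open>p\<close> form a multiplicative set without 0, as \<open>x\<close> is
  regular. A prime missing it lies inside \<open>p\<close> and omits \<open>x\<close>, so
  \<open>x \<in> p\<close> would contradict minimality.\<close>

lemma not_mem_minimal_prime_of_regular:
  assumes "x \<in> carrier R" "\<And>s. s \<in> carrier R \<Longrightarrow> x \<otimes> s = \<zero> \<Longrightarrow> s = \<zero>"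
    and p: "primeideal p R" "\<And>q. primeideal q R \<Longrightarrow> \<not> q \<subset> p"
  shows "x \<notin> p"
proof
  assume "x \<in> p"
  note D = primeidealD[OF p(1)]
  let ?S = "{x [^] n \<otimes> s | (n::nat) s. s \<in> carrier R \<and> s \<notin> p}"
  have reg: "x [^] n \<otimes> s = \<zero> \<Longrightarrow> s = \<zero>" if s: "s \<in> carrier R" for n :: nat and s
  proof (induction n)
    case 0
    then show ?case using s by simp
  next
    case (Suc n)
    have "x \<otimes> (x [^] n \<otimes> s) = x [^] Suc n \<otimes> s" using s assms(1) by (simp add: m_ac)
    then show ?case using Suc assms(2)[of "x [^] n \<otimes> s"] s assms(1) by simp
  qed
  obtain P where P: "primeideal P R" "{\<zero>} \<subseteq> P" "P \<inter> ?S = {}"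
  proof (rule exists_prime_avoiding[OF zeroideal])
    show "?S \<subseteq> carrier R" using assms(1) by auto
    show "\<one> \<in> ?S" using D(3) by (auto intro!: exI[of _ "0::nat"] exI[of _ \<one>])
    show "s \<otimes> t \<in> ?S" if st: "s \<in> ?S" "t \<in> ?S" for s t
    proof -
      obtain m a where m: "s = x [^] (m::nat) \<otimes> a" "a \<in> carrier R" "a \<notin> p" using st(1) by blast
      obtain n b where n: "t = x [^] (n::nat) \<otimes> b" "b \<in> carrier R" "b \<notin> p" using st(2) by blast
      have "s \<otimes> t = x [^] (m + n) \<otimes> (a \<otimes> b)"
        using m n assms(1) by (simp add: nat_pow_mult[symmetric] m_ac)
      moreover have "a \<otimes> b \<notin> p" using D(4)[OF m(2) n(2)] m n by blast
      ultimately show ?thesis using m n by blast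
    qed
    show "{\<zero>} \<inter> ?S = {}"
    proof -
      have "\<zero> \<in> p" using D(1) by (simp add: additive_subgroup.zero_closed ideal.axioms(1))
      then have "\<zero> \<noteq> x [^] n \<otimes> s" if "s \<in> carrier R" "s \<notin> p" for n :: nat and s
        using reg[OF that(1), of n] that(2) by metis
      then show ?thesis by blast
    qed
  qed
  have sub: "P \<subseteq> p"
  proof
    fix s assume s: "s \<in> P"
    have sR: "s \<in> carrier R" using s primeidealD(2)[OF P(1)] by blast
    have "s = x [^] (0::nat) \<otimes> s" using sR by simp
    then show "s \<in> p" using P(3) s sR by blast
  qed
  have "x = x [^] (1::nat) \<otimes> \<one>" using assms(1) by simp
  then have "x \<in> ?S" using D(3) by blast
  then have "P \<noteq> p" using P(3) \<open>x \<in> p\<close> by blast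
  then show False using sub p(2)[OF P(1)] by blast
qed

text \<open>The first prime of a chain of length dim R is minimal, hence belongs to the finite set
  \<open>F\<close>; by assumption such primes do not contain \<open>J\<close>, so prime avoidance
  applies.\<close>

lemma exists_mem_avoiding_long_chains:
  assumes dim: "krull_dim R = enat d" and J: "ideal J R"
    and no: "\<And>c. prime_chain R d c \<Longrightarrow> \<not> J \<subseteq> c 0"
  obtains r where "r \<in> J" "\<And>c. prime_chain R d c \<Longrightarrow> r \<notin> c 0"
proof -
  obtain F where F: "finite F" "\<And>p. p \<in> F \<Longrightarrow> primeideal p R"
    "\<And>P. primeideal P R \<Longrightarrow> \<exists>p\<in>F. p \<subseteq> P"
  proof -
    obtain F where "finite F" "\<forall>p\<in>F. primeideal p R \<and> {\<zero>} \<subseteq> p"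
      "\<forall>P. primeideal P R \<and> {\<zero>} \<subseteq> P \<longrightarrow> (\<exists>p\<in>F. p \<subseteq> P)"
      using finite_minimal_primes[OF zeroideal] by blast
    moreover have "{\<zero>} \<subseteq> P" if "primeideal P R" for P
      using primeidealD(1)[OF that] by (simp add: additive_subgroup.zero_closed ideal.axioms(1))
    ultimately show thesis using that[of F] by simp
  qed
  let ?F = "{p \<in> F. \<not> J \<subseteq> p}"
  have "\<exists>r\<in>J. \<forall>p\<in>?F. r \<notin> p" using F(1,2) by (intro prime_avoidance J) auto
  then obtain r where r: "r \<in> J" "\<And>p. p \<in> F \<Longrightarrow> \<not> J \<subseteq> p \<Longrightarrow> r \<notin> p" by blast
  have "r \<notin> c 0" if c: "prime_chain R d c" for c
  proof
    assume "r \<in> c 0"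
    obtain p where p: "p \<in> F" "p \<subseteq> c 0" using F(3) prime_chain_primeideal[OF c, of 0] by auto
    have "p = c 0"
    proof (rule ccontr)
      assume "p \<noteq> c 0"
      then have "prime_chain R (Suc d) (case_nat p c)" using prime_chain_Cons[OF c F(2)[OF p(1)]] p by blast
      then show False using prime_chain_le_krull_dim[of R "Suc d"] dim by fastforce
    qed
    then show False using r(2) p(1) no[OF c] \<open>r \<in> c 0\<close> by blast
  qed
  then show thesis using that r by blast
qed

end

section \<open>Top local cohomology and its Matlis dual\<close>

lemma annihilator_ideal:
  fixes R :: "('a, 'r) ring_scheme" and M :: "('a, 'm) module"
  assumes "module R M"
  shows "ideal (annihilator R M) R"
proof -
  interpret module R M by fact
  have "annihilator R M = \<Inter> (colon {\<zero>\<^bsub>M\<^esub>} ` carrier M)"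
    using M.zero_closed by (auto simp: annihilator_def colon_def)
  moreover have "ideal (\<Inter> (colon {\<zero>\<^bsub>M\<^esub>} ` carrier M)) R"
    using colon_ideal[OF submodule_zero] M.zero_closed by (intro R.i_Intersect) auto
  ultimately show ?thesis by simp
qed

context noetherian_local_ring
begin

text \<open>A nonzero \<open>v = r h\<close> has its annihilator inside \<open>\<mm>\<close>, so
  \<open>s v \<mapsto> s e\<close> is well defined for the image \<open>e\<close> of 1 under k = R/m
  \<rightarrow> E. Extended to \<open>H\<close> by injectivity it is a functional \<open>g\<close>
  with \<open>g v \<noteq> 0\<close>, whereas \<open>r\<close> kills \<open>g\<close>.\<close>

lemma annihilator_matlis_dual_kills:
  fixes H :: "('a, 'h) module" and E :: "('a, 'e) module"
  assumes hull: "injective_hull R (quotient_module (ring_module R) \<mm>) E \<iota>" and mH: "module R H"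
    and r: "r \<in> annihilator R (matlis_dual R E H)" and h: "h \<in> carrier H"
  shows "r \<odot>\<^bsub>H\<^esub> h = \<zero>\<^bsub>H\<^esub>"
proof (rule ccontr)
  assume nz: "r \<odot>\<^bsub>H\<^esub> h \<noteq> \<zero>\<^bsub>H\<^esub>"
  let ?k = "quotient_module (ring_module R) \<mm>"
  have inj: "injective_module R E" and \<iota>: "\<iota> \<in> module_hom R ?k E" "inj_on \<iota> (carrier ?k)"
    using hull by (auto simp: injective_hull_def)
  have mE: "module R E" using inj by (simp add: injective_module_def)
  note mR = module_ring_module[OF is_cring]
  note sub = ideal_submodule_ring_module[OF is_cring max_ideal(1)]
  note mk = module_quotient[OF mR sub]
  interpret H: module R H by (rule mH)
  interpret E: module R E by (rule mE)
  have rc: "r \<in> carrier R" using r by (simp add: annihilator_def)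
  define v where "v = r \<odot>\<^bsub>H\<^esub> h"
  have v: "v \<in> carrier H" "v \<noteq> \<zero>\<^bsub>H\<^esub>" using nz rc h by (auto simp: v_def)
  let ?one = "\<mm> +>\<^bsub>ring_module R\<^esub> \<one>"
  define e where "e = \<iota> ?one"
  have one: "\<one> \<in> carrier (ring_module R)" by (simp add: ring_module_def)
  have one_k: "?one \<in> carrier ?k" using one by (auto simp: quotient_carrier[OF mR sub])
  have zero_k: "\<mm> \<in> carrier ?k" and \<iota>0: "\<iota> \<mm> = \<zero>\<^bsub>E\<^esub>"
  proof -
    interpret k: module R ?k by (rule mk)
    show "\<mm> \<in> carrier ?k" using k.M.zero_closed by (simp add: quotient_zero[OF mR sub])
    show "\<iota> \<mm> = \<zero>\<^bsub>E\<^esub>" using module_homD2(1)[OF \<iota>(1) mk mE] by (simp add: quotient_zero[OF mR sub])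
  qed
  have ec: "e \<in> carrier E" using module_homD(1)[OF \<iota>(1) one_k] by (simp add: e_def)
  have e0: "e \<noteq> \<zero>\<^bsub>E\<^esub>"
  proof
    assume "e = \<zero>\<^bsub>E\<^esub>"
    then have "?one = \<mm>" using \<iota>0 inj_onD[OF \<iota>(2) _ one_k zero_k] by (simp add: e_def)
    then show False using quotient_coset_eq_zero_iff[OF mR sub one] max_ideal(2) by simp
  qed
  have kill: "s \<odot>\<^bsub>E\<^esub> e = \<zero>\<^bsub>E\<^esub>" if s: "s \<in> \<mm>" for s
  proof -
    have sR: "s \<in> carrier R" using s max_ideal(3) by blast
    then have s1: "s \<odot>\<^bsub>ring_module R\<^esub> \<one> = s" "s \<in> carrier (ring_module R)" by (auto simp: ring_module_def)
    have "s \<odot>\<^bsub>?k\<^esub> ?one = \<mm>"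
      using quotient_smult[OF mR sub sR one] quotient_coset_eq_zero_iff[OF mR sub s1(2)] s s1(1) by simp
    then show ?thesis using module_homD(3)[OF \<iota>(1) sR one_k] \<iota>0 by (simp add: e_def)
  qed
  define G where "G = {(s \<odot>\<^bsub>H\<^esub> v, s \<odot>\<^bsub>E\<^esub> e) | s. s \<in> carrier R}"
  have "hom_graph R H E G"
    unfolding hom_graph_def
  proof (intro conjI allI impI)
    show "G \<subseteq> carrier H \<times> carrier E" using v ec by (auto simp: G_def)
    have "(\<zero> \<odot>\<^bsub>H\<^esub> v, \<zero> \<odot>\<^bsub>E\<^esub> e) \<in> G" unfolding G_def by blast
    then show "(\<zero>\<^bsub>H\<^esub>, \<zero>\<^bsub>E\<^esub>) \<in> G" using v ec by simp
  next
    fix x a y b assume "(x, a) \<in> G \<and> (y, b) \<in> G"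
    then obtain s t where "s \<in> carrier R" "x = s \<odot>\<^bsub>H\<^esub> v" "a = s \<odot>\<^bsub>E\<^esub> e"
      "t \<in> carrier R" "y = t \<odot>\<^bsub>H\<^esub> v" "b = t \<odot>\<^bsub>E\<^esub> e" unfolding G_def by blast
    then show "(x \<oplus>\<^bsub>H\<^esub> y, a \<oplus>\<^bsub>E\<^esub> b) \<in> G"
      unfolding G_def using v ec
      by (intro CollectI exI[of _ "s \<oplus> t"]) (simp add: H.smult_l_distr E.smult_l_distr)
  next
    fix q x a assume "q \<in> carrier R \<and> (x, a) \<in> G"
    then obtain s where "s \<in> carrier R" "x = s \<odot>\<^bsub>H\<^esub> v" "a = s \<odot>\<^bsub>E\<^esub> e" "q \<in> carrier R"
      unfolding G_def by blast
    then show "(q \<odot>\<^bsub>H\<^esub> x, q \<odot>\<^bsub>E\<^esub> a) \<in> G"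
      unfolding G_def using v ec
      by (intro CollectI exI[of _ "q \<otimes> s"]) (simp add: H.smult_assoc1 E.smult_assoc1)
  next
    fix a assume "(\<zero>\<^bsub>H\<^esub>, a) \<in> G"
    then obtain s where s: "s \<in> carrier R" "s \<odot>\<^bsub>H\<^esub> v = \<zero>\<^bsub>H\<^esub>" "a = s \<odot>\<^bsub>E\<^esub> e"
      unfolding G_def by auto
    have "s \<in> H.colon {\<zero>\<^bsub>H\<^esub>} v" using s by (simp add: H.colon_def)
    moreover have "H.colon {\<zero>\<^bsub>H\<^esub>} v \<subseteq> \<mm>"
      using proper_ideal_subset[OF H.colon_ideal[OF H.submodule_zero v(1)]] H.one_mem_colon[OF v(1)] v(2)
      by blast
    ultimately show "a = \<zero>\<^bsub>E\<^esub>" using kill s(3) by blast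
  qed
  note hg = this
  obtain g where g: "g \<in> module_hom R H E" "\<And>x a. (x, a) \<in> G \<Longrightarrow> g x = a"
    by (rule injective_module_extend[OF inj mH hg], rule that)
  have "(\<one> \<odot>\<^bsub>H\<^esub> v, \<one> \<odot>\<^bsub>E\<^esub> e) \<in> G" unfolding G_def by blast
  then have gv: "g v = e" using g(2) v ec by fastforce
  \<comment> \<open>Members of \<open>Hom_module\<close> are extensional functions.\<close>
  let ?g = "restrict g (carrier H)"
  have "?g \<in> carrier (matlis_dual R E H)"
    using g(1) by (auto simp: matlis_dual_def Hom_module_def module_hom_def)
  then have "r \<odot>\<^bsub>matlis_dual R E H\<^esub> ?g = \<zero>\<^bsub>matlis_dual R E H\<^esub>" using r by (simp add: annihilator_def)
  then have "(r \<odot>\<^bsub>matlis_dual R E H\<^esub> ?g) h = \<zero>\<^bsub>matlis_dual R E H\<^esub> h" by simp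
  then have "r \<odot>\<^bsub>E\<^esub> g h = \<zero>\<^bsub>E\<^esub>" using h by (simp add: matlis_dual_def Hom_module_def)
  moreover have "r \<odot>\<^bsub>E\<^esub> g h = g v" unfolding v_def using module_homD(3)[OF g(1) rc h] by simp
  ultimately show False using gv e0 by simp
qed

end

text \<open>The dimension is written \<open>Suc i\<close> because coboundaries come from degree
  \<open>i\<close>, which is also the number of elements allowed beside \<open>r\<close> in
  generating the support.\<close>

locale top_local_cohomology = noetherian_local_ring R \<mm> + injective_complex R I \<delta>
  for R :: "('a, 'r) ring_scheme" (structure) and \<mm> and I :: "nat \<Rightarrow> ('a, 'i) module" and \<delta> +
  fixes A :: "'a set" and i :: nat
  assumes A: "ideal A R" and dim: "krull_dim R = enat (Suc i)"
begin

definition cocycles :: "'i set" where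
  "cocycles = {x \<in> torsion_part R A (I (Suc i)). \<delta> (Suc i) x = \<zero>\<^bsub>I (Suc (Suc i))\<^esub>}"

definition coboundaries :: "'i set" where
  "coboundaries = \<delta> i ` torsion_part R A (I i)"

abbreviation "cocycle_module \<equiv> (I (Suc i))\<lparr>carrier := cocycles\<rparr>"

lemma A_carrier: "A \<subseteq> carrier R" using ideal.Icarr[OF A] by blast

lemma torsion_part_eq: "torsion_part R A (I n) = \<Gamma> A n"
  by (rule torsion_part_eq_power_torsion[OF mod noetherian_cring_axioms A])

lemma module_cocycles: "module R cocycle_module"
proof -
  interpret S: module R "I (Suc i)" by (rule mod)
  interpret SS: module R "I (Suc (Suc i))" by (rule mod)
  note P = S.submoduleD[OF power_torsion_submodule[OF mod A_carrier]]
  have "submodule cocycles R (I (Suc i))"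
    unfolding cocycles_def torsion_part_eq
    using P \<delta>(2)[of _ "Suc i"] \<delta>(3)[of _ _ "Suc i"] \<delta>(4)[of "Suc i"]
    by (intro S.submoduleI') auto
  then show ?thesis using submodule.submodule_is_module[OF _ mod] by blast
qed

lemma submodule_coboundaries: "submodule coboundaries R cocycle_module"
proof -
  interpret S: module R "I (Suc i)" by (rule mod)
  interpret T: module R "I i" by (rule mod)
  interpret Z: module R cocycle_module by (rule module_cocycles)
  note P = T.submoduleD[OF power_torsion_submodule[OF mod A_carrier]]
  show ?thesis
  proof (rule Z.submoduleI')
    show "coboundaries \<subseteq> carrier cocycle_module"
      using \<Gamma>_\<delta>[OF A_carrier] \<delta>\<delta> \<Gamma>_carrier
      by (auto simp: coboundaries_def cocycles_def torsion_part_eq)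
    have "\<delta> i \<zero>\<^bsub>I i\<^esub> \<in> coboundaries" using P(2) by (auto simp: coboundaries_def torsion_part_eq)
    then show "\<zero>\<^bsub>cocycle_module\<^esub> \<in> coboundaries" using \<delta>(4) by simp
  next
    fix x y assume "x \<in> coboundaries" "y \<in> coboundaries"
    then obtain v w where vw: "v \<in> \<Gamma> A i" "x = \<delta> i v" "w \<in> \<Gamma> A i" "y = \<delta> i w"
      by (auto simp: coboundaries_def torsion_part_eq)
    then have "x \<oplus>\<^bsub>I (Suc i)\<^esub> y = \<delta> i (v \<oplus>\<^bsub>I i\<^esub> w)" using \<delta>(2) \<Gamma>_carrier by simp
    then show "x \<oplus>\<^bsub>cocycle_module\<^esub> y \<in> coboundaries"
      using P(3)[OF vw(1,3)] by (auto simp: coboundaries_def torsion_part_eq)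
  next
    fix r x assume "r \<in> carrier R" "x \<in> coboundaries"
    then obtain v where v: "v \<in> \<Gamma> A i" "x = \<delta> i v" "r \<in> carrier R"
      by (auto simp: coboundaries_def torsion_part_eq)
    then have "r \<odot>\<^bsub>I (Suc i)\<^esub> x = \<delta> i (r \<odot>\<^bsub>I i\<^esub> v)" using \<delta>(3) \<Gamma>_carrier by simp
    then show "r \<odot>\<^bsub>cocycle_module\<^esub> x \<in> coboundaries"
      using P(6)[OF v(3,1)] by (auto simp: coboundaries_def torsion_part_eq)
  qed
qed

lemma local_cohomology_eq: "local_cohomology R A I \<delta> (Suc i) = quotient_module cocycle_module coboundaries"
  by (simp add: local_cohomology_def cocycles_def coboundaries_def)

lemma module_local_cohomology: "module R (local_cohomology R A I \<delta> (Suc i))"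
  unfolding local_cohomology_eq by (rule module_quotient[OF module_cocycles submodule_coboundaries])

lemma local_cohomology_trivial:
  assumes "cocycles \<subseteq> coboundaries"
  shows "carrier (local_cohomology R A I \<delta> (Suc i)) = {\<zero>\<^bsub>local_cohomology R A I \<delta> (Suc i)\<^esub>}"
proof -
  note q = quotient_carrier[OF module_cocycles submodule_coboundaries]
    quotient_zero[OF module_cocycles submodule_coboundaries]
    quotient_coset_eq_zero_iff[OF module_cocycles submodule_coboundaries]
  interpret Z: module R cocycle_module by (rule module_cocycles)
  have "coboundaries +>\<^bsub>cocycle_module\<^esub> z = coboundaries" if "z \<in> cocycles" for z
    using q(3) that assms by auto
  moreover have "\<zero>\<^bsub>I (Suc i)\<^esub> \<in> cocycles" using Z.M.zero_closed by simp
  ultimately show ?thesis unfolding local_cohomology_eq q(1,2) by auto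
qed

text \<open>\<open>avoid\<close> is the form in which dim R/(r) < d is used. A prime over
  \<open>r\<close> and the \<open>i\<close> elements \<open>bs\<close> that does not contain
  \<open>A\<close> would end a chain of length \<open>i\<close> and lie strictly below
  \<open>\<mm>\<close>; appending \<open>\<mm>\<close> gives a forbidden chain.\<close>

lemma killed_local_cohomology_trivial:
  assumes r: "r \<in> carrier R" and avoid: "\<And>c. prime_chain R (Suc i) c \<Longrightarrow> r \<notin> c 0"
    and kill: "\<And>h. h \<in> carrier (local_cohomology R A I \<delta> (Suc i)) \<Longrightarrow>
      r \<odot>\<^bsub>local_cohomology R A I \<delta> (Suc i)\<^esub> h = \<zero>\<^bsub>local_cohomology R A I \<delta> (Suc i)\<^esub>"
  shows "carrier (local_cohomology R A I \<delta> (Suc i)) = {\<zero>\<^bsub>local_cohomology R A I \<delta> (Suc i)\<^esub>}"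
proof (rule local_cohomology_trivial, rule subsetI)
  note Z = module_cocycles and B = submodule_coboundaries
  interpret T: module R "I i" by (rule mod)
  interpret S: module R "I (Suc i)" by (rule mod)
  fix z assume "z \<in> cocycles"
  then have z: "z \<in> \<Gamma> A (Suc i)" "\<delta> (Suc i) z = \<zero>\<^bsub>I (Suc (Suc i))\<^esub>"
    by (auto simp: cocycles_def torsion_part_eq)
  have "\<exists>w\<in>\<Gamma> A i. \<delta> i w = z"
  proof (cases "\<one> \<in> A")
    \<comment> \<open>For A = R every torsion element is zero; this case is separate because the
      other one needs \<open>A\<close> inside \<open>\<mm>\<close>.\<close>
    case True
    then obtain n :: nat where "\<one> [^] n \<odot>\<^bsub>I (Suc i)\<^esub> z = \<zero>\<^bsub>I (Suc i)\<^esub>"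
      using z(1) unfolding power_torsion_def by blast
    then have "z = \<zero>\<^bsub>I (Suc i)\<^esub>" using \<Gamma>_carrier[OF z(1)] by simp
    then show ?thesis
      using \<delta>(4)[of i] T.submoduleD(2)[OF power_torsion_submodule[OF mod A_carrier]] by auto
  next
    case False
    obtain bs where bs: "set bs \<subseteq> A" "length bs = i"
      and ch: "\<And>P. primeideal P R \<Longrightarrow> insert r (set bs) \<subseteq> P \<Longrightarrow> \<not> A \<subseteq> P \<Longrightarrow>
        \<exists>c. prime_chain R i c \<and> r \<in> c 0 \<and> c i = P"
      using generate_up_to_radical[OF A r, of i] by metis
    have contains: "A \<subseteq> P" if P: "primeideal P R" "insert r (set bs) \<subseteq> P" for P
    proof (rule ccontr)
      assume neg: "\<not> A \<subseteq> P"
      then obtain c where c: "prime_chain R i c" "r \<in> c 0" "c i = P" using ch P by blast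
      have "P \<subseteq> \<mm>" "A \<subseteq> \<mm>"
        using proper_ideal_subset primeidealD(1,3)[OF P(1)] A False by auto
      then have "c i \<subset> \<mm>" using neg c(3) by blast
      then have "prime_chain R (Suc i) (c(Suc i := \<mm>))"
        by (rule prime_chain_snoc[OF c(1) max_ideal(4)])
      then show False using avoid[of "c(Suc i := \<mm>)"] c(2) by simp
    qed
    have bsR: "set bs \<subseteq> carrier R" using bs A_carrier by blast
    show ?thesis
    proof (rule killed_cohomology_vanishes[OF A_carrier r bsR _ _ _ z])
      show "length bs \<le> i" using bs by simp
      show "\<Gamma> (insert r (set bs)) n = \<Gamma> (insert r A) n" for n
        by (rule power_torsion_radical_eq[OF mod A_carrier bs(1) r contains])
      fix y assume "y \<in> \<Gamma> A (Suc i)" "\<delta> (Suc i) y = \<zero>\<^bsub>I (Suc (Suc i))\<^esub>"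
      then have y: "y \<in> carrier cocycle_module" by (simp add: cocycles_def torsion_part_eq)
      then have "coboundaries +>\<^bsub>cocycle_module\<^esub> y \<in> carrier (quotient_module cocycle_module coboundaries)"
        unfolding quotient_carrier[OF Z B] by blast
      then have "coboundaries +>\<^bsub>cocycle_module\<^esub> (r \<odot>\<^bsub>cocycle_module\<^esub> y) = coboundaries"
        using kill quotient_smult[OF Z B r y] quotient_zero[OF Z B] unfolding local_cohomology_eq by metis
      moreover have "r \<odot>\<^bsub>cocycle_module\<^esub> y \<in> carrier cocycle_module"
        using module.smult_closed[OF Z r y] .
      ultimately have "r \<odot>\<^bsub>cocycle_module\<^esub> y \<in> coboundaries"
        using quotient_coset_eq_zero_iff[OF Z B] by blast
      then show "\<exists>v\<in>\<Gamma> A i. r \<odot>\<^bsub>I (Suc i)\<^esub> y = \<delta> i v"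
        by (auto simp: coboundaries_def torsion_part_eq)
    qed
  qed
  then show "z \<in> coboundaries" by (auto simp: coboundaries_def torsion_part_eq)
qed

text \<open>Otherwise some \<open>r\<close> in the annihilator of the dual avoids the first prime of
  every longest chain; it kills the cohomology, which would then vanish. The chain obtained bounds
  the dimension of the dual from below.\<close>

lemma matlis_dual_annihilator_chain:
  fixes E :: "('a, 'e) module"
  assumes hull: "injective_hull R (quotient_module (ring_module R) \<mm>) E \<iota>"
    and nz: "carrier (local_cohomology R A I \<delta> (Suc i)) \<noteq> {\<zero>\<^bsub>local_cohomology R A I \<delta> (Suc i)\<^esub>}"
  shows "\<exists>c. prime_chain R (Suc i) c \<and>
    annihilator R (matlis_dual R E (local_cohomology R A I \<delta> (Suc i))) \<subseteq> c 0"
proof (rule ccontr)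
  let ?H = "local_cohomology R A I \<delta> (Suc i)"
  assume no: "\<not> ?thesis"
  have "module R (matlis_dual R E ?H)"
    unfolding matlis_dual_def using hull
    by (intro module_Hom_module module_local_cohomology) (simp add: injective_hull_def injective_module_def)
  then have J: "ideal (annihilator R (matlis_dual R E ?H)) R" by (rule annihilator_ideal)
  obtain r where r: "r \<in> annihilator R (matlis_dual R E ?H)"
    "\<And>c. prime_chain R (Suc i) c \<Longrightarrow> r \<notin> c 0"
    using exists_mem_avoiding_long_chains[OF dim J] no by metis
  have "carrier ?H = {\<zero>\<^bsub>?H\<^esub>}"
    using annihilator_matlis_dual_kills[OF hull module_local_cohomology r(1)] r ideal.Icarr[OF J]
    by (intro killed_local_cohomology_trivial[of r]) auto
  then show False using nz by blast
qed

end

section \<open>The contradiction from Cohen-Macaulayness of the dual\<close>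

theorem mainTheorem3:
  fixes R :: "('a, 'r) ring_scheme" and \<mm> \<aa> \<bb> :: "'a set" and d :: nat and x :: 'a
    and I :: "nat \<Rightarrow> ('a, 'i) module" and \<delta> :: "nat \<Rightarrow> 'i \<Rightarrow> 'i" and \<epsilon> :: "'a \<Rightarrow> 'i"
    and E :: "('a, 'e) module" and \<iota> :: "'a set \<Rightarrow> 'e"
  defines "H \<equiv> local_cohomology R \<aa> I \<delta> d"
  defines "K \<equiv> matlis_dual R E H"
  assumes "noetherian_local_ring R \<mm>"
    and "adically_complete R \<mm>"
    and "krull_dim R = enat d"
    and "d \<ge> 3"
    and "injective_resolution R (ring_module R) I \<delta> \<epsilon>"
    and "injective_hull R (quotient_module (ring_module R) \<mm>) E \<iota>"
    and "ideal \<aa> R"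
    and "carrier H \<noteq> {\<zero>\<^bsub>H\<^esub>}"
    and "ideal \<bb> R"
    and "krull_dim (R Quot \<bb>) = 1"
    and "x \<in> \<bb>"
    and "regular_element R (ring_module R) x"
    and "\<not> (\<exists>y\<in>\<bb>. regular_element R (quotient_module K (mult_submodule R {x} K)) y)"
  shows "\<not> cohen_macaulay_module R \<mm> K"
proof
  assume cm: "cohen_macaulay_module R \<mm> K"
  interpret noetherian_local_ring R \<mm> by fact
  obtain i where i: "d = Suc i" using \<open>d \<ge> 3\<close> by (cases d) auto
  interpret C: top_local_cohomology R \<mm> I \<delta> \<aa> i
  proof (intro top_local_cohomology.intro injective_complex.intro injective_complex_axioms.intro
      top_local_cohomology_axioms.intro noetherian_local_ring_axioms noetherian_cring_axioms)
    note res = assms(7)[unfolded injective_resolution_def]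
    show "injective_module R (I n)" for n using res by (elim conjE) (erule spec)
    show "\<delta> n \<in> module_hom R (I n) (I (Suc n))" for n using res by (elim conjE) (erule spec)
    show "\<delta> n ` carrier (I n) = {x \<in> carrier (I (Suc n)). \<delta> (Suc n) x = \<zero>\<^bsub>I (Suc (Suc n))\<^esub>}" for n
      using res by (elim conjE) (erule spec)
    show "ideal \<aa> R" by fact
    show "krull_dim R = enat (Suc i)" using assms(5) i by simp
  qed
  have H: "H = local_cohomology R \<aa> I \<delta> (Suc i)" by (simp add: H_def i)
  have mK: "module R K"
    unfolding K_def matlis_dual_def H using assms(8)
    by (intro module_Hom_module C.module_local_cohomology) (simp add: injective_hull_def injective_module_def)
  interpret K: module R K by (rule mK)
  have xR: "x \<in> carrier R" using assms(14) by (simp add: regular_element_def)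
  let ?N = "mult_submodule R {x} K"
  have N: "submodule ?N R K" using mult_submodule_props(1)[OF mK] xR by simp
  have zd: "\<not> K.regular_mod ?N y" if "y \<in> \<bb>" for y
    using assms(15) that regular_element_quotient_iff[OF mK N] by blast
  \<comment> \<open>1 is regular on every module, even on the zero module.\<close>
  have "\<one>\<^bsub>R\<^esub> \<notin> \<bb>" using zd[of "\<one>\<^bsub>R\<^esub>"] by (auto simp: K.regular_mod_def)
  then have "\<bb> \<subseteq> \<mm>" by (rule proper_ideal_subset[OF assms(11)])
  have "carrier K \<noteq> {\<zero>\<^bsub>K\<^esub>}"
    \<comment> \<open>On the zero module \<open>x\<close> itself would be regular, so the degenerate
      alternative in \<open>cohen_macaulay_module\<close> is excluded.\<close>
    using zd[OF assms(13)] K.submoduleD(2)[OF N] xR by (auto simp: K.regular_mod_def)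
  then have fg: "fin_gen_module R K" and dd: "depth R \<mm> K = module_dim R K"
    using cm by (auto simp: cohen_macaulay_module_def)
  interpret local_noetherian_module R \<mm> K
    using noetherian_module_of_fin_gen[OF noetherian_cring_axioms fg mK]
    by (intro local_noetherian_module.intro noetherian_local_ring_axioms)

  have "enat d \<le> module_dim R K"
  proof -
    obtain c where "prime_chain R d c" "annihilator R K \<subseteq> c 0"
      using C.matlis_dual_annihilator_chain[OF assms(8)] assms(10) unfolding K_def H i by blast
    then show ?thesis
      unfolding module_dim_def by (rule krull_dim_Quot_ge[OF annihilator_ideal[OF mK]])
  qed
  then have "enat d \<le> Sup {enat (length rs) | rs. set rs \<subseteq> \<mm> \<and> regular_sequence R K rs}"
    using dd by (simp add: depth_def)
  \<comment> \<open>The depth is a supremum, not yet known to be finite, so the sequence is merely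
    at least as long as \<open>d\<close>.\<close>
  then obtain rs where rs: "set rs \<subseteq> \<mm>" "regular_sequence R K rs" "d \<le> length rs"
    by (rule Sup_enat_ge_obtain) (use \<open>d \<ge> 3\<close> in auto)
  have seq: "K.regular_seq_mod {\<zero>\<^bsub>K\<^esub>} rs"
    using regular_sequence_imp[OF mK rs(2)] rs(1) max_ideal(3) by blast

  have "K.regular_mod {\<zero>\<^bsub>K\<^esub>} x"
  proof (rule ccontr)
    assume "\<not> ?thesis"
    then obtain u where u: "u \<in> carrier K" "u \<notin> {\<zero>\<^bsub>K\<^esub>}" "x \<odot>\<^bsub>K\<^esub> u \<in> {\<zero>\<^bsub>K\<^esub>}"
      using xR unfolding K.regular_mod_def by blast
    obtain p where p: "K.assoc_prime {\<zero>\<^bsub>K\<^esub>} p" "K.colon {\<zero>\<^bsub>K\<^esub>} u \<subseteq> p"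
      using exists_assoc_prime[OF K.submodule_zero u(1,2)] .
    obtain c where c: "prime_chain R (length rs) c" "c 0 = p"
      using assoc_prime_chain[OF K.submodule_zero rs(1) seq p(1)] by blast
    \<comment> \<open>A smaller prime would prolong the chain from \<open>p\<close> beyond dim R =
      \<open>d\<close>.\<close>
    have "\<not> q \<subset> p" if q: "primeideal q R" for q
    proof
      assume "q \<subset> p"
      then have "prime_chain R (Suc d) (case_nat q c)"
        using prime_chain_Cons[OF prime_chain_take[OF c(1) rs(3)] q] c(2) by simp
      then show False using prime_chain_le_krull_dim[of R "Suc d"] assms(5) by fastforce
    qed
    moreover have "s = \<zero>\<^bsub>R\<^esub>" if "s \<in> carrier R" "x \<otimes>\<^bsub>R\<^esub> s = \<zero>\<^bsub>R\<^esub>" for s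
      using assms(14) that by (simp add: regular_element_def ring_module_def)
    ultimately have "x \<notin> p"
      using not_mem_minimal_prime_of_regular[OF xR] p(1) unfolding K.assoc_prime_def by blast
    then show False using p(2) u xR by (auto simp: K.colon_def)
  qed
  moreover have "?N = K.add_mult {\<zero>\<^bsub>K\<^esub>} x"
    using mult_submodule_insert[OF mK, of "{}" x] mult_submodule_empty[OF mK] xR by simp
  moreover have "length rs = Suc (length rs - 1)" using rs(3) \<open>d \<ge> 3\<close> by simp
  ultimately obtain c where c: "prime_chain R (length rs - 1) c" "\<bb> \<subseteq> c 0"
    using zero_divisor_ideal_chain[OF K.submodule_zero rs(1) seq, of "length rs - 1" x \<bb>]
      assms(11,13) zd \<open>\<bb> \<subseteq> \<mm>\<close> by auto
  \<comment> \<open>Here \<open>d \<ge> 3\<close> enters: one member of the sequence is spent on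
    \<open>x\<close>, and the chain above \<open>\<bb>\<close> still has length at least 2.\<close>
  have "enat 2 \<le> enat (length rs - 1)" using rs(3) \<open>d \<ge> 3\<close> by simp
  also have "\<dots> \<le> krull_dim (R Quot \<bb>)" by (rule krull_dim_Quot_ge[OF assms(11) c])
  finally show False using assms(12) by (simp add: one_enat_def)
qed

end
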